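(* Let $X$ be the space of Whitney umbrellas up to four-jets, identified with a subset of a Euclidean space. For a Whitney umbrella $f$, let $h=h_{\kappa_1}:(\mathcal{M}_0,\mathcal{E}_0)\to\mathbb{R}^3$ be its principal curvature surface with respect to the bounded principal curvature $\kappa_1$, and let $r_g(\theta)$ and $r_n(\theta)$ be the geodesic and normal curvatures at $r=0$ of the radial curve $r\mapsto h(r,\theta)$ as a curve on $h$. (1) There exists an algebraic subset $A_{rg}\subsetneq X$ such that for any $f\in X\setminus A_{rg}$, the radial curve is nonsingular at $\mathcal{E}_0$ for every $\theta$, and the number of zeros of $r_g(\theta)$ for $\theta\in\mathcal{E}_0$ is $2n-1$ for some $n\in\{1,\ldots,10\}$. (2) There exists an algebraic subset $A_{rn}\subsetneq X$ such that for any $f\in X\setminus A_{rn}$, the radial curve is nonsingular at $\mathcal{E}_0$ for every $\theta$, and the number of zeros of $r_n(\theta)$ for $\theta\in\mathcal{E}_0$ is $2n$ for some $n\in\{0,1,\ldots,7\}$.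
   Context: All maps and germs are $C^\infty$. A map-germ $f:(\mathbb{R}^2,0)\to(\mathbb{R}^3,0)$ is a Whitney umbrella if there are diffeomorphism-germs $\lambda$ of $(\mathbb{R}^2,0)$ and $\mu$ of $(\mathbb{R}^3,0)$ with $\mu\circ f\circ\lambda^{-1}(u,v)=(u,v^2,uv)$. Normal form: by an orientation preserving diffeomorphism-germ of the source and an element of $SO(3)$ in the target, a Whitney umbrella can be brought to the form $$f(u,v)=\big(u,\;u^2f_{21}(u)+v^2,\;u^2f_{31}(u)+v^2(uf_{321}(u)+vf_{322}(u,v))+uvf_{331}(u)\big),\qquad f_{331}(0)>0,$$ where $f_{21},f_{31},f_{321},f_{331}$ are function-germs of one variable and $f_{322}$ of two variables, and these functions are uniquely determined by $f$. Space $X$: $X$ is the set of tuples $(j^2f_{21}(0),j^2f_{31}(0),j^1f_{321}(0),j^1f_{322}(0,0),j^2f_{331}(0))$ with $f_{331}(0)>0$ (jets include the constant term), regarded as a subset of a Euclidean space via Taylor coefficients; it parametrizes four-jets of Whitney umbrellas up to source diffeomorphisms and $SO(3)$. An algebraic subset of $X$ is the zero set in $X$ of polynomials in these coordinates. Writing $f\in X\setminus A$ means that $f$ is a Whitney umbrella, written in normal form, whose tuple of jets lies in $X\setminus A$. Blow-up: $\mathcal{M}$ is the quotient of $\mathbb{R}\times(\mathbb{R}/2\pi\mathbb{Z})$ by $(r,\theta)\sim(-r,\theta+\pi)$, with $\pi:\mathcal{M}\to\mathbb{R}^2$, $\pi(r,\theta)=(r\cos\theta,r\sin\theta)$. One identifies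 $f$ (in normal form) with $f\circ\pi$. $\mathcal{E}=\{(0,\theta)\in\mathcal{M}\}$, $\mathcal{E}_0=\{(0,\theta)\in\mathcal{E}:\cos\theta\neq0\}$, and $\mathcal{M}_0\subset\mathcal{M}$ is the open set of points $(r,\theta)$ such that, if $r=0$, then $(\cos\theta,\sin\theta)\notin\ker df_0$. Maps $(\mathcal{M}_0,\mathcal{E}_0)\to\cdot$ are germs along $\mathcal{E}_0$. Principal curvature surface: the unit normal $\nu$ of $f$ extends smoothly, up to sign, across $\mathcal{E}$. The principal curvatures are the roots $k$ of $\det(\mathrm{II}-k\,\mathrm{I})=0$, where $\mathrm{I},\mathrm{II}$ are the matrices of the first and second fundamental forms of $f$ in the coordinates $(u,v)$ (second with respect to $\nu$). Exactly one of them is bounded near $\mathcal{E}_0$ and it extends smoothly there; it is denoted $\kappa_1$, and $h_{\kappa_1}=f+\kappa_1\nu$. Curvatures: for fixed $\theta$ and a unit normal vector $n$ of the surface $h$, $r_g(\theta)=\det(h_r,h_{rr},n)/|h_r|^3$ and $r_n(\theta)=(h_{rr}\cdot n)/|h_r|^2$ at $(0,\theta)$. Zeros are counted as points of $\mathcal{E}_0$ (equivalently as values of $t=\tan\theta\in\mathbb{R}$). *)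

theory Defs
  imports "HOL-Analysis.Analysis"
begin

subsection \<open>Smoothness and germs\<close>

text \<open>Class \<open>C\<^sup>n\<close> on an open set \<open>S\<close>: all iterated directional derivatives up to order \<open>n\<close> exist
  and are continuous.\<close>

primrec Ck_on :: "nat \<Rightarrow> 'a::real_normed_vector set \<Rightarrow> ('a \<Rightarrow> 'b::real_normed_vector) \<Rightarrow> bool" where
  "Ck_on 0 S f \<longleftrightarrow> continuous_on S f"
| "Ck_on (Suc n) S f \<longleftrightarrow>
     (\<forall>x\<in>S. f differentiable (at x)) \<and> (\<forall>v. Ck_on n S (\<lambda>x. frechet_derivative f (at x) v))"

definition smooth_on :: "'a::real_normed_vector set \<Rightarrow> ('a \<Rightarrow> 'b::real_normed_vector) \<Rightarrow> bool" where
  "smooth_on S f \<longleftrightarrow> (\<forall>n. Ck_on n S f)"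

text \<open>Germs are represented by total functions, of which only the behaviour near the base point
  (or the base set) matters.\<close>

definition smooth_germ :: "('a::real_normed_vector \<Rightarrow> 'b::real_normed_vector) \<Rightarrow> bool" where
  "smooth_germ f \<longleftrightarrow> (\<exists>S. open S \<and> 0 \<in> S \<and> smooth_on S f)"

definition diffeo_germ ::
    "('a::real_normed_vector \<Rightarrow> 'a) \<Rightarrow> ('a \<Rightarrow> 'a) \<Rightarrow> bool"  \<comment> \<open>a diffeomorphism-germ at \<open>0\<close> and its inverse\<close> where
  "diffeo_germ \<phi> \<psi> \<longleftrightarrow> \<phi> 0 = 0 \<and>
     (\<exists>S T. open S \<and> 0 \<in> S \<and> open T \<and> homeomorphism S T \<phi> \<psi> \<and> smooth_on S \<phi> \<and> smooth_on T \<psi>)"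

text \<open>Partial derivatives with respect to the first and the second coordinate of \<open>\<real>\<^sup>2\<close>.\<close>

definition pd1 :: "(real \<times> real \<Rightarrow> 'b::real_normed_vector) \<Rightarrow> real \<times> real \<Rightarrow> 'b" where
  "pd1 f p = frechet_derivative f (at p) (1, 0)"

definition pd2 :: "(real \<times> real \<Rightarrow> 'b::real_normed_vector) \<Rightarrow> real \<times> real \<Rightarrow> 'b" where
  "pd2 f p = frechet_derivative f (at p) (0, 1)"


subsection \<open>Whitney umbrellas, their normal form, and the jet space\<close>

definition whitney_umbrella :: "(real \<times> real \<Rightarrow> real^3) \<Rightarrow> bool" where
  "whitney_umbrella f \<longleftrightarrow> smooth_germ f \<and> f 0 = 0 \<and>
     (\<exists>\<phi> \<psi> \<mu> \<mu>'. diffeo_germ \<phi> \<psi> \<and> diffeo_germ \<mu> \<mu>' \<and>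
        (\<forall>\<^sub>F (u, v) in nhds (0, 0). \<mu> (f (\<psi> (u, v))) = vector [u, v\<^sup>2, u * v]))"

definition in_normal_form ::
    "(real \<times> real \<Rightarrow> real^3) \<Rightarrow> (real \<Rightarrow> real) \<Rightarrow> (real \<Rightarrow> real) \<Rightarrow> (real \<Rightarrow> real)
      \<Rightarrow> (real \<times> real \<Rightarrow> real) \<Rightarrow> (real \<Rightarrow> real) \<Rightarrow> bool" where
  "in_normal_form f f21 f31 f321 f322 f331 \<longleftrightarrow>
     smooth_germ f21 \<and> smooth_germ f31 \<and> smooth_germ f321 \<and> smooth_germ f322 \<and> smooth_germ f331 \<and>
     f331 0 > 0 \<and>
     (\<forall>\<^sub>F (u, v) in nhds (0, 0). f (u, v) =
        vector [u,
                u\<^sup>2 * f21 u + v\<^sup>2,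
                u\<^sup>2 * f31 u + v\<^sup>2 * (u * f321 u + v * f322 (u, v)) + u * v * f331 u])"

text \<open>The Euclidean space \<open>\<real>\<^sup>1\<^sup>4\<close> of Taylor coefficients, grouped by coefficient function. Each block
  lists the Taylor coefficients of the jet, the constant term first.\<close>

type_synonym jet_coords =
  "(real \<times> real \<times> real) \<times> (real \<times> real \<times> real) \<times> (real \<times> real) \<times>
   (real \<times> real \<times> real) \<times> (real \<times> real \<times> real)"

definition jet1 :: "(real \<Rightarrow> real) \<Rightarrow> real \<times> real" where
  "jet1 g = (g 0, deriv g 0)"

definition jet2 :: "(real \<Rightarrow> real) \<Rightarrow> real \<times> real \<times> real" where
  "jet2 g = (g 0, deriv g 0, deriv (deriv g) 0 / 2)"

definition jet1_2var :: "(real \<times> real \<Rightarrow> real) \<Rightarrow> real \<times> real \<times> real" where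
  "jet1_2var g = (g (0, 0), pd1 g (0, 0), pd2 g (0, 0))"

text \<open>The parameter space \<open>X\<close>; \<open>a\<close> is the coordinate \<open>f331 0\<close>.\<close>

definition jet_space :: "jet_coords set" where
  "jet_space = {(j21, j31, j321, j322, (a, a', a'')). a > 0}"

definition algebraic_in_jet_space :: "jet_coords set \<Rightarrow> bool" where
  "algebraic_in_jet_space A \<longleftrightarrow>
     (\<exists>P. (\<forall>p\<in>P. real_polynomial_function p) \<and> A = {x \<in> jet_space. \<forall>p\<in>P. p x = 0})"

text \<open>\<open>umbrella_in f S\<close>: \<open>f\<close> is a Whitney umbrella, written in normal form, whose tuple of jets
  lies in \<open>S\<close>.\<close>

definition umbrella_in :: "(real \<times> real \<Rightarrow> real^3) \<Rightarrow> jet_coords set \<Rightarrow> bool" where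
  "umbrella_in f S \<longleftrightarrow> whitney_umbrella f \<and>
     (\<exists>f21 f31 f321 f322 f331. in_normal_form f f21 f31 f321 f322 f331 \<and>
        (jet2 f21, jet2 f31, jet1 f321, jet1_2var f322, jet2 f331) \<in> S)"


subsection \<open>The blow-up\<close>

text \<open>Points of the blow-up \<open>\<M>\<close> are classes of pairs \<open>(r, \<theta>)\<close> under the relation
  \<open>blowup_rel\<close>, which is generated by \<open>(r, \<theta>) \<sim> (-r, \<theta> + \<pi>)\<close> and contains \<open>(r, \<theta>) \<sim> (r, \<theta> + 2\<pi>)\<close>.
  Subsets of \<open>\<M>\<close> and maps on them are given on the covering plane \<open>\<real> \<times> \<real>\<close>.\<close>

definition blowup_rel :: "((real \<times> real) \<times> (real \<times> real)) set" where
  "blowup_rel = {((r, \<theta>), (r', \<theta>')).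
     \<exists>k::int. \<theta>' = \<theta> + of_int k * pi \<and> r' = (if even k then r else - r)}"

lemma equiv_blowup_rel: "equiv UNIV blowup_rel"
proof (rule equivI)
  show "refl blowup_rel"
    by (auto simp: refl_on_def blowup_rel_def intro: exI[of _ 0])
  show "sym blowup_rel"
  proof (rule symI, clarify)
    fix r \<theta> r' \<theta>' assume "((r, \<theta>), (r', \<theta>')) \<in> blowup_rel"
    then obtain k :: int where "\<theta>' = \<theta> + of_int k * pi" "r' = (if even k then r else - r)"
      by (auto simp: blowup_rel_def)
    then show "((r', \<theta>'), (r, \<theta>)) \<in> blowup_rel"
      by (auto simp: blowup_rel_def intro!: exI[of _ "- k"])
  qed
  show "trans blowup_rel"
  proof (rule transI, clarify)
    fix r1 t1 r2 t2 r3 t3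
    assume "((r1, t1), (r2, t2)) \<in> blowup_rel" "((r2, t2), (r3, t3)) \<in> blowup_rel"
    then obtain k l :: int where
      "t2 = t1 + of_int k * pi" "r2 = (if even k then r1 else - r1)"
      "t3 = t2 + of_int l * pi" "r3 = (if even l then r2 else - r2)"
      by (auto simp: blowup_rel_def)
    then show "((r1, t1), (r3, t3)) \<in> blowup_rel"
      by (auto simp: blowup_rel_def algebra_simps intro!: exI[of _ "k + l"])
  qed
qed simp_all

definition blowup_map :: "real \<times> real \<Rightarrow> real \<times> real" where
  "blowup_map = (\<lambda>(r, \<theta>). (r * cos \<theta>, r * sin \<theta>))"

definition exc_set0 :: "(real \<times> real) set" where  \<comment> \<open>\<open>\<E>\<^sub>0\<close>\<close>
  "exc_set0 = {(r, \<theta>). r = 0 \<and> cos \<theta> \<noteq> 0}"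

definition blowup_M0 :: "(real \<times> real \<Rightarrow> real^3) \<Rightarrow> (real \<times> real) set" where  \<comment> \<open>\<open>\<M>\<^sub>0\<close>\<close>
  "blowup_M0 f = {(r, \<theta>). r = 0 \<longrightarrow> frechet_derivative f (at 0) (cos \<theta>, sin \<theta>) \<noteq> 0}"


subsection \<open>The principal curvature surface\<close>

definition unit_normal_at :: "(real \<times> real \<Rightarrow> real^3) \<Rightarrow> real \<times> real \<Rightarrow> real^3 \<Rightarrow> bool" where
  "unit_normal_at f p n \<longleftrightarrow> norm n = 1 \<and> n \<bullet> pd1 f p = 0 \<and> n \<bullet> pd2 f p = 0"

definition first_form :: "(real \<times> real \<Rightarrow> real^3) \<Rightarrow> real \<times> real \<Rightarrow> real^2^2" where
  "first_form f p = vector [vector [pd1 f p \<bullet> pd1 f p, pd1 f p \<bullet> pd2 f p],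
                            vector [pd2 f p \<bullet> pd1 f p, pd2 f p \<bullet> pd2 f p]]"

definition second_form :: "(real \<times> real \<Rightarrow> real^3) \<Rightarrow> real^3 \<Rightarrow> real \<times> real \<Rightarrow> real^2^2" where
  "second_form f n p = vector [vector [pd1 (pd1 f) p \<bullet> n, pd2 (pd1 f) p \<bullet> n],
                               vector [pd1 (pd2 f) p \<bullet> n, pd2 (pd2 f) p \<bullet> n]]"

definition principal_curvature :: "(real \<times> real \<Rightarrow> real^3) \<Rightarrow> real^3 \<Rightarrow> real \<times> real \<Rightarrow> real \<Rightarrow> bool" where
  "principal_curvature f n p k \<longleftrightarrow> det (second_form f n p - k *\<^sub>R first_form f p) = 0"

text \<open>\<open>principal_curvature_surface f h\<close>: near \<open>\<E>\<^sub>0\<close>, \<open>h = f \<circ> \<pi> + \<kappa>\<^sub>1 \<nu>\<close>, where \<open>\<nu>\<close> and \<open>\<kappa>\<^sub>1\<close> are the smooth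
  extensions across \<open>r = 0\<close> of the unit normal and of the bounded principal curvature. A principal
  curvature that extends smoothly across \<open>\<E>\<^sub>0\<close> is bounded near each of its points, which singles out
  \<open>\<kappa>\<^sub>1\<close>. Reversing \<open>\<nu>\<close> also reverses \<open>\<kappa>\<^sub>1\<close>; hence the germ of \<open>h\<close> along \<open>\<E>\<^sub>0\<close> depends
  neither on the sign of \<open>\<nu>\<close> nor on the choice of a lift of a point of \<open>\<M>\<close>.\<close>

definition principal_curvature_surface ::
    "(real \<times> real \<Rightarrow> real^3) \<Rightarrow> (real \<times> real \<Rightarrow> real^3) \<Rightarrow> bool" where
  "principal_curvature_surface f h \<longleftrightarrow>
     (\<exists>U \<nu> \<kappa>. open U \<and> exc_set0 \<subseteq> U \<and> U \<subseteq> blowup_M0 f \<and> smooth_on U \<nu> \<and> smooth_on U \<kappa> \<and>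
        (\<forall>p\<in>U. fst p \<noteq> 0 \<longrightarrow>
           unit_normal_at f (blowup_map p) (\<nu> p) \<and>
           principal_curvature f (\<nu> p) (blowup_map p) (\<kappa> p)) \<and>
        (\<forall>p\<in>U. h p = f (blowup_map p) + \<kappa> p *\<^sub>R \<nu> p))"


subsection \<open>Curvatures of the radial curves\<close>

definition unit_normals_exc :: "(real \<times> real \<Rightarrow> real^3) \<Rightarrow> (real \<Rightarrow> real^3) \<Rightarrow> bool" where
  "unit_normals_exc h n \<longleftrightarrow> (\<forall>\<theta>. (0, \<theta>) \<in> exc_set0 \<longrightarrow> unit_normal_at h (0, \<theta>) (n \<theta>))"

definition radial_nonsingular :: "(real \<times> real \<Rightarrow> real^3) \<Rightarrow> bool" where
  "radial_nonsingular h \<longleftrightarrow> (\<forall>\<theta>. (0, \<theta>) \<in> exc_set0 \<longrightarrow> pd1 h (0, \<theta>) \<noteq> 0)"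

definition radial_geodesic_curvature :: "(real \<times> real \<Rightarrow> real^3) \<Rightarrow> (real \<Rightarrow> real^3) \<Rightarrow> real \<Rightarrow> real" where
  "radial_geodesic_curvature h n \<theta> =
     det (vector [pd1 h (0, \<theta>), pd1 (pd1 h) (0, \<theta>), n \<theta>] :: real^3^3) / norm (pd1 h (0, \<theta>)) ^ 3"

definition radial_normal_curvature :: "(real \<times> real \<Rightarrow> real^3) \<Rightarrow> (real \<Rightarrow> real^3) \<Rightarrow> real \<Rightarrow> real" where
  "radial_normal_curvature h n \<theta> = (pd1 (pd1 h) (0, \<theta>) \<bullet> n \<theta>) / (norm (pd1 h (0, \<theta>)))\<^sup>2"

text \<open>The zeros of a function of \<open>\<theta>\<close>, as points of \<open>\<E>\<^sub>0\<close>, that is, as classes in \<open>\<M>\<close>.\<close>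

definition zeros_exc :: "(real \<Rightarrow> real) \<Rightarrow> (real \<times> real) set set" where
  "zeros_exc c = {p \<in> exc_set0. c (snd p) = 0} // blowup_rel"

end

theory Submission
  imports Defs "Subresultants.Resultant_Prelim"
begin

text \<open>
  Fix \<open>\<theta>\<close> and put \<open>t = tan \<theta>\<close>. Along the ray \<open>(u, v) = (r, r t)\<close> the normal vector \<open>f\<^sub>u \<times> f\<^sub>v\<close> is
  \<open>r N\<close> with \<open>N \<noteq> 0\<close> at \<open>r = 0\<close>. With \<open>K = \<kappa>\<^sub>1 (\<nu> \<bullet> N)\<close> the square roots disappear: \<open>h = f + K N / |N|\<^sup>2\<close>, and
  the quadratic equation for \<open>K\<close> determines the two-jet of \<open>K\<close> in \<open>r\<close> rationally in \<open>t\<close> and the jet of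
  \<open>f\<close>. Up to nonzero factors, \<open>r\<^sub>g\<close> and \<open>r\<^sub>n\<close> are therefore polynomials in \<open>t\<close>, of degrees 19 and 14,
  whose coefficients are polynomials in the jet. Where the leading coefficient and the resultant with
  the derivative do not vanish, all real roots are simple, so their number has the parity of the degree
  and is at most the degree. Further polynomial conditions make \<open>h\<close> an immersion along the exceptional
  set. One explicit jet shows that the exceptional algebraic sets are proper.
\<close>

subsection \<open>Polynomials with parameters and resultants\<close>

text \<open>The first fundamental form degenerates at \<open>r = 0\<close>: its entry for
  \<open>v\<close> vanishes there to second order. The quadratic equation for the principal
  curvatures then loses its leading term, one root escapes to infinity, and the other solves a
  linear equation with slope \<open>2 * a\<close>. This is why the jet of \<open>K\<close> comes out
  order by order without radicals. The equation is known only for \<open>r \<noteq> 0\<close>, so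
  jets are limits at a punctured point and are compared by uniqueness.

  The bounds on the number of zeros depend on the exact degrees. Spare powers of \<open>w\<close> in
  the numerators would add no real zero but would raise the degree, so they must be divided out
  explicitly.

  The Sylvester matrix is built with prescribed formal degrees, so that its determinant is a single
  polynomial in the jet. For \<open>fam_rg\<close> and its derivative it has 37 rows; a Bezout
  identity at one jet certifies that the determinant is nonzero there, without expanding it.

  The unit normal of \<open>h\<close> is constrained only by orthogonality. It is determined up to
  sign where \<open>h\<close> is an immersion, and the further conditions on the jet secure
  this.\<close>

hide_const (open) Determinant.det

text \<open>\<open>d\<close> is a bound, not the degree: leading coefficients may vanish at some
  parameters. It plays the role of the formal degree that fixes the size of a Sylvester
  matrix.\<close>

definition poly_family :: "nat \<Rightarrow> ('a::real_normed_vector \<Rightarrow> real poly) \<Rightarrow> bool" where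
  "poly_family d P \<longleftrightarrow> (\<forall>x. degree (P x) \<le> d) \<and> (\<forall>i. real_polynomial_function (\<lambda>x. coeff (P x) i))"

lemma poly_family_degree: "poly_family d P \<Longrightarrow> degree (P x) \<le> d"
  by (simp add: poly_family_def)

lemma poly_family_coeff: "poly_family d P \<Longrightarrow> real_polynomial_function (\<lambda>x. coeff (P x) i)"
  by (simp add: poly_family_def)

lemma poly_family_mono: "poly_family d P \<Longrightarrow> d \<le> e \<Longrightarrow> poly_family e P"
  by (meson order_trans poly_family_def)

lemma poly_family_const: "poly_family (degree p) (\<lambda>x. p)"
  by (auto simp: poly_family_def)

lemma poly_family_pCons:
  assumes "real_polynomial_function f" "poly_family d P"
  shows "poly_family (Suc d) (\<lambda>x. pCons (f x) (P x))"
  unfolding poly_family_def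
proof (intro conjI allI)
  show "degree (pCons (f x) (P x)) \<le> Suc d" for x
    using assms(2) degree_pCons_le[of "f x" "P x"] by (metis Suc_le_mono order_trans poly_family_def)
  show "real_polynomial_function (\<lambda>x. coeff (pCons (f x) (P x)) i)" for i
    using assms by (cases i) (auto simp: poly_family_def)
qed

lemma poly_family_coeff_const: "real_polynomial_function f \<Longrightarrow> poly_family 0 (\<lambda>x. [:f x:])"
  using poly_family_pCons[of f 0 "\<lambda>x. 0"]
  by (auto simp: poly_family_def)

lemma poly_family_add:
  "poly_family d P \<Longrightarrow> poly_family d Q \<Longrightarrow> poly_family d (\<lambda>x. P x + Q x)"
  by (auto simp: poly_family_def intro: degree_add_le)

lemma poly_family_diff:
  "poly_family d P \<Longrightarrow> poly_family d Q \<Longrightarrow> poly_family d (\<lambda>x. P x - Q x)"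
  by (auto simp: poly_family_def intro: degree_diff_le)

lemma poly_family_mult:
  assumes "poly_family d P" "poly_family e Q"
  shows "poly_family (d + e) (\<lambda>x. P x * Q x)"
  unfolding poly_family_def
proof (intro conjI allI)
  show "degree (P x * Q x) \<le> d + e" for x
    using assms degree_mult_le[of "P x" "Q x"] by (meson add_mono order_trans poly_family_def)
  show "real_polynomial_function (\<lambda>x. coeff (P x * Q x) i)" for i
    unfolding coeff_mult using assms
    by (intro real_polynomial_function_sum real_polynomial_function.intros(4)) (auto simp: poly_family_def)
qed

lemma poly_family_power:
  "poly_family d P \<Longrightarrow> poly_family (n * d) (\<lambda>x. P x ^ n)"
proof (induction n)
  case 0
  show ?case using poly_family_const[of 1] by simp
next
  case (Suc n)
  then show ?case using poly_family_mult[of d P "n * d" "\<lambda>x. P x ^ n"] by simp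
qed

lemma poly_family_pderiv:
  assumes "poly_family d P"
  shows "poly_family (d - 1) (\<lambda>x. pderiv (P x))"
  using assms by (auto simp: poly_family_def coeff_pderiv degree_pderiv intro: diff_le_mono)

text \<open>The size of the matrix does not depend on \<open>x\<close>, and its entries are
  coefficients or zero; the Leibniz formula is then a fixed polynomial in these
  coefficients.\<close>

lemma real_polynomial_function_resultant_sub:
  assumes "poly_family m P" "poly_family n Q"
  shows "real_polynomial_function (\<lambda>x. resultant_sub m n (P x) (Q x))"
proof -
  have entry: "real_polynomial_function (\<lambda>x. sylvester_mat_sub m n (P x) (Q x) $$ (i, j))"
    if "i < m + n" "j < m + n" for i j
    using assms
    unfolding sylvester_mat_sub_index[OF that]
    by (cases "i < n"; cases "i \<le> j \<and> j - i \<le> m"; cases "i - n \<le> j"; cases "j \<le> i")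
      (simp_all add: poly_family_coeff real_polynomial_function.intros(2))
  have "resultant_sub m n (P x) (Q x) = (\<Sum>p\<in>{p. p permutes {0..<m+n}}.
      signof p * (\<Prod>i = 0..<m+n. sylvester_mat_sub m n (P x) (Q x) $$ (i, p i)))" for x
    unfolding resultant_sub_def by (rule det_def') (rule sylvester_mat_sub_carrier)
  moreover have "p i < m + n" if "p permutes {0..<m+n}" "i < m + n" for p i
    using permutes_in_image[OF that(1), of i] that(2) by simp
  ultimately show ?thesis
    by (auto intro!: real_polynomial_function.intros(2,4) real_polynomial_function_sum
        real_polynomial_function_prod entry finite_permutations)
qed

text \<open>The rows are the coefficient vectors of \<open>p\<close> and \<open>q\<close> times
  powers of the variable, so the vector of powers of a common root lies in the kernel.\<close>

lemma resultant_sub_common_root: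
  fixes p q :: "real poly"
  assumes "degree p \<le> m" "degree q \<le> n" "0 < m + n" "poly p t = 0" "poly q t = 0"
  shows "resultant_sub m n p q = 0"
proof -
  define v where "v = vec (m + n) (\<lambda>j. t ^ (m + n - 1 - j))"
  let ?S = "sylvester_mat_sub m n p q"
  have poly_shift: "(\<Sum>j<m+n. (if i \<le> j \<and> j - i \<le> d then coeff r (d + i - j) else 0) * t ^ (m + n - 1 - j))
      = t ^ (m + n - 1 - d - i) * poly r t"
    if "degree r \<le> d" "i + d < m + n" for r d i
  proof -
    have "(\<Sum>j<m+n. (if i \<le> j \<and> j - i \<le> d then coeff r (d + i - j) else 0) * t ^ (m + n - 1 - j))
        = (\<Sum>j\<in>{i..i+d}. coeff r (d + i - j) * t ^ (m + n - 1 - j))"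
      using that(2) by (intro sum.mono_neutral_cong_right) auto
    also have "\<dots> = (\<Sum>k\<le>d. coeff r k * t ^ (m + n - 1 - d - i + k))"
      using that(2) by (intro sum.reindex_bij_witness[of _ "\<lambda>k. d + i - k" "\<lambda>j. d + i - j"])
        (auto intro!: arg_cong2[of _ _ _ _ "(*)"] arg_cong2[of _ _ _ _ "(^)"])
    also have "\<dots> = t ^ (m + n - 1 - d - i) * (\<Sum>k\<le>d. coeff r k * t ^ k)"
      by (simp add: sum_distrib_left power_add algebra_simps)
    also have "(\<Sum>k\<le>d. coeff r k * t ^ k) = poly r t"
      unfolding poly_altdef using that(1)
      by (intro sum.mono_neutral_right) (auto simp: coeff_eq_0)
    finally show ?thesis .
  qed
  have "?S *\<^sub>v v = 0\<^sub>v (m + n)"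
  proof (rule eq_vecI)
    fix i assume i: "i < dim_vec (0\<^sub>v (m + n))"
    have "(?S *\<^sub>v v) $ i = (\<Sum>j<m+n. ?S $$ (i, j) * t ^ (m + n - 1 - j))"
      using i by (simp add: v_def scalar_prod_def atLeast0LessThan)
    also have "\<dots> = 0"
    proof (cases "i < n")
      case True
      have "(\<Sum>j<m+n. ?S $$ (i, j) * t ^ (m + n - 1 - j))
          = (\<Sum>j<m+n. (if i \<le> j \<and> j - i \<le> m then coeff p (m + i - j) else 0) * t ^ (m + n - 1 - j))"
        using i True by (intro sum.cong) (auto simp: sylvester_mat_sub_index)
      then show ?thesis
        using poly_shift[OF assms(1), of i] assms(4) True by simp
    next
      case False
      have "(\<Sum>j<m+n. ?S $$ (i, j) * t ^ (m + n - 1 - j))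
          = (\<Sum>j<m+n. (if i - n \<le> j \<and> j - (i - n) \<le> n then coeff q (n + (i - n) - j) else 0) * t ^ (m + n - 1 - j))"
        using i False by (intro sum.cong) (auto simp: sylvester_mat_sub_index)
      then show ?thesis
        using poly_shift[OF assms(2), of "i - n"] assms(5) False i by simp
    qed
    finally show "(?S *\<^sub>v v) $ i = 0\<^sub>v (m + n) $ i"
      using i by simp
  qed auto
  \<comment> \<open>The last entry is \<open>t ^ 0\<close>, so \<open>v\<close> is nonzero also for
    \<open>t = 0\<close>.\<close>
  moreover have "v $ (m + n - 1) = 1"
    using assms(3) by (simp add: v_def)
  then have "v \<noteq> 0\<^sub>v (m + n)"
    using assms(3) by auto
  ultimately show ?thesis
    unfolding resultant_sub_def det_0_iff_vec_prod_zero[OF sylvester_mat_sub_carrier]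
    by (intro exI[of _ v]) (auto simp: v_def)
qed

text \<open>A kernel vector of the transpose encodes cofactors with
  \<open>A * p + B * q = 0\<close>, where \<open>A\<close> has degree below \<open>n\<close> and
  \<open>B\<close> below \<open>m\<close>. The Bezout identity forces \<open>p\<close> to divide
  \<open>B\<close>, whose degree is too small, so both cofactors vanish. For this \<open>p\<close>
  must have its full formal degree, while \<open>q\<close> may drop.\<close>

lemma resultant_sub_nonzero:
  fixes p q :: "real poly"
  assumes bezout: "u * p + w * q = [:c:]" "c \<noteq> 0"
    and "p \<noteq> 0" "degree p = m" "degree q \<le> n"
  shows "resultant_sub m n p q \<noteq> 0"
proof
  let ?S = "sylvester_mat_sub m n p q"
  assume "resultant_sub m n p q = 0"
  then have "Determinant.det (transpose_mat ?S) = 0"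
    unfolding resultant_sub_def by (simp add: det_transpose[OF sylvester_mat_sub_carrier])
  then obtain v where v: "v \<in> carrier_vec (m + n)" "v \<noteq> 0\<^sub>v (m + n)"
      and Sv: "transpose_mat ?S *\<^sub>v v = 0\<^sub>v (m + n)"
    using det_0_iff_vec_prod_zero[of "transpose_mat ?S" "m + n"]
      sylvester_mat_sub_carrier[of m n p q] by (auto simp del: index_transpose_mat)
  define A where "A = (\<Sum>i<n. monom (v $ i) (n - 1 - i))"
  define B where "B = (\<Sum>i<m. monom (v $ (n + i)) (m - 1 - i))"
  have coeffA: "coeff A k = (if k < n then v $ (n - 1 - k) else 0)" for k
  proof -
    have "coeff A k = (\<Sum>i<n. if i = n - 1 - k \<and> k < n then v $ i else 0)"
      unfolding A_def coeff_sum by (intro sum.cong) auto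
    then show ?thesis by (auto simp: if_distrib cong: if_cong)
  qed
  have coeffB: "coeff B k = (if k < m then v $ (n + (m - 1 - k)) else 0)" for k
  proof -
    have "coeff B k = (\<Sum>i<m. if i = m - 1 - k \<and> k < m then v $ (n + i) else 0)"
      unfolding B_def coeff_sum by (intro sum.cong) auto
    then show ?thesis by (auto simp: if_distrib cong: if_cong)
  qed
  have degA: "A = 0 \<or> degree A < n" and degB: "B = 0 \<or> degree B < m"
    by (metis coeffA leading_coeff_0_iff) (metis coeffB leading_coeff_0_iff)
  have split: "(\<Sum>i<n+k. f i) = (\<Sum>i<n. f i) + (\<Sum>i<k. f (n + i))" for f :: "nat \<Rightarrow> real" and k
    by (induction k) (simp_all add: add.assoc)
  have "coeff (A * p + B * q) k = 0" for k
  proof (cases "k < m + n")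
    case True
    define j where "j = m + n - 1 - k"
    have j: "j < m + n" "k = m + n - 1 - j" using True by (auto simp: j_def)
    have "0 = (transpose_mat ?S *\<^sub>v v) $ j"
      using Sv j by simp
    also have "\<dots> = (\<Sum>i<m+n. ?S $$ (i, j) * v $ i)"
      using j v(1) by (simp add: scalar_prod_def atLeast0LessThan)
    also have "\<dots> = (\<Sum>i<n. ?S $$ (i, j) * v $ i) + (\<Sum>i<m. ?S $$ (n + i, j) * v $ (n + i))"
      by (simp add: add.commute[of m n] split)
    also have "(\<Sum>i<n. ?S $$ (i, j) * v $ i) = coeff (A * p) k"
      unfolding A_def sum_distrib_right coeff_sum using assms(4) j
      by (intro sum.cong) (auto simp: sylvester_mat_sub_index coeff_monom_mult intro: coeff_eq_0)
    also have "(\<Sum>i<m. ?S $$ (n + i, j) * v $ (n + i)) = coeff (B * q) k"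
      unfolding B_def sum_distrib_right coeff_sum using assms(5) j
      by (intro sum.cong) (auto simp: sylvester_mat_sub_index coeff_monom_mult intro: coeff_eq_0)
    finally show ?thesis by simp
  next
    case False
    have "degree (A * p) < m + n \<or> A * p = 0" "degree (B * q) < m + n \<or> B * q = 0"
      using degA degB assms(4,5) degree_mult_le[of A p] degree_mult_le[of B q] by auto
    then show ?thesis using False by (auto simp: coeff_eq_0)
  qed
  then have eq: "A * p + B * q = 0"
    by (simp add: poly_eq_iff)
  then have "p dvd B * q"
    by (metis add.commute add_eq_0_iff dvd_minus_iff dvd_triv_right)
  then have "p dvd B * u * p + w * (B * q)"
    by (rule dvd_add[OF dvd_triv_right dvd_mult])
  also have "B * u * p + w * (B * q) = B * (u * p + w * q)"
    by (simp add: algebra_simps)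
  also have "\<dots> = Polynomial.smult c B"
    by (simp add: bezout)
  finally have "p dvd B"
    by (rule dvd_smult_cancel[OF _ bezout(2)])
  then have "B = 0"
    using degB assms(4) dvd_imp_degree_le[of p B] by (metis leD)
  then have "A = 0"
    using eq assms(3) by simp
  have "v $ i = 0" if "i < m + n" for i
  proof (cases "i < n")
    case True
    then show ?thesis using coeffA[of "n - 1 - i"] \<open>A = 0\<close> by simp
  next
    case False
    define k where "k = i - n"
    have "i = n + k" "k < m" using False that by (auto simp: k_def)
    then show ?thesis using coeffB[of "m - 1 - k"] \<open>B = 0\<close> by simp
  qed
  then show False
    using v by (auto intro: eq_vecI)
qed

no_notation vec_index (infixl "$" 100)

section \<open>Counting simple real roots\<close>

lemma odd_degree_real_root:
  fixes p :: "real poly"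
  assumes "odd (degree p)"
  shows "\<exists>t. poly p t = 0"
proof -
  have pos: "\<exists>t. poly p t = 0" if odd: "odd (degree p)" and lc: "lead_coeff p > 0" for p :: "real poly"
  proof -
    \<comment> \<open>\<open>r\<close> at \<open>x\<close> is minus \<open>p\<close> at
      \<open>- x\<close>. Its leading coefficient is again positive because the degree is odd, and
      its positivity far out says that \<open>p\<close> is negative far to the left.\<close>
    define r where "r = - pcompose p [:0, -1:]"
    have "lead_coeff r = lead_coeff p"
      using odd lead_coeff_comp[of "[:0, -1:]" p] by (simp add: r_def lead_coeff_minus)
    then obtain a b where a: "\<And>x. x \<ge> a \<Longrightarrow> poly r x > 0" and b: "\<And>x. x \<ge> b \<Longrightarrow> poly p x > 0"
      using poly_pinfty_gt_lc[of p] poly_pinfty_gt_lc[of r] lc by (metis less_le_trans)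
    define x where "x = max (max a b) 1"
    have "poly p (- x) < 0" "poly p x > 0" "- x < x"
      using a[of x] b[of x] by (auto simp: r_def poly_pcompose x_def)
    then show ?thesis using poly_IVT_pos by blast
  qed
  show ?thesis
  proof (cases "lead_coeff p > 0")
    case True
    then show ?thesis using pos assms by blast
  next
    case False
    moreover have "lead_coeff p \<noteq> 0" using assms by (metis degree_0 even_zero leading_coeff_0_iff)
    ultimately have "lead_coeff (- p) > 0" by (simp add: lead_coeff_minus not_less order.strict_iff_order)
    then show ?thesis using pos[of "- p"] assms by auto
  qed
qed

text \<open>Splitting off one linear factor for each real root leaves a cofactor \<open>q\<close>. A
  real root of \<open>q\<close> would be a multiple root of \<open>p\<close>, so \<open>q\<close>
  has none and its degree is even; the number of roots therefore has the parity of
  \<open>degree p\<close>.\<close>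

lemma card_simple_real_roots:
  fixes p :: "real poly"
  assumes "p \<noteq> 0" and simple: "\<And>t. poly p t = 0 \<Longrightarrow> poly (pderiv p) t \<noteq> 0"
  shows "finite {t. poly p t = 0}" "card {t. poly p t = 0} \<le> degree p"
    "even (card {t. poly p t = 0}) \<longleftrightarrow> even (degree p)"
proof -
  let ?R = "{t. poly p t = 0}"
  show fin: "finite ?R" using assms(1) by (rule poly_roots_finite)
  show "card ?R \<le> degree p" using assms(1) by (rule card_poly_roots_bound)
  define g where "g = (\<Prod>r\<in>?R. [:- r, 1:])"
  have "(\<Prod>r\<in>S. [:- r, 1:]) dvd p" if "finite S" "S \<subseteq> ?R" for S
    using that
  proof (induction S)
    case (insert r S)
    then obtain q where q: "p = (\<Prod>r\<in>S. [:- r, 1:]) * q" by (auto elim: dvdE)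
    have "poly (\<Prod>r\<in>S. [:- r, 1:]) r \<noteq> 0"
      using insert by (auto simp: poly_prod)
    moreover have "poly p r = 0" using insert by auto
    ultimately have "poly q r = 0" by (simp add: q)
    then have "[:- r, 1:] dvd q" by (simp add: poly_eq_0_iff_dvd)
    then have "[:- r, 1:] * (\<Prod>r\<in>S. [:- r, 1:]) dvd q * (\<Prod>r\<in>S. [:- r, 1:])"
      by (rule mult_dvd_mono) simp
    then show ?case
      unfolding prod.insert[OF insert(1,2)] by (metis q mult.commute)
  qed simp
  then have "g dvd p" unfolding g_def using fin by blast
  then obtain q where q: "p = g * q" by (elim dvdE)
  have "g \<noteq> 0" "q \<noteq> 0" using assms(1) q by auto
  have "degree g = card ?R"
    unfolding g_def by (subst degree_prod_eq_sum_degree) auto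
  then have deg: "degree p = card ?R + degree q"
    using \<open>g \<noteq> 0\<close> \<open>q \<noteq> 0\<close> unfolding q by (simp add: degree_mult_eq)
  have no_root: "poly q t \<noteq> 0" for t
  proof
    assume t: "poly q t = 0"
    then have "t \<in> ?R" using q by simp
    then have "poly g t = 0" using fin by (auto simp: g_def poly_prod)
    then show False using simple[of t] t \<open>t \<in> ?R\<close> unfolding q by (simp add: pderiv_mult)
  qed
  have "even (degree q)"
    using odd_degree_real_root[of q] no_root by blast
  then show "even (card ?R) \<longleftrightarrow> even (degree p)"
    using deg by simp
qed

text \<open>The resultant serves as \<open>D\<close>, and the Bezout identity at the one parameter
  \<open>x0\<close> shows that it is not the zero polynomial.\<close>

lemma generic_no_common_root:
  assumes "poly_family m P" "poly_family n Q" "0 < m + n"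
    and "degree (P x0) = m" "P x0 \<noteq> 0" "u * P x0 + w * Q x0 = [:c:]" "c \<noteq> 0"
  shows "\<exists>D. real_polynomial_function D \<and> D x0 \<noteq> 0 \<and>
    (\<forall>x. D x \<noteq> 0 \<longrightarrow> (\<forall>t. poly (P x) t = 0 \<longrightarrow> poly (Q x) t \<noteq> 0))"
  using assms
  by (intro exI[of _ "\<lambda>x. resultant_sub m n (P x) (Q x)"])
    (auto intro: real_polynomial_function_resultant_sub resultant_sub_common_root
      dest: resultant_sub_nonzero poly_family_degree)

lemma generic_simple_roots:
  assumes P: "poly_family d P" "0 < d"
    and P0: "degree (P x0) = d" "u * P x0 + w * pderiv (P x0) = [:c:]" "c \<noteq> 0"
  shows "\<exists>D. real_polynomial_function D \<and> D x0 \<noteq> 0 \<and>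
    (\<forall>x. D x \<noteq> 0 \<longrightarrow> finite {t. poly (P x) t = 0} \<and> card {t. poly (P x) t = 0} \<le> d \<and>
      (even (card {t. poly (P x) t = 0}) \<longleftrightarrow> even d))"
proof -
  have nz: "P x0 \<noteq> 0" using P0(1) P(2) by auto
  obtain D where D: "real_polynomial_function D" "D x0 \<noteq> 0"
    and simple: "\<And>x t. D x \<noteq> 0 \<Longrightarrow> poly (P x) t = 0 \<Longrightarrow> poly (pderiv (P x)) t \<noteq> 0"
    using generic_no_common_root[OF P(1) poly_family_pderiv[OF P(1)] _ P0(1) nz P0(2,3)] P(2) by auto
  show ?thesis
  \<comment> \<open>The factor \<open>coeff (P x) d\<close> makes the degree exactly
    \<open>d\<close>, on which the parity statement rests.\<close>
  proof (intro exI[of _ "\<lambda>x. coeff (P x) d * D x"] conjI allI impI)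
    show "real_polynomial_function (\<lambda>x. coeff (P x) d * D x)"
      using D(1) P(1) by (intro real_polynomial_function.intros(4) poly_family_coeff)
    show "coeff (P x0) d * D x0 \<noteq> 0"
      using D(2) P0(1) nz by auto
    fix x assume x: "coeff (P x) d * D x \<noteq> 0"
    then have "P x \<noteq> 0" "degree (P x) = d"
      using poly_family_degree[OF P(1), of x] le_degree[of "P x" d] by auto
    then show "finite {t. poly (P x) t = 0}" "card {t. poly (P x) t = 0} \<le> d"
      "even (card {t. poly (P x) t = 0}) \<longleftrightarrow> even d"
      using card_simple_real_roots[of "P x"] simple[of x] x by auto
  qed
qed

subsection \<open>Second-order jets\<close>

text \<open>Peano form of the Taylor expansion. Neither derivatives nor the value at 0 occur, so it
  applies to functions whose equations hold only off 0, and it can be propagated through sums and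
  products purely algebraically.\<close>

definition has_jet2 :: "(real \<Rightarrow> real) \<Rightarrow> real \<Rightarrow> real \<Rightarrow> real \<Rightarrow> bool" where
  "has_jet2 g a b c \<longleftrightarrow> ((\<lambda>x. (g x - (a + b * x + c * x\<^sup>2)) / x\<^sup>2) \<longlongrightarrow> 0) (at 0)"

lemma has_jet2_cong:
  assumes "\<forall>\<^sub>F x in at 0. g x = g' x"
  shows "has_jet2 g a b c \<longleftrightarrow> has_jet2 g' a b c"
  unfolding has_jet2_def using assms by (intro filterlim_cong refl) (auto elim: eventually_mono)

lemma has_jet2_eq: "has_jet2 g a b c \<Longrightarrow> a = a' \<Longrightarrow> b = b' \<Longrightarrow> c = c' \<Longrightarrow> has_jet2 g a' b' c'"
  by simp

lemma has_jet2_const: "has_jet2 (\<lambda>x. k) k 0 0"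
  by (simp add: has_jet2_def)

lemma has_jet2_ident: "has_jet2 (\<lambda>x. x) 0 1 0"
  by (simp add: has_jet2_def)

lemma has_jet2_tendsto:
  assumes "has_jet2 g a b c"
  shows "(g \<longlongrightarrow> a) (at 0)"
proof -
  have "((\<lambda>x. (g x - (a + b * x + c * x\<^sup>2)) / x\<^sup>2 * x\<^sup>2 + (a + b * x + c * x\<^sup>2)) \<longlongrightarrow>
      0 * 0\<^sup>2 + (a + b * 0 + c * 0\<^sup>2)) (at 0)"
    using assms unfolding has_jet2_def by (intro tendsto_intros)
  moreover have "\<forall>\<^sub>F x in at 0. (g x - (a + b * x + c * x\<^sup>2)) / x\<^sup>2 * x\<^sup>2 + (a + b * x + c * x\<^sup>2) = g x"
    by (auto simp: eventually_at_filter)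
  ultimately show ?thesis
    by (simp add: tendsto_cong)
qed

lemma has_jet2_add:
  assumes "has_jet2 f a b c" "has_jet2 g a' b' c'"
  shows "has_jet2 (\<lambda>x. f x + g x) (a + a') (b + b') (c + c')"
  using tendsto_add[OF assms[unfolded has_jet2_def]] unfolding has_jet2_def
  by (simp add: add_divide_distrib diff_divide_distrib algebra_simps)

lemma has_jet2_minus:
  assumes "has_jet2 f a b c"
  shows "has_jet2 (\<lambda>x. - f x) (- a) (- b) (- c)"
  using tendsto_minus[OF assms[unfolded has_jet2_def]] unfolding has_jet2_def
  by (simp add: add_divide_distrib diff_divide_distrib algebra_simps)

lemma has_jet2_diff:
  assumes "has_jet2 f a b c" "has_jet2 g a' b' c'"
  shows "has_jet2 (\<lambda>x. f x - g x) (a - a') (b - b') (c - c')"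
  using has_jet2_add[OF assms(1) has_jet2_minus[OF assms(2)]] by simp

lemma has_jet2_mult:
  assumes "has_jet2 f a b c" "has_jet2 g a' b' c'"
  shows "has_jet2 (\<lambda>x. f x * g x) (a * a') (a * b' + b * a') (a * c' + b * b' + c * a')"
proof -
  let ?p = "\<lambda>x. a + b * x + c * x\<^sup>2" and ?q = "\<lambda>x. a' + b' * x + c' * x\<^sup>2"
  \<comment> \<open>The error of the product is \<open>(f - p) g + p (g - q)\<close> plus the terms
    of orders 3 and 4 in the product of the Taylor polynomials; after division by
    \<open>x\<^sup>2\<close> the latter still tend to 0.\<close>
  have "((\<lambda>x. (f x - ?p x) / x\<^sup>2 * g x + ?p x * ((g x - ?q x) / x\<^sup>2) + ((b * c' + c * b') * x + c * c' * x\<^sup>2)) \<longlongrightarrow>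
      0 * a' + (a + b * 0 + c * 0\<^sup>2) * 0 + ((b * c' + c * b') * 0 + c * c' * 0\<^sup>2)) (at 0)"
    using assms has_jet2_tendsto[OF assms(2)] unfolding has_jet2_def by (intro tendsto_intros)
  moreover have "\<forall>\<^sub>F x in at 0. (f x - ?p x) / x\<^sup>2 * g x + ?p x * ((g x - ?q x) / x\<^sup>2) + ((b * c' + c * b') * x + c * c' * x\<^sup>2)
     = (f x * g x - (a * a' + (a * b' + b * a') * x + (a * c' + b * b' + c * a') * x\<^sup>2)) / x\<^sup>2"
    by (auto simp: eventually_at_filter field_simps power2_eq_square)
  ultimately show ?thesis
    unfolding has_jet2_def by (simp add: tendsto_cong)
qed

lemma has_jet2_power2:
  assumes "has_jet2 f a b c"
  shows "has_jet2 (\<lambda>x. (f x)\<^sup>2) (a\<^sup>2) (2 * a * b) (2 * a * c + b\<^sup>2)"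
  using has_jet2_mult[OF assms assms] by (simp add: power2_eq_square algebra_simps)

lemmas jet2_intros = has_jet2_const has_jet2_ident has_jet2_add has_jet2_minus has_jet2_diff
  has_jet2_power2 has_jet2_mult

lemma has_jet2_0:
  assumes "has_jet2 (\<lambda>x. 0) a b c"
  shows "a = 0" "b = 0" "c = 0"
proof -
  note lim = assms[unfolded has_jet2_def]
  show a: "a = 0"
    using has_jet2_tendsto[OF assms] tendsto_unique[OF _ tendsto_const] by force
  have "((\<lambda>x. - ((0 - (a + b * x + c * x\<^sup>2)) / x\<^sup>2 * x + c * x)) \<longlongrightarrow> - (0 * 0 + c * 0)) (at 0)"
    using lim by (intro tendsto_intros)
  moreover have "\<forall>\<^sub>F x in at 0. - ((0 - (a + b * x + c * x\<^sup>2)) / x\<^sup>2 * x + c * x) = b"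
    using a by (auto simp: eventually_at_filter field_simps power2_eq_square)
  ultimately have "((\<lambda>x::real. b) \<longlongrightarrow> 0) (at 0)"
    by (simp add: tendsto_cong)
  then show b: "b = 0"
    by (simp add: tendsto_const_iff)
  have "\<forall>\<^sub>F x in at 0. (0 - (a + b * x + c * x\<^sup>2)) / x\<^sup>2 = - c"
    using a b by (auto simp: eventually_at_filter)
  then have "((\<lambda>x::real. - c) \<longlongrightarrow> 0) (at 0)"
    using lim by (simp add: tendsto_cong)
  then show "c = 0"
    by (simp add: tendsto_const_iff)
qed

lemma has_jet2_unique:
  assumes "has_jet2 f a b c" "has_jet2 g a' b' c'" "\<forall>\<^sub>F x in at 0. f x = g x"
  shows "a = a'" "b = b'" "c = c'"
proof -
  have "has_jet2 (\<lambda>x. 0) (a - a') (b - b') (c - c')"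
    using has_jet2_diff[OF assms(1,2)] assms(3)
    by (subst has_jet2_cong[of _ "\<lambda>x. f x - g x"]) (auto elim: eventually_mono)
  from has_jet2_0[OF this] show "a = a'" "b = b'" "c = c'" by auto
qed

text \<open>One use of l'Hopital turns the remainder into the difference quotient of
  \<open>g'\<close>, so differentiability of \<open>g'\<close> at the single point 0
  suffices.\<close>

lemma has_jet2_taylor:
  assumes g: "\<forall>\<^sub>F x in nhds 0. (g has_real_derivative g' x) (at x)"
    and g': "(g' has_real_derivative d) (at 0)"
  shows "has_jet2 g (g 0) (g' 0) (d / 2)"
proof -
  let ?r = "\<lambda>x. g x - (g 0 + g' 0 * x + d / 2 * x\<^sup>2)" and ?r' = "\<lambda>x. g' x - (g' 0 + d * x)"
  have r': "\<forall>\<^sub>F x in at 0. (?r has_real_derivative ?r' x) (at x)"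
    using g unfolding eventually_at_filter
    by eventually_elim (auto intro!: derivative_eq_intros)
  have quot: "((\<lambda>x. ?r' x / (2 * x)) \<longlongrightarrow> 0) (at 0)"
  proof -
    have lim: "((\<lambda>x. ((g' x - g' 0) / x - d) / 2) \<longlongrightarrow> (d - d) / 2) (at 0)"
      using g' unfolding has_field_derivative_iff by (intro tendsto_intros) auto
    have "\<forall>\<^sub>F x in at 0. ((g' x - g' 0) / x - d) / 2 = ?r' x / (2 * x)"
      by (auto simp: eventually_at_filter field_simps)
    from Lim_transform_eventually[OF lim this] show ?thesis by simp
  qed
  have "isCont g 0"
    using eventually_nhds_x_imp_x[OF g] DERIV_isCont by blast
  then have r0: "(?r \<longlongrightarrow> 0) (at 0)"
    unfolding isCont_def by (auto intro!: tendsto_eq_intros)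
  have sq0: "((\<lambda>x::real. x\<^sup>2) \<longlongrightarrow> 0) (at 0)"
    by (auto intro!: tendsto_eq_intros)
  have nz: "\<forall>\<^sub>F x::real in at 0. x\<^sup>2 \<noteq> 0" "\<forall>\<^sub>F x::real in at 0. 2 * x \<noteq> 0"
    by (simp_all add: eventually_at_filter)
  have "\<forall>\<^sub>F x in at 0. ((\<lambda>x::real. x\<^sup>2) has_real_derivative 2 * x) (at x)"
    by (intro always_eventually allI) (auto intro!: derivative_eq_intros)
  from lhopital[OF r0 sq0 nz r' this quot] show ?thesis
    unfolding has_jet2_def .
qed

section \<open>Taylor expansion of smooth maps along lines\<close>

lemma smooth_on_differentiable: "smooth_on S f \<Longrightarrow> x \<in> S \<Longrightarrow> f differentiable (at x)"
  unfolding smooth_on_def by (metis Ck_on.simps(2))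

lemma smooth_on_directional: "smooth_on S f \<Longrightarrow> smooth_on S (\<lambda>x. frechet_derivative f (at x) v)"
  unfolding smooth_on_def by (metis Ck_on.simps(2))

lemma differentiable_line_derivative:
  fixes F :: "'a::real_normed_vector \<Rightarrow> 'b::real_normed_vector"
  assumes "F differentiable (at (p + s *\<^sub>R v))"
  shows "((\<lambda>x. F (p + x *\<^sub>R v)) has_vector_derivative frechet_derivative F (at (p + s *\<^sub>R v)) v) (at s)"
proof -
  have F: "(F has_derivative frechet_derivative F (at (p + s *\<^sub>R v))) (at (p + s *\<^sub>R v))"
    using assms by (simp add: frechet_derivative_works)
  have "((\<lambda>x. p + x *\<^sub>R v) has_derivative (\<lambda>x. x *\<^sub>R v)) (at s)"
    by (auto intro!: derivative_eq_intros)
  from has_derivative_compose[OF this F]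
  have "((\<lambda>x. F (p + x *\<^sub>R v)) has_derivative (\<lambda>x. frechet_derivative F (at (p + s *\<^sub>R v)) (x *\<^sub>R v))) (at s)" .
  then show ?thesis
    unfolding has_vector_derivative_def using linear_cmul[OF linear_frechet_derivative[OF assms]] by simp
qed

lemma has_jet2_line:
  fixes F :: "'a::real_normed_vector \<Rightarrow> real"
  assumes "\<forall>\<^sub>F x in nhds p. F differentiable (at x)"
    and "(\<lambda>x. frechet_derivative F (at x) v) differentiable (at p)"
  shows "has_jet2 (\<lambda>x. F (p + x *\<^sub>R v)) (F p) (frechet_derivative F (at p) v)
    (frechet_derivative (\<lambda>x. frechet_derivative F (at x) v) (at p) v / 2)"
proof -
  have "((\<lambda>x. p + x *\<^sub>R v) \<longlongrightarrow> p) (nhds 0)"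
    by (auto intro!: tendsto_eq_intros filterlim_ident)
  then have "\<forall>\<^sub>F x in nhds 0. F differentiable (at (p + x *\<^sub>R v))"
    using assms(1) by (rule eventually_compose_filterlim[rotated])
  then have "\<forall>\<^sub>F x in nhds 0. ((\<lambda>x. F (p + x *\<^sub>R v)) has_real_derivative
      frechet_derivative F (at (p + x *\<^sub>R v)) v) (at x)"
    by eventually_elim
      (use differentiable_line_derivative in \<open>simp add: has_real_derivative_iff_has_vector_derivative\<close>)
  from has_jet2_taylor[OF this, of "frechet_derivative (\<lambda>x. frechet_derivative F (at x) v) (at p) v"]
  show ?thesis
    using differentiable_line_derivative[of "\<lambda>x. frechet_derivative F (at x) v" p 0 v] assms(2)
    by (simp add: has_real_derivative_iff_has_vector_derivative)
qed

lemma frechet_derivative_nth: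
  fixes F :: "'a::real_normed_vector \<Rightarrow> real^'n"
  assumes "F differentiable (at x)"
  shows "(\<lambda>x. F x $ i) differentiable (at x)"
    "frechet_derivative (\<lambda>x. F x $ i) (at x) v = frechet_derivative F (at x) v $ i"
proof -
  have "((\<lambda>x. F x $ i) has_derivative (\<lambda>v. frechet_derivative F (at x) v $ i)) (at x)"
    using assms by (intro bounded_linear.has_derivative[OF bounded_linear_vec_nth])
      (simp add: frechet_derivative_works)
  then show "(\<lambda>x. F x $ i) differentiable (at x)"
    "frechet_derivative (\<lambda>x. F x $ i) (at x) v = frechet_derivative F (at x) v $ i"
    by (auto simp: differentiable_def dest: frechet_derivative_at[symmetric])
qed

text \<open>The hypotheses are phrased by differentiability instead of smoothness so that they can
  be met by the surface \<open>h\<close>, about which just these two facts are proved.\<close>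

lemma has_jet2_line_nth:
  fixes F :: "'a::real_normed_vector \<Rightarrow> real^'n"
  assumes diff: "\<forall>\<^sub>F x in nhds p. F differentiable (at x)"
    and diff': "(\<lambda>x. frechet_derivative F (at x) v) differentiable (at p)"
  shows "has_jet2 (\<lambda>x. F (p + x *\<^sub>R v) $ i) (F p $ i) (frechet_derivative F (at p) v $ i)
    (frechet_derivative (\<lambda>x. frechet_derivative F (at x) v) (at p) v $ i / 2)"
proof -
  have eq: "\<forall>\<^sub>F x in nhds p. frechet_derivative F (at x) v $ i = frechet_derivative (\<lambda>x. F x $ i) (at x) v"
    using diff by eventually_elim (simp add: frechet_derivative_nth)
  have "((\<lambda>x. frechet_derivative F (at x) v $ i) has_derivative
      (\<lambda>w. frechet_derivative (\<lambda>x. frechet_derivative F (at x) v) (at p) w $ i)) (at p)"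
    using diff' by (intro bounded_linear.has_derivative[OF bounded_linear_vec_nth])
      (simp add: frechet_derivative_works)
  then have D: "((\<lambda>x. frechet_derivative (\<lambda>x. F x $ i) (at x) v) has_derivative
      (\<lambda>w. frechet_derivative (\<lambda>x. frechet_derivative F (at x) v) (at p) w $ i)) (at p)"
    by (rule has_derivative_transform_eventually)
      (use eq eventually_nhds_x_imp_x[OF eq] in \<open>auto simp: eventually_at_filter elim: eventually_mono\<close>)
  have "\<forall>\<^sub>F x in nhds p. (\<lambda>x. F x $ i) differentiable (at x)"
    using diff by eventually_elim (simp add: frechet_derivative_nth)
  from has_jet2_line[OF this, of v] show ?thesis
    unfolding frechet_derivative_at[OF D, symmetric] eventually_nhds_x_imp_x[OF eq, symmetric]
    using D by (simp add: differentiable_def) blast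
qed

subsection \<open>Partial derivatives of the normal form\<close>

lemma smooth_germ_directional:
  "smooth_germ f \<Longrightarrow> smooth_germ (\<lambda>x. frechet_derivative f (at x) v)"
  unfolding smooth_germ_def using smooth_on_directional by blast

lemma smooth_germ_differentiable:
  "smooth_germ f \<Longrightarrow> \<forall>\<^sub>F x in nhds 0. f differentiable (at x)"
  unfolding smooth_germ_def eventually_nhds using smooth_on_differentiable by blast

lemma smooth_germ_has_jet2:
  fixes F :: "'a::real_normed_vector \<Rightarrow> real"
  assumes "smooth_germ F"
  shows "has_jet2 (\<lambda>x. F (x *\<^sub>R v)) (F 0) (frechet_derivative F (at 0) v)
    (frechet_derivative (\<lambda>x. frechet_derivative F (at x) v) (at 0) v / 2)"
  using has_jet2_line[of F 0 v] smooth_germ_differentiable[OF assms]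
    eventually_nhds_x_imp_x[OF smooth_germ_differentiable[OF smooth_germ_directional[OF assms]]] by simp

text \<open>Unlike \<^const>\<open>deriv\<close>, this derivative of a smooth germ is definitionally an iterate
  of directional derivatives, hence again a smooth germ.\<close>

definition rderiv :: "(real \<Rightarrow> real) \<Rightarrow> real \<Rightarrow> real" where
  "rderiv g x = frechet_derivative g (at x) 1"

lemma smooth_germ_rderiv: "smooth_germ g \<Longrightarrow> smooth_germ (rderiv g)"
  unfolding rderiv_def by (rule smooth_germ_directional)

lemma smooth_germ_pd1: "smooth_germ f \<Longrightarrow> smooth_germ (pd1 f)"
  using smooth_germ_directional[of f "(1, 0)"] by (simp add: pd1_def[abs_def])

lemma smooth_germ_pd2: "smooth_germ f \<Longrightarrow> smooth_germ (pd2 f)"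
  using smooth_germ_directional[of f "(0, 1)"] by (simp add: pd2_def[abs_def])

lemma differentiable_has_real_derivative_rderiv:
  "g differentiable (at x) \<Longrightarrow> (g has_real_derivative rderiv g x) (at x)"
  using differentiable_line_derivative[of g 0 x 1]
  by (simp add: rderiv_def has_real_derivative_iff_has_vector_derivative)

lemma smooth_germ_rderiv_at:
  "smooth_germ g \<Longrightarrow> \<forall>\<^sub>F x in nhds 0. (g has_real_derivative rderiv g x) (at x)"
  by (rule eventually_mono[OF smooth_germ_differentiable[of g] differentiable_has_real_derivative_rderiv])

text \<open>Connects the coordinates of the jet space, written with \<open>deriv\<close>, to the
  iterates of \<open>rderiv\<close> that the computations produce.\<close>

lemma jet2_eq_rderiv:
  assumes "smooth_germ g"
  shows "jet2 g = (g 0, rderiv g 0, rderiv (rderiv g) 0 / 2)" "jet1 g = (g 0, rderiv g 0)"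
proof -
  have eq: "\<forall>\<^sub>F x in nhds 0. deriv g x = rderiv g x"
    using smooth_germ_rderiv_at[OF assms] by eventually_elim (rule DERIV_imp_deriv)
  have "deriv (deriv g) 0 = deriv (rderiv g) 0"
    by (rule deriv_cong_ev[OF eq]) simp
  also have "\<dots> = rderiv (rderiv g) 0"
    using eventually_nhds_x_imp_x[OF smooth_germ_rderiv_at[OF smooth_germ_rderiv[OF assms]]]
    by (rule DERIV_imp_deriv)
  finally show "jet2 g = (g 0, rderiv g 0, rderiv (rderiv g) 0 / 2)" "jet1 g = (g 0, rderiv g 0)"
    using eventually_nhds_x_imp_x[OF eq] by (auto simp: jet2_def jet1_def)
qed

lemma has_jet2_rderiv:
  assumes "smooth_germ g"
  shows "has_jet2 g (g 0) (rderiv g 0) (rderiv (rderiv g) 0 / 2)"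
  using has_jet2_taylor[OF smooth_germ_rderiv_at[OF assms]]
    eventually_nhds_x_imp_x[OF smooth_germ_rderiv_at[OF smooth_germ_rderiv[OF assms]]] .

lemma differentiable_has_derivative_pd1:
  fixes f :: "real \<times> real \<Rightarrow> 'b::real_normed_vector"
  assumes "f differentiable (at p)"
  shows "((\<lambda>s. f (s, snd p)) has_vector_derivative pd1 f p) (at (fst p))"
  using differentiable_line_derivative[of f "(0, snd p)" "fst p" "(1, 0)"] assms
  by (simp add: pd1_def)

lemma differentiable_has_derivative_pd2:
  fixes f :: "real \<times> real \<Rightarrow> 'b::real_normed_vector"
  assumes "f differentiable (at p)"
  shows "((\<lambda>s. f (fst p, s)) has_vector_derivative pd2 f p) (at (snd p))"
  using differentiable_line_derivative[of f "(fst p, 0)" "snd p" "(0, 1)"] assms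
  by (simp add: pd2_def)

lemma smooth_germ_pd1_at:
  fixes F :: "real \<times> real \<Rightarrow> real"
  assumes "smooth_germ F"
  shows "\<forall>\<^sub>F p in nhds 0. ((\<lambda>s. F (s, snd p)) has_real_derivative pd1 F p) (at (fst p))"
  using smooth_germ_differentiable[OF assms] unfolding has_real_derivative_iff_has_vector_derivative
  by eventually_elim (rule differentiable_has_derivative_pd1)

lemma smooth_germ_pd2_at:
  fixes F :: "real \<times> real \<Rightarrow> real"
  assumes "smooth_germ F"
  shows "\<forall>\<^sub>F p in nhds 0. ((\<lambda>s. F (fst p, s)) has_real_derivative pd2 F p) (at (snd p))"
  using smooth_germ_differentiable[OF assms] unfolding has_real_derivative_iff_has_vector_derivative
  by eventually_elim (rule differentiable_has_derivative_pd2)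

lemma has_vector_derivative_nth:
  "(f has_vector_derivative d) F \<Longrightarrow> ((\<lambda>x. f x $ i) has_real_derivative d $ i) F"
  unfolding has_real_derivative_iff_has_vector_derivative
  by (rule bounded_linear.has_vector_derivative[OF bounded_linear_vec_nth])

text \<open>An identity of germs at 0 also holds near every point close to 0, so both sides have the
  same partial derivative there. Iterating this yields all second partial derivatives of the normal
  form, component by component.\<close>

lemma eventually_pd1_nth:
  fixes f :: "real \<times> real \<Rightarrow> real^'n"
  assumes smooth: "smooth_germ f"
    and eq: "\<forall>\<^sub>F p in nhds 0. f p $ i = \<phi> p"
    and d: "\<forall>\<^sub>F p in nhds 0. ((\<lambda>s. \<phi> (s, snd p)) has_real_derivative d p) (at (fst p))"
  shows "\<forall>\<^sub>F p in nhds 0. pd1 f p $ i = d p"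
proof -
  have "\<forall>\<^sub>F p in nhds 0. \<forall>\<^sub>F q in nhds p. f q $ i = \<phi> q"
    using eq by (simp add: eventually_eventually)
  with d smooth_germ_differentiable[OF smooth] show ?thesis
  proof eventually_elim
    case (elim p)
    have "((\<lambda>s. f (s, snd p) $ i) has_real_derivative pd1 f p $ i) (at (fst p))"
      using elim(2) by (intro has_vector_derivative_nth differentiable_has_derivative_pd1)
    moreover have "((\<lambda>s. (s, snd p)) \<longlongrightarrow> (fst p, snd p)) (nhds (fst p))"
      by (intro tendsto_intros filterlim_ident)
    then have "((\<lambda>s. (s, snd p)) \<longlongrightarrow> p) (nhds (fst p))"
      by simp
    from this elim(3) have "\<forall>\<^sub>F s in nhds (fst p). f (s, snd p) $ i = \<phi> (s, snd p)"
      by (rule eventually_compose_filterlim[rotated])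
    then have "((\<lambda>s. f (s, snd p) $ i) has_real_derivative d p) (at (fst p))"
      using elim(1) by (subst DERIV_cong_ev[OF refl _ refl])
    ultimately show ?case by (rule DERIV_unique)
  qed
qed

lemma eventually_pd2_nth:
  fixes f :: "real \<times> real \<Rightarrow> real^'n"
  assumes smooth: "smooth_germ f"
    and eq: "\<forall>\<^sub>F p in nhds 0. f p $ i = \<phi> p"
    and d: "\<forall>\<^sub>F p in nhds 0. ((\<lambda>s. \<phi> (fst p, s)) has_real_derivative d p) (at (snd p))"
  shows "\<forall>\<^sub>F p in nhds 0. pd2 f p $ i = d p"
proof -
  have "\<forall>\<^sub>F p in nhds 0. \<forall>\<^sub>F q in nhds p. f q $ i = \<phi> q"
    using eq by (simp add: eventually_eventually)
  with d smooth_germ_differentiable[OF smooth] show ?thesis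
  proof eventually_elim
    case (elim p)
    have "((\<lambda>s. f (fst p, s) $ i) has_real_derivative pd2 f p $ i) (at (snd p))"
      using elim(2) by (intro has_vector_derivative_nth differentiable_has_derivative_pd2)
    moreover have "((\<lambda>s. (fst p, s)) \<longlongrightarrow> (fst p, snd p)) (nhds (snd p))"
      by (intro tendsto_intros filterlim_ident)
    then have "((\<lambda>s. (fst p, s)) \<longlongrightarrow> p) (nhds (snd p))"
      by simp
    from this elim(3) have "\<forall>\<^sub>F s in nhds (snd p). f (fst p, s) $ i = \<phi> (fst p, s)"
      by (rule eventually_compose_filterlim[rotated])
    then have "((\<lambda>s. f (fst p, s) $ i) has_real_derivative d p) (at (snd p))"
      using elim(1) by (subst DERIV_cong_ev[OF refl _ refl])
    ultimately show ?case by (rule DERIV_unique)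
  qed
qed

locale umbrella_normal_form =
  fixes f :: "real \<times> real \<Rightarrow> real^3" and f21 f31 f321 f331 :: "real \<Rightarrow> real"
    and f322 :: "real \<times> real \<Rightarrow> real"
  assumes smooth: "smooth_germ f" and normal_form: "in_normal_form f f21 f31 f321 f322 f331"
begin

lemma smooth_coefficients:
  "smooth_germ f21" "smooth_germ f31" "smooth_germ f321" "smooth_germ f322" "smooth_germ f331"
  and f331_pos: "f331 0 > 0"
  using normal_form by (auto simp: in_normal_form_def)

lemma f_nth:
  "\<forall>\<^sub>F p in nhds 0. f p $ 1 = fst p"
  "\<forall>\<^sub>F p in nhds 0. f p $ 2 = (fst p)\<^sup>2 * f21 (fst p) + (snd p)\<^sup>2"
  "\<forall>\<^sub>F p in nhds 0. f p $ 3 = (fst p)\<^sup>2 * f31 (fst p)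
     + (snd p)\<^sup>2 * (fst p * f321 (fst p) + snd p * f322 (fst p, snd p)) + fst p * snd p * f331 (fst p)"
proof -
  have "\<forall>\<^sub>F p in nhds 0. f p = vector [fst p, (fst p)\<^sup>2 * f21 (fst p) + (snd p)\<^sup>2,
     (fst p)\<^sup>2 * f31 (fst p) + (snd p)\<^sup>2 * (fst p * f321 (fst p) + snd p * f322 (fst p, snd p))
       + fst p * snd p * f331 (fst p)]"
    using normal_form unfolding in_normal_form_def zero_prod_def by (simp add: case_prod_unfold)
  then show "\<forall>\<^sub>F p in nhds 0. f p $ 1 = fst p"
  "\<forall>\<^sub>F p in nhds 0. f p $ 2 = (fst p)\<^sup>2 * f21 (fst p) + (snd p)\<^sup>2"
  "\<forall>\<^sub>F p in nhds 0. f p $ 3 = (fst p)\<^sup>2 * f31 (fst p)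
     + (snd p)\<^sup>2 * (fst p * f321 (fst p) + snd p * f322 (fst p, snd p)) + fst p * snd p * f331 (fst p)"
    by (auto elim!: eventually_mono)
qed

lemma eventually_fst: "\<forall>\<^sub>F x in nhds 0. P x \<Longrightarrow> \<forall>\<^sub>F p in nhds (0 :: real \<times> real). P (fst p :: real)"
proof -
  assume "\<forall>\<^sub>F x in nhds 0. P x"
  moreover have "(fst \<longlongrightarrow> 0) (nhds (0 :: real \<times> real))"
    using tendsto_fst[OF filterlim_ident, of "0 :: real \<times> real"] by simp
  ultimately show ?thesis by (rule eventually_compose_filterlim)
qed

lemmas coefficient_derivatives =
  eventually_fst[OF smooth_germ_rderiv_at[OF smooth_coefficients(1)]]
  eventually_fst[OF smooth_germ_rderiv_at[OF smooth_germ_rderiv[OF smooth_coefficients(1)]]]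
  eventually_fst[OF smooth_germ_rderiv_at[OF smooth_coefficients(2)]]
  eventually_fst[OF smooth_germ_rderiv_at[OF smooth_germ_rderiv[OF smooth_coefficients(2)]]]
  eventually_fst[OF smooth_germ_rderiv_at[OF smooth_coefficients(3)]]
  eventually_fst[OF smooth_germ_rderiv_at[OF smooth_germ_rderiv[OF smooth_coefficients(3)]]]
  eventually_fst[OF smooth_germ_rderiv_at[OF smooth_coefficients(5)]]
  eventually_fst[OF smooth_germ_rderiv_at[OF smooth_germ_rderiv[OF smooth_coefficients(5)]]]
  smooth_germ_pd1_at[OF smooth_coefficients(4)]
  smooth_germ_pd2_at[OF smooth_coefficients(4)]
  smooth_germ_pd1_at[OF smooth_germ_pd1[OF smooth_coefficients(4)]]
  smooth_germ_pd2_at[OF smooth_germ_pd1[OF smooth_coefficients(4)]]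
  smooth_germ_pd1_at[OF smooth_germ_pd2[OF smooth_coefficients(4)]]
  smooth_germ_pd2_at[OF smooth_germ_pd2[OF smooth_coefficients(4)]]

lemma pd1_f_nth:
  "\<forall>\<^sub>F p in nhds 0. pd1 f p $ 1 = 1"
  "\<forall>\<^sub>F p in nhds 0. pd1 f p $ 2 = 2 * fst p * f21 (fst p) + (fst p)\<^sup>2 * rderiv f21 (fst p)"
  "\<forall>\<^sub>F p in nhds 0. pd1 f p $ 3 = 2 * fst p * f31 (fst p) + (fst p)\<^sup>2 * rderiv f31 (fst p)
     + (snd p)\<^sup>2 * (f321 (fst p) + fst p * rderiv f321 (fst p) + snd p * pd1 f322 (fst p, snd p))
     + snd p * f331 (fst p) + fst p * snd p * rderiv f331 (fst p)"
  by (rule eventually_pd1_nth[OF smooth f_nth(1)] eventually_pd1_nth[OF smooth f_nth(2)]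
      eventually_pd1_nth[OF smooth f_nth(3)],
      use coefficient_derivatives in eventually_elim,
      auto intro!: derivative_eq_intros simp: algebra_simps power2_eq_square)+

lemma pd2_f_nth:
  "\<forall>\<^sub>F p in nhds 0. pd2 f p $ 1 = 0"
  "\<forall>\<^sub>F p in nhds 0. pd2 f p $ 2 = 2 * snd p"
  "\<forall>\<^sub>F p in nhds 0. pd2 f p $ 3 = 2 * snd p * (fst p * f321 (fst p)) + 3 * (snd p)\<^sup>2 * f322 (fst p, snd p)
     + (snd p)^3 * pd2 f322 (fst p, snd p) + fst p * f331 (fst p)"
  by (rule eventually_pd2_nth[OF smooth f_nth(1)] eventually_pd2_nth[OF smooth f_nth(2)]
      eventually_pd2_nth[OF smooth f_nth(3)],
      use coefficient_derivatives in eventually_elim,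
      auto intro!: derivative_eq_intros simp: algebra_simps power2_eq_square power3_eq_cube)+

lemma pd1_pd1_f_nth:
  "\<forall>\<^sub>F p in nhds 0. pd1 (pd1 f) p $ 1 = 0"
  "\<forall>\<^sub>F p in nhds 0. pd1 (pd1 f) p $ 2 =
     2 * f21 (fst p) + 4 * fst p * rderiv f21 (fst p) + (fst p)\<^sup>2 * rderiv (rderiv f21) (fst p)"
  "\<forall>\<^sub>F p in nhds 0. pd1 (pd1 f) p $ 3 =
     2 * f31 (fst p) + 4 * fst p * rderiv f31 (fst p) + (fst p)\<^sup>2 * rderiv (rderiv f31) (fst p)
     + (snd p)\<^sup>2 * (2 * rderiv f321 (fst p) + fst p * rderiv (rderiv f321) (fst p)
         + snd p * pd1 (pd1 f322) (fst p, snd p))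
     + snd p * (2 * rderiv f331 (fst p) + fst p * rderiv (rderiv f331) (fst p))"
  by (rule eventually_pd1_nth[OF smooth_germ_pd1[OF smooth] pd1_f_nth(1)]
      eventually_pd1_nth[OF smooth_germ_pd1[OF smooth] pd1_f_nth(2)]
      eventually_pd1_nth[OF smooth_germ_pd1[OF smooth] pd1_f_nth(3)],
      use coefficient_derivatives in eventually_elim,
      auto intro!: derivative_eq_intros simp: algebra_simps power2_eq_square)+

lemma pd2_pd1_f_nth:
  "\<forall>\<^sub>F p in nhds 0. pd2 (pd1 f) p $ 1 = 0"
  "\<forall>\<^sub>F p in nhds 0. pd2 (pd1 f) p $ 2 = 0"
  "\<forall>\<^sub>F p in nhds 0. pd2 (pd1 f) p $ 3 =
     2 * snd p * (f321 (fst p) + fst p * rderiv f321 (fst p) + snd p * pd1 f322 (fst p, snd p))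
     + (snd p)\<^sup>2 * (pd1 f322 (fst p, snd p) + snd p * pd2 (pd1 f322) (fst p, snd p))
     + f331 (fst p) + fst p * rderiv f331 (fst p)"
  by (rule eventually_pd2_nth[OF smooth_germ_pd1[OF smooth] pd1_f_nth(1)]
      eventually_pd2_nth[OF smooth_germ_pd1[OF smooth] pd1_f_nth(2)]
      eventually_pd2_nth[OF smooth_germ_pd1[OF smooth] pd1_f_nth(3)],
      use coefficient_derivatives in eventually_elim,
      auto intro!: derivative_eq_intros simp: algebra_simps power2_eq_square)+

lemma pd1_pd2_f_nth:
  "\<forall>\<^sub>F p in nhds 0. pd1 (pd2 f) p $ 1 = 0"
  "\<forall>\<^sub>F p in nhds 0. pd1 (pd2 f) p $ 2 = 0"
  "\<forall>\<^sub>F p in nhds 0. pd1 (pd2 f) p $ 3 =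
     2 * snd p * (f321 (fst p) + fst p * rderiv f321 (fst p)) + 3 * (snd p)\<^sup>2 * pd1 f322 (fst p, snd p)
     + (snd p)^3 * pd1 (pd2 f322) (fst p, snd p) + f331 (fst p) + fst p * rderiv f331 (fst p)"
  by (rule eventually_pd1_nth[OF smooth_germ_pd2[OF smooth] pd2_f_nth(1)]
      eventually_pd1_nth[OF smooth_germ_pd2[OF smooth] pd2_f_nth(2)]
      eventually_pd1_nth[OF smooth_germ_pd2[OF smooth] pd2_f_nth(3)],
      use coefficient_derivatives in eventually_elim,
      auto intro!: derivative_eq_intros simp: algebra_simps power2_eq_square power3_eq_cube)+

lemma pd2_pd2_f_nth:
  "\<forall>\<^sub>F p in nhds 0. pd2 (pd2 f) p $ 1 = 0"
  "\<forall>\<^sub>F p in nhds 0. pd2 (pd2 f) p $ 2 = 2"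
  "\<forall>\<^sub>F p in nhds 0. pd2 (pd2 f) p $ 3 =
     2 * (fst p * f321 (fst p)) + 6 * snd p * f322 (fst p, snd p) + 6 * (snd p)\<^sup>2 * pd2 f322 (fst p, snd p)
     + (snd p)^3 * pd2 (pd2 f322) (fst p, snd p)"
  by (rule eventually_pd2_nth[OF smooth_germ_pd2[OF smooth] pd2_f_nth(1)]
      eventually_pd2_nth[OF smooth_germ_pd2[OF smooth] pd2_f_nth(2)]
      eventually_pd2_nth[OF smooth_germ_pd2[OF smooth] pd2_f_nth(3)],
      use coefficient_derivatives in eventually_elim,
      auto intro!: derivative_eq_intros simp: algebra_simps power2_eq_square power3_eq_cube)+

end

subsection \<open>The bounded principal curvature\<close>

lemma frechet_derivative_pd:
  fixes F :: "real \<times> real \<Rightarrow> real"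
  assumes "F differentiable (at p)"
  shows "frechet_derivative F (at p) (1, t) = pd1 F p + t * pd2 F p"
proof -
  have lin: "linear (frechet_derivative F (at p))"
    using assms by (rule linear_frechet_derivative)
  have "(1, t) = (1, 0) + t *\<^sub>R (0, 1 :: real)" by simp
  then have "frechet_derivative F (at p) (1, t) = frechet_derivative F (at p) ((1, 0) + t *\<^sub>R (0, 1))"
    by (rule arg_cong)
  also have "\<dots> = pd1 F p + t * pd2 F p"
    by (simp only: linear_add[OF lin] linear_cmul[OF lin] pd1_def pd2_def real_scaleR_def)
  finally show ?thesis .
qed

lemma has_jet2_ray:
  fixes F :: "real \<times> real \<Rightarrow> real"
  assumes "smooth_germ F"
  obtains c where "has_jet2 (\<lambda>x. F (x, x * t)) (F 0) (pd1 F 0 + t * pd2 F 0) c"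
  using smooth_germ_has_jet2[OF assms, of "(1, t)"] that
    frechet_derivative_pd[OF eventually_nhds_x_imp_x[OF smooth_germ_differentiable[OF assms]], of t]
  by simp

text \<open>The unit normal is a multiple of the cross product \<open>(Y z - Z y, - z, y)\<close> of the partial
  derivatives \<open>(1, Y, Z)\<close> and \<open>(0, y, z)\<close>; multiplying it by its own component along that vector
  makes it independent of the choice of sign and of the normalisation.\<close>

lemma unnormalized_principal_curvature:
  fixes r Y Z y z \<nu>1 \<nu>2 \<nu>3 \<kappa> fuu2 fuu3 fuv3 fvu3 fvv2 fvv3 :: real
  assumes "r \<noteq> 0" "z \<noteq> 0"
    and unit: "\<nu>1\<^sup>2 + \<nu>2\<^sup>2 + \<nu>3\<^sup>2 = 1"
    and orth: "\<nu>1 + \<nu>2 * (r * Y) + \<nu>3 * (r * Z) = 0" "\<nu>2 * (r * y) + \<nu>3 * (r * z) = 0"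
    and curv: "(\<nu>2 * fuu2 + \<nu>3 * fuu3 - \<kappa> * (1 + (r * Y)\<^sup>2 + (r * Z)\<^sup>2)) * (\<nu>2 * fvv2 + \<nu>3 * fvv3 - \<kappa> * ((r * y)\<^sup>2 + (r * z)\<^sup>2))
      - (\<nu>3 * fuv3 - \<kappa> * (r * Y * (r * y) + r * Z * (r * z))) * (\<nu>3 * fvu3 - \<kappa> * (r * Y * (r * y) + r * Z * (r * z))) = 0"
  defines "N \<equiv> r * (Y * z - Z * y)"
  defines "K \<equiv> \<kappa> * (\<nu>1 * N - \<nu>2 * z + \<nu>3 * y)"
  shows "(- z * fuu2 + y * fuu3 - K * (1 + r\<^sup>2 * (Y\<^sup>2 + Z\<^sup>2))) * (- z * fvv2 + y * fvv3 - K * (r\<^sup>2 * (y\<^sup>2 + z\<^sup>2)))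
      - (y * fuv3 - K * (r\<^sup>2 * (Y * y + Z * z))) * (y * fvu3 - K * (r\<^sup>2 * (Y * y + Z * z))) = 0"
    "(N\<^sup>2 + z\<^sup>2 + y\<^sup>2) * (\<kappa> * \<nu>1) = K * N"
    "(N\<^sup>2 + z\<^sup>2 + y\<^sup>2) * (\<kappa> * \<nu>2) = - (K * z)"
    "(N\<^sup>2 + z\<^sup>2 + y\<^sup>2) * (\<kappa> * \<nu>3) = K * y"
proof -
  \<comment> \<open>\<open>l\<close> is the scalar with \<open>\<nu> = l (N, - z, y)\<close>, read
    off from the second component because \<open>z \<noteq> 0\<close>.\<close>
  define l where "l = - \<nu>2 / z"
  have \<nu>2: "\<nu>2 = - (l * z)" using assms(2) by (simp add: l_def)
  have "r * (\<nu>2 * y + \<nu>3 * z) = 0" using orth(2) by (simp add: algebra_simps)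
  then have "z * (\<nu>3 - l * y) = 0" using assms(1) \<nu>2 by (simp add: algebra_simps)
  then have \<nu>3: "\<nu>3 = l * y" using assms(2) by simp
  have \<nu>1: "\<nu>1 = l * N" using orth(1) unfolding \<nu>2 \<nu>3 N_def by (simp add: algebra_simps)
  let ?w = "N\<^sup>2 + z\<^sup>2 + y\<^sup>2"
  have lw: "l\<^sup>2 * ?w = 1" using unit unfolding \<nu>1 \<nu>2 \<nu>3 by (simp add: algebra_simps power_mult_distrib)
  have K: "K = \<kappa> * l * ?w"
    unfolding K_def \<nu>1 \<nu>2 \<nu>3 by (simp add: algebra_simps power2_eq_square)
  then show "?w * (\<kappa> * \<nu>1) = K * N" "?w * (\<kappa> * \<nu>2) = - (K * z)" "?w * (\<kappa> * \<nu>3) = K * y"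
    unfolding \<nu>1 \<nu>2 \<nu>3 by (simp_all add: algebra_simps)
  have "\<kappa> = l * K"
  proof -
    have "l * K = \<kappa> * (l\<^sup>2 * ?w)" unfolding K by (simp add: power2_eq_square algebra_simps)
    then show ?thesis using lw by simp
  qed
  then have \<kappa>: "\<kappa> = l * K" .
  define A B C D where "A = - z * fuu2 + y * fuu3 - K * (1 + r\<^sup>2 * (Y\<^sup>2 + Z\<^sup>2))"
    and "B = - z * fvv2 + y * fvv3 - K * (r\<^sup>2 * (y\<^sup>2 + z\<^sup>2))"
    and "C = y * fuv3 - K * (r\<^sup>2 * (Y * y + Z * z))"
    and "D = y * fvu3 - K * (r\<^sup>2 * (Y * y + Z * z))"
  note ABCD_def = this
  \<comment> \<open>The second form is linear in \<open>\<nu>\<close>, and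
    \<open>\<kappa> = l * K\<close>; so each entry of the matrix carries one factor
    \<open>l\<close>, and the determinant a factor \<open>l\<^sup>2\<close> that can be
    cancelled.\<close>
  have "\<nu>2 * fuu2 + \<nu>3 * fuu3 - \<kappa> * (1 + (r * Y)\<^sup>2 + (r * Z)\<^sup>2) = l * A"
    "\<nu>2 * fvv2 + \<nu>3 * fvv3 - \<kappa> * ((r * y)\<^sup>2 + (r * z)\<^sup>2) = l * B"
    "\<nu>3 * fuv3 - \<kappa> * (r * Y * (r * y) + r * Z * (r * z)) = l * C"
    "\<nu>3 * fvu3 - \<kappa> * (r * Y * (r * y) + r * Z * (r * z)) = l * D"
    unfolding ABCD_def \<nu>2 \<nu>3 \<kappa> by (simp_all add: power2_eq_square algebra_simps)
  with curv have "l * A * (l * B) - l * C * (l * D) = 0"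
    by simp
  then have "l\<^sup>2 * (A * B - C * D) = 0"
    by (simp add: power2_eq_square algebra_simps)
  moreover have "l \<noteq> 0" using lw by auto
  ultimately show "(- z * fuu2 + y * fuu3 - K * (1 + r\<^sup>2 * (Y\<^sup>2 + Z\<^sup>2))) * (- z * fvv2 + y * fvv3 - K * (r\<^sup>2 * (y\<^sup>2 + z\<^sup>2)))
      - (y * fuv3 - K * (r\<^sup>2 * (Y * y + Z * z))) * (y * fvu3 - K * (r\<^sup>2 * (Y * y + Z * z))) = 0"
    unfolding ABCD_def by simp
qed

text \<open>The coefficients of order 0, 1 and 2 of the equation
  \<open>(L - K E) (N - K G) - (M - K F)\<^sup>2 = 0\<close>, where \<open>E = 1 + E2 r\<^sup>2 + \<dots>\<close>, \<open>F = F2 r\<^sup>2 + \<dots>\<close>,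
  \<open>G = w r\<^sup>2 + \<dots>\<close>, \<open>N = - 2 a + \<dots>\<close> and \<open>M = 2 a t + \<dots>\<close>. The equation has exactly one
  smooth solution \<open>K\<close> because \<open>a \<noteq> 0\<close>.\<close>

lemma bounded_root_jet:
  fixes a t :: real
  assumes "a \<noteq> 0"
    and jets: "has_jet2 L L0 L1 L2" "has_jet2 N (- 2 * a) N1 N2" "has_jet2 M (2 * a * t) M1 M2"
      "has_jet2 M' (2 * a * t) M1 M2" "has_jet2 E 1 0 E2" "has_jet2 F 0 0 F2" "has_jet2 G 0 0 w"
      "has_jet2 K k0 k1 k2"
    and eq: "\<forall>\<^sub>F x in at 0. (L x - K x * E x) * (N x - K x * G x) - (M x - K x * F x) * (M' x - K x * F x) = 0"
  shows "k0 = L0 + 2 * a * t\<^sup>2" "k1 = L1 + t\<^sup>2 * N1 + 2 * t * M1"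
    "2 * a * k2 = 2 * a * (L2 - k0 * E2 + t\<^sup>2 * (N2 - k0 * w) + 2 * t * (M2 - k0 * F2)) + (t * N1 + M1)\<^sup>2"
proof -
  note 1 = has_jet2_diff[OF has_jet2_mult[OF has_jet2_diff[OF jets(1) has_jet2_mult[OF jets(8,5)]]
        has_jet2_diff[OF jets(2) has_jet2_mult[OF jets(8,7)]]]
      has_jet2_mult[OF has_jet2_diff[OF jets(3) has_jet2_mult[OF jets(8,6)]]
        has_jet2_diff[OF jets(4) has_jet2_mult[OF jets(8,6)]]]]
  note e = has_jet2_unique[OF 1 has_jet2_const[of 0] eq]
  \<comment> \<open>In each order the newest coefficient of \<open>K\<close> occurs linearly with
    factor \<open>2 * a\<close>, because \<open>N\<close> starts with \<open>- 2 * a\<close> while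
    \<open>F\<close> and \<open>G\<close> start in order two.\<close>
  have "2 * a * (k0 - (L0 + 2 * a * t\<^sup>2)) = 0"
    using e(1) by (simp add: power2_eq_square algebra_simps)
  then show k0: "k0 = L0 + 2 * a * t\<^sup>2"
    using assms(1) by simp
  have "2 * a * (k1 - (L1 + t\<^sup>2 * N1 + 2 * t * M1)) = 0"
    using e(2) unfolding k0 by (simp add: power2_eq_square algebra_simps)
  then show k1: "k1 = L1 + t\<^sup>2 * N1 + 2 * t * M1"
    using assms(1) by simp
  show "2 * a * k2 = 2 * a * (L2 - k0 * E2 + t\<^sup>2 * (N2 - k0 * w) + 2 * t * (M2 - k0 * F2)) + (t * N1 + M1)\<^sup>2"
  proof -
    \<comment> \<open>Eliminating \<open>L0\<close> and \<open>L1\<close>, and not \<open>k0\<close>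
      and \<open>k1\<close>, collects the products of first-order terms into the square of
      \<open>t * N1 + M1\<close>.\<close>
    have L: "L0 = k0 - 2 * a * t\<^sup>2" "L1 = k1 - t\<^sup>2 * N1 - 2 * t * M1"
      using k0 k1 by simp_all
    show ?thesis
      using e(3) unfolding L by (simp add: power2_eq_square algebra_simps)
  qed
qed

context umbrella_normal_form
begin

abbreviation "p0 \<equiv> f21 0"
abbreviation "p1 \<equiv> rderiv f21 0"
abbreviation "p2 \<equiv> rderiv (rderiv f21) 0 / 2"
abbreviation "q0 \<equiv> f31 0"
abbreviation "q1 \<equiv> rderiv f31 0"
abbreviation "q2 \<equiv> rderiv (rderiv f31) 0 / 2"
abbreviation "m0 \<equiv> f321 0"
abbreviation "m1 \<equiv> rderiv f321 0"
abbreviation "n0 \<equiv> f322 0"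
abbreviation "n1 \<equiv> pd1 f322 0"
abbreviation "n2 \<equiv> pd2 f322 0"
abbreviation "a0 \<equiv> f331 0"
abbreviation "a1 \<equiv> rderiv f331 0"
abbreviation "a2 \<equiv> rderiv (rderiv f331) 0 / 2"

lemmas coefficient_jets =
  has_jet2_rderiv[OF smooth_coefficients(1)]
  has_jet2_rderiv[OF smooth_germ_rderiv[OF smooth_coefficients(1)]]
  has_jet2_rderiv[OF smooth_germ_rderiv[OF smooth_germ_rderiv[OF smooth_coefficients(1)]]]
  has_jet2_rderiv[OF smooth_coefficients(2)]
  has_jet2_rderiv[OF smooth_germ_rderiv[OF smooth_coefficients(2)]]
  has_jet2_rderiv[OF smooth_germ_rderiv[OF smooth_germ_rderiv[OF smooth_coefficients(2)]]]
  has_jet2_rderiv[OF smooth_coefficients(3)]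
  has_jet2_rderiv[OF smooth_germ_rderiv[OF smooth_coefficients(3)]]
  has_jet2_rderiv[OF smooth_germ_rderiv[OF smooth_germ_rderiv[OF smooth_coefficients(3)]]]
  has_jet2_rderiv[OF smooth_coefficients(5)]
  has_jet2_rderiv[OF smooth_germ_rderiv[OF smooth_coefficients(5)]]
  has_jet2_rderiv[OF smooth_germ_rderiv[OF smooth_germ_rderiv[OF smooth_coefficients(5)]]]

lemma ray_eventually:
  assumes "\<forall>\<^sub>F p in nhds 0. P p"
  shows "\<forall>\<^sub>F r in at (0::real). P (r, r * t :: real)"
proof -
  have "((\<lambda>r. (r, r * t)) \<longlongrightarrow> 0) (at 0)"
    unfolding zero_prod_def by (auto intro!: tendsto_eq_intros)
  with assms show ?thesis by (rule eventually_compose_filterlim)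
qed

text \<open>On the ray the last two components of both first partial derivatives are divisible by
  \<open>r\<close>, and the quotients are what enters the curvature equation. Taylor coefficients
  beyond the jet meet enough powers of \<open>r\<close> to fall out of the two-jets, so the fourteen
  coordinates of the jet space suffice.\<close>

lemma ray_partial_derivative_jets:
  obtains Y Z z fuuy fuuz fuvz fvuz fvvz where
    "\<forall>\<^sub>F r in at 0. pd1 f (r, r * t) = vector [1, r * Y r, r * Z r]"
    "\<forall>\<^sub>F r in at 0. pd2 f (r, r * t) = vector [0, r * (2 * t), r * z r]"
    "\<forall>\<^sub>F r in at 0. pd1 (pd1 f) (r, r * t) = vector [0, fuuy r, fuuz r]"
    "\<forall>\<^sub>F r in at 0. pd2 (pd1 f) (r, r * t) = vector [0, 0, fuvz r]"
    "\<forall>\<^sub>F r in at 0. pd1 (pd2 f) (r, r * t) = vector [0, 0, fvuz r]"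
    "\<forall>\<^sub>F r in at 0. pd2 (pd2 f) (r, r * t) = vector [0, 2, fvvz r]"
    "\<forall>\<^sub>F r in at 0. f (r, r * t) $ 1 = r"
    "has_jet2 (\<lambda>r. f (r, r * t) $ 2) 0 0 (p0 + t\<^sup>2)"
    "has_jet2 (\<lambda>r. f (r, r * t) $ 3) 0 0 (q0 + a0 * t)"
    "has_jet2 Y (2 * p0) (3 * p1) (4 * p2)"
    "has_jet2 Z (2 * q0 + a0 * t) (3 * q1 + 2 * a1 * t + m0 * t\<^sup>2) (4 * q2 + 3 * a2 * t + 2 * m1 * t\<^sup>2 + n1 * t^3)"
    "has_jet2 z a0 (a1 + 2 * m0 * t + 3 * n0 * t\<^sup>2) (a2 + 2 * m1 * t + 3 * n1 * t\<^sup>2 + 4 * n2 * t^3)"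
    "has_jet2 fuuy (2 * p0) (6 * p1) (12 * p2)"
    "has_jet2 fuuz (2 * q0) (6 * q1 + 2 * a1 * t) (12 * q2 + 6 * a2 * t + 2 * m1 * t\<^sup>2)"
    "has_jet2 fuvz a0 (2 * a1 + 2 * m0 * t) (3 * a2 + 4 * m1 * t + 3 * n1 * t\<^sup>2)"
    "has_jet2 fvuz a0 (2 * a1 + 2 * m0 * t) (3 * a2 + 4 * m1 * t + 3 * n1 * t\<^sup>2)"
    "has_jet2 fvvz 0 (2 * m0 + 6 * n0 * t) (2 * m1 + 6 * n1 * t + 12 * n2 * t\<^sup>2)"
proof -
  note s322 = smooth_coefficients(4)
  obtain c0 where c0:
    "has_jet2 (\<lambda>r. f322 (r, r * t)) n0 (n1 + t * n2) c0"
    by (rule has_jet2_ray[OF s322])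
  obtain c1 where c1:
    "has_jet2 (\<lambda>r. pd1 f322 (r, r * t)) n1 (pd1 (pd1 f322) 0 + t * pd2 (pd1 f322) 0) c1"
    by (rule has_jet2_ray[OF smooth_germ_pd1[OF s322]])
  obtain c2 where c2:
    "has_jet2 (\<lambda>r. pd2 f322 (r, r * t)) n2 (pd1 (pd2 f322) 0 + t * pd2 (pd2 f322) 0) c2"
    by (rule has_jet2_ray[OF smooth_germ_pd2[OF s322]])
  obtain c11 where c11:
    "has_jet2 (\<lambda>r. pd1 (pd1 f322) (r, r * t)) (pd1 (pd1 f322) 0) (pd1 (pd1 (pd1 f322)) 0 + t * pd2 (pd1 (pd1 f322)) 0) c11"
    by (rule has_jet2_ray[OF smooth_germ_pd1[OF smooth_germ_pd1[OF s322]]])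
  obtain c12 where c12:
    "has_jet2 (\<lambda>r. pd2 (pd1 f322) (r, r * t)) (pd2 (pd1 f322) 0) (pd1 (pd2 (pd1 f322)) 0 + t * pd2 (pd2 (pd1 f322)) 0) c12"
    by (rule has_jet2_ray[OF smooth_germ_pd2[OF smooth_germ_pd1[OF s322]]])
  obtain c21 where c21:
    "has_jet2 (\<lambda>r. pd1 (pd2 f322) (r, r * t)) (pd1 (pd2 f322) 0) (pd1 (pd1 (pd2 f322)) 0 + t * pd2 (pd1 (pd2 f322)) 0) c21"
    by (rule has_jet2_ray[OF smooth_germ_pd1[OF smooth_germ_pd2[OF s322]]])
  obtain c22 where c22:
    "has_jet2 (\<lambda>r. pd2 (pd2 f322) (r, r * t)) (pd2 (pd2 f322) 0) (pd1 (pd2 (pd2 f322)) 0 + t * pd2 (pd2 (pd2 f322)) 0) c22"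
    by (rule has_jet2_ray[OF smooth_germ_pd2[OF smooth_germ_pd2[OF s322]]])
  note jets = jet2_intros coefficient_jets c0 c1 c2 c11 c12 c21 c22
  show ?thesis
  proof (rule that[where Y = "\<lambda>r. 2 * f21 r + r * rderiv f21 r"
      and Z = "\<lambda>r. 2 * f31 r + r * rderiv f31 r
          + r * (t\<^sup>2 * (f321 r + r * rderiv f321 r + r * t * pd1 f322 (r, r * t)))
          + t * f331 r + r * t * rderiv f331 r"
      and z = "\<lambda>r. 2 * t * (r * f321 r) + r * (3 * t\<^sup>2) * f322 (r, r * t)
          + r\<^sup>2 * (t^3 * pd2 f322 (r, r * t)) + f331 r"
      and fuuy = "\<lambda>r. 2 * f21 r + 4 * (r * rderiv f21 r) + r\<^sup>2 * rderiv (rderiv f21) r"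
      and fuuz = "\<lambda>r. 2 * f31 r + 4 * (r * rderiv f31 r) + r\<^sup>2 * rderiv (rderiv f31) r
          + r\<^sup>2 * (t\<^sup>2 * (2 * rderiv f321 r + r * rderiv (rderiv f321) r + r * t * pd1 (pd1 f322) (r, r * t)))
          + r * t * (2 * rderiv f331 r + r * rderiv (rderiv f331) r)"
      and fuvz = "\<lambda>r. 2 * (r * t) * (f321 r + r * rderiv f321 r + r * t * pd1 f322 (r, r * t))
          + r\<^sup>2 * (t\<^sup>2 * (pd1 f322 (r, r * t) + r * t * pd2 (pd1 f322) (r, r * t)))
          + f331 r + r * rderiv f331 r"
      and fvuz = "\<lambda>r. 2 * (r * t) * (f321 r + r * rderiv f321 r) + 3 * (r\<^sup>2 * (t\<^sup>2 * pd1 f322 (r, r * t)))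
          + r * (r\<^sup>2 * (t^3 * pd1 (pd2 f322) (r, r * t))) + f331 r + r * rderiv f331 r"
      and fvvz = "\<lambda>r. 2 * (r * f321 r) + 6 * (r * t) * f322 (r, r * t) + 6 * (r\<^sup>2 * (t\<^sup>2 * pd2 f322 (r, r * t)))
          + r * (r\<^sup>2 * (t^3 * pd2 (pd2 f322) (r, r * t)))"])
    show "\<forall>\<^sub>F r in at 0. f (r, r * t) $ 1 = r"
      using ray_eventually[OF f_nth(1), of t] by simp
    have "has_jet2 (\<lambda>r. r\<^sup>2 * f21 r + r\<^sup>2 * t\<^sup>2) 0 0 (p0 + t\<^sup>2)"
      by (rule has_jet2_eq, (rule jets)+) (simp_all add: algebra_simps)
    then show "has_jet2 (\<lambda>r. f (r, r * t) $ 2) 0 0 (p0 + t\<^sup>2)"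
      using ray_eventually[OF f_nth(2), of t] by (subst has_jet2_cong) (auto simp: power_mult_distrib)
    have "has_jet2 (\<lambda>r. r\<^sup>2 * f31 r + r\<^sup>2 * t\<^sup>2 * (r * f321 r + r * t * f322 (r, r * t)) + r\<^sup>2 * t * f331 r) 0 0 (q0 + a0 * t)"
      by (rule has_jet2_eq, (rule jets)+) (simp_all add: algebra_simps)
    then show "has_jet2 (\<lambda>r. f (r, r * t) $ 3) 0 0 (q0 + a0 * t)"
      using ray_eventually[OF f_nth(3), of t]
      by (subst has_jet2_cong) (auto simp: power_mult_distrib power2_eq_square mult_ac)
    show "has_jet2 (\<lambda>r. 2 * f21 r + r * rderiv f21 r) (2 * p0) (3 * p1) (4 * p2)"
      by (rule has_jet2_eq, (rule jets)+) (simp_all add: algebra_simps)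
    show "has_jet2 (\<lambda>r. 2 * f31 r + r * rderiv f31 r
          + r * (t\<^sup>2 * (f321 r + r * rderiv f321 r + r * t * pd1 f322 (r, r * t)))
          + t * f331 r + r * t * rderiv f331 r)
      (2 * q0 + a0 * t) (3 * q1 + 2 * a1 * t + m0 * t\<^sup>2) (4 * q2 + 3 * a2 * t + 2 * m1 * t\<^sup>2 + n1 * t^3)"
      by (rule has_jet2_eq, (rule jets)+)
        (simp_all add: algebra_simps power2_eq_square power3_eq_cube)
    show "has_jet2 (\<lambda>r. 2 * t * (r * f321 r) + r * (3 * t\<^sup>2) * f322 (r, r * t)
          + r\<^sup>2 * (t^3 * pd2 f322 (r, r * t)) + f331 r)
      a0 (a1 + 2 * m0 * t + 3 * n0 * t\<^sup>2) (a2 + 2 * m1 * t + 3 * n1 * t\<^sup>2 + 4 * n2 * t^3)"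
      by (rule has_jet2_eq, (rule jets)+)
        (simp_all add: algebra_simps power2_eq_square power3_eq_cube)
    show "has_jet2 (\<lambda>r. 2 * f21 r + 4 * (r * rderiv f21 r) + r\<^sup>2 * rderiv (rderiv f21) r)
      (2 * p0) (6 * p1) (12 * p2)"
      by (rule has_jet2_eq, (rule jets)+)
        (simp_all add: algebra_simps power2_eq_square power3_eq_cube)
    show "has_jet2 (\<lambda>r. 2 * f31 r + 4 * (r * rderiv f31 r) + r\<^sup>2 * rderiv (rderiv f31) r
          + r\<^sup>2 * (t\<^sup>2 * (2 * rderiv f321 r + r * rderiv (rderiv f321) r + r * t * pd1 (pd1 f322) (r, r * t)))
          + r * t * (2 * rderiv f331 r + r * rderiv (rderiv f331) r))
      (2 * q0) (6 * q1 + 2 * a1 * t) (12 * q2 + 6 * a2 * t + 2 * m1 * t\<^sup>2)"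
      by (rule has_jet2_eq, (rule jets)+)
        (simp_all add: algebra_simps power2_eq_square power3_eq_cube)
    show "has_jet2 (\<lambda>r. 2 * (r * t) * (f321 r + r * rderiv f321 r + r * t * pd1 f322 (r, r * t))
          + r\<^sup>2 * (t\<^sup>2 * (pd1 f322 (r, r * t) + r * t * pd2 (pd1 f322) (r, r * t)))
          + f331 r + r * rderiv f331 r)
      a0 (2 * a1 + 2 * m0 * t) (3 * a2 + 4 * m1 * t + 3 * n1 * t\<^sup>2)"
      by (rule has_jet2_eq, (rule jets)+)
        (simp_all add: algebra_simps power2_eq_square power3_eq_cube)
    show "has_jet2 (\<lambda>r. 2 * (r * t) * (f321 r + r * rderiv f321 r) + 3 * (r\<^sup>2 * (t\<^sup>2 * pd1 f322 (r, r * t)))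
          + r * (r\<^sup>2 * (t^3 * pd1 (pd2 f322) (r, r * t))) + f331 r + r * rderiv f331 r)
      a0 (2 * a1 + 2 * m0 * t) (3 * a2 + 4 * m1 * t + 3 * n1 * t\<^sup>2)"
      by (rule has_jet2_eq, (rule jets)+)
        (simp_all add: algebra_simps power2_eq_square power3_eq_cube)
    show "has_jet2 (\<lambda>r. 2 * (r * f321 r) + 6 * (r * t) * f322 (r, r * t) + 6 * (r\<^sup>2 * (t\<^sup>2 * pd2 f322 (r, r * t)))
          + r * (r\<^sup>2 * (t^3 * pd2 (pd2 f322) (r, r * t))))
      0 (2 * m0 + 6 * n0 * t) (2 * m1 + 6 * n1 * t + 12 * n2 * t\<^sup>2)"
      by (rule has_jet2_eq, (rule jets)+)
        (simp_all add: algebra_simps power2_eq_square power3_eq_cube)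
    show "\<forall>\<^sub>F r in at 0. pd1 f (r, r * t) = vector
      [1, r * (2 * f21 r + r * rderiv f21 r),
        r * (2 * f31 r + r * rderiv f31 r
          + r * (t\<^sup>2 * (f321 r + r * rderiv f321 r + r * t * pd1 f322 (r, r * t)))
          + t * f331 r + r * t * rderiv f331 r)]"
      using pd1_f_nth[THEN ray_eventually, of t]
      by eventually_elim (simp add: Finite_Cartesian_Product.vec_eq_iff forall_3 algebra_simps power2_eq_square power3_eq_cube)
    show "\<forall>\<^sub>F r in at 0. pd2 f (r, r * t) = vector
      [0, r * (2 * t),
        r * (2 * t * (r * f321 r) + r * (3 * t\<^sup>2) * f322 (r, r * t)
          + r\<^sup>2 * (t^3 * pd2 f322 (r, r * t)) + f331 r)]"
      using pd2_f_nth[THEN ray_eventually, of t]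
      by eventually_elim (simp add: Finite_Cartesian_Product.vec_eq_iff forall_3 algebra_simps power2_eq_square power3_eq_cube)
    show "\<forall>\<^sub>F r in at 0. pd1 (pd1 f) (r, r * t) = vector
      [0, 2 * f21 r + 4 * (r * rderiv f21 r) + r\<^sup>2 * rderiv (rderiv f21) r,
        2 * f31 r + 4 * (r * rderiv f31 r) + r\<^sup>2 * rderiv (rderiv f31) r
          + r\<^sup>2 * (t\<^sup>2 * (2 * rderiv f321 r + r * rderiv (rderiv f321) r + r * t * pd1 (pd1 f322) (r, r * t)))
          + r * t * (2 * rderiv f331 r + r * rderiv (rderiv f331) r)]"
      using pd1_pd1_f_nth[THEN ray_eventually, of t]
      by eventually_elim (simp add: Finite_Cartesian_Product.vec_eq_iff forall_3 algebra_simps power2_eq_square power3_eq_cube)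
    show "\<forall>\<^sub>F r in at 0. pd2 (pd1 f) (r, r * t) = vector
      [0, 0, 2 * (r * t) * (f321 r + r * rderiv f321 r + r * t * pd1 f322 (r, r * t))
          + r\<^sup>2 * (t\<^sup>2 * (pd1 f322 (r, r * t) + r * t * pd2 (pd1 f322) (r, r * t)))
          + f331 r + r * rderiv f331 r]"
      using pd2_pd1_f_nth[THEN ray_eventually, of t]
      by eventually_elim (simp add: Finite_Cartesian_Product.vec_eq_iff forall_3 algebra_simps power2_eq_square power3_eq_cube)
    show "\<forall>\<^sub>F r in at 0. pd1 (pd2 f) (r, r * t) = vector
      [0, 0, 2 * (r * t) * (f321 r + r * rderiv f321 r) + 3 * (r\<^sup>2 * (t\<^sup>2 * pd1 f322 (r, r * t)))
          + r * (r\<^sup>2 * (t^3 * pd1 (pd2 f322) (r, r * t))) + f331 r + r * rderiv f331 r]"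
      using pd1_pd2_f_nth[THEN ray_eventually, of t]
      by eventually_elim (simp add: Finite_Cartesian_Product.vec_eq_iff forall_3 algebra_simps power2_eq_square power3_eq_cube)
    show "\<forall>\<^sub>F r in at 0. pd2 (pd2 f) (r, r * t) = vector
      [0, 2, 2 * (r * f321 r) + 6 * (r * t) * f322 (r, r * t) + 6 * (r\<^sup>2 * (t\<^sup>2 * pd2 f322 (r, r * t)))
          + r * (r\<^sup>2 * (t^3 * pd2 (pd2 f322) (r, r * t)))]"
      using pd2_pd2_f_nth[THEN ray_eventually, of t]
      by eventually_elim (simp add: Finite_Cartesian_Product.vec_eq_iff forall_3 algebra_simps power2_eq_square power3_eq_cube)
  qed
qed

text \<open>The conclusions compare the coefficients of orders 0 to 2 in
  \<open>w * (\<kappa> * \<nu>) = K (N, - z, 2 * t)\<close>, with the jet of \<open>K\<close>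
  supplied by \<open>bounded_root_jet\<close>. They are left undivided to stay polynomial, and
  \<open>k2\<close> is given through \<open>a0 * k2\<close> for the same reason. The number
  \<open>k0\<close> has two roles: it is the limit of \<open>K\<close> and minus the slope of
  \<open>N\<close>.\<close>

lemma principal_curvature_jet:
  fixes \<kappa> :: "real \<Rightarrow> real" and \<nu> :: "real \<Rightarrow> real^3"
  assumes \<kappa>: "has_jet2 \<kappa> \<kappa>0 \<kappa>1 \<kappa>2" and \<nu>: "\<And>i. has_jet2 (\<lambda>r. \<nu> r $ i) (\<nu>0 i) (\<nu>1 i) (\<nu>2 i)"
    and curv: "\<forall>\<^sub>F r in at 0. unit_normal_at f (r, r * t) (\<nu> r) \<and> principal_curvature f (\<nu> r) (r, r * t) (\<kappa> r)"
    and g: "\<And>i. has_jet2 (\<lambda>r. \<kappa> r * \<nu> r $ i) (g0 i) (g1 i) (g2 i)"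
    and z1: "z1 = a1 + 2 * m0 * t + 3 * n0 * t\<^sup>2"
    and z2: "z2 = a2 + 2 * m1 * t + 3 * n1 * t\<^sup>2 + 4 * n2 * t^3"
    and X2: "X2 = 2 * p0 * z1 + 3 * p1 * a0 - 2 * t * (3 * q1 + 2 * a1 * t + m0 * t\<^sup>2)"
    and w0: "w0 = a0\<^sup>2 + 4 * t\<^sup>2" and w2: "w2 = k0\<^sup>2 + z1\<^sup>2 + 2 * a0 * z2"
    and k0: "k0 = 2 * (a0 * t\<^sup>2 + 2 * q0 * t - a0 * p0)"
    and k1: "k1 = - (6 * a0 * p1 + 2 * p0 * z1) + 2 * t * (6 * q1 + 2 * a1 * t)
        + t\<^sup>2 * (6 * n0 * t\<^sup>2 - 2 * a1) + 2 * t * (4 * a1 * t + 4 * m0 * t\<^sup>2)"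
    and k2: "a0 * k2 = a0 * (2 * t * (12 * q2 + 6 * a2 * t + 2 * m1 * t\<^sup>2) - (12 * a0 * p2 + 6 * p1 * z1 + 2 * p0 * z2)
        - k0 * (4 * p0\<^sup>2 + (2 * q0 + a0 * t)\<^sup>2)
        + t\<^sup>2 * (2 * t * (2 * m1 + 6 * n1 * t + 12 * n2 * t\<^sup>2) - 2 * z2 - k0 * w0)
        + 2 * t * (2 * t * (3 * a2 + 4 * m1 * t + 3 * n1 * t\<^sup>2) - k0 * (4 * t * p0 + a0 * (2 * q0 + a0 * t)))) + 2 * t\<^sup>2 * z1\<^sup>2"
  shows "w0 * g0 1 = 0" "w0 * g1 1 + 2 * a0 * z1 * g0 1 = - k0\<^sup>2"
    "w0 * g2 1 + 2 * a0 * z1 * g1 1 + w2 * g0 1 = k0 * X2 - k1 * k0"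
    "w0 * g0 2 = - (a0 * k0)" "w0 * g1 2 + 2 * a0 * z1 * g0 2 = - (k0 * z1 + k1 * a0)"
    "w0 * g2 2 + 2 * a0 * z1 * g1 2 + w2 * g0 2 = - (k0 * z2 + k1 * z1 + k2 * a0)"
    "w0 * g0 3 = 2 * t * k0" "w0 * g1 3 + 2 * a0 * z1 * g0 3 = 2 * t * k1"
    "w0 * g2 3 + 2 * a0 * z1 * g1 3 + w2 * g0 3 = 2 * t * k2"
proof -
  obtain Y Z z fuuy fuuz fuvz fvuz fvvz where partials:
    "\<forall>\<^sub>F r in at 0. pd1 f (r, r * t) = vector [1, r * Y r, r * Z r]"
    "\<forall>\<^sub>F r in at 0. pd2 f (r, r * t) = vector [0, r * (2 * t), r * z r]"
    "\<forall>\<^sub>F r in at 0. pd1 (pd1 f) (r, r * t) = vector [0, fuuy r, fuuz r]"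
    "\<forall>\<^sub>F r in at 0. pd2 (pd1 f) (r, r * t) = vector [0, 0, fuvz r]"
    "\<forall>\<^sub>F r in at 0. pd1 (pd2 f) (r, r * t) = vector [0, 0, fvuz r]"
    "\<forall>\<^sub>F r in at 0. pd2 (pd2 f) (r, r * t) = vector [0, 2, fvvz r]"
    and jets: "has_jet2 Y (2 * p0) (3 * p1) (4 * p2)"
    "has_jet2 Z (2 * q0 + a0 * t) (3 * q1 + 2 * a1 * t + m0 * t\<^sup>2) (4 * q2 + 3 * a2 * t + 2 * m1 * t\<^sup>2 + n1 * t^3)"
    "has_jet2 z a0 (a1 + 2 * m0 * t + 3 * n0 * t\<^sup>2) (a2 + 2 * m1 * t + 3 * n1 * t\<^sup>2 + 4 * n2 * t^3)"
    "has_jet2 fuuy (2 * p0) (6 * p1) (12 * p2)"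
    "has_jet2 fuuz (2 * q0) (6 * q1 + 2 * a1 * t) (12 * q2 + 6 * a2 * t + 2 * m1 * t\<^sup>2)"
    "has_jet2 fuvz a0 (2 * a1 + 2 * m0 * t) (3 * a2 + 4 * m1 * t + 3 * n1 * t\<^sup>2)"
    "has_jet2 fvuz a0 (2 * a1 + 2 * m0 * t) (3 * a2 + 4 * m1 * t + 3 * n1 * t\<^sup>2)"
    "has_jet2 fvvz 0 (2 * m0 + 6 * n0 * t) (2 * m1 + 6 * n1 * t + 12 * n2 * t\<^sup>2)"
    by (rule ray_partial_derivative_jets[of t]) blast
  define N where "N r = r * (Y r * z r - Z r * (2 * t))" for r
  define K where "K r = \<kappa> r * (\<nu> r $ 1 * N r - \<nu> r $ 2 * z r + \<nu> r $ 3 * (2 * t))" for r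
  define w where "w r = (N r)\<^sup>2 + (z r)\<^sup>2 + (2 * t)\<^sup>2" for r
  have "\<forall>\<^sub>F r in at 0. z r \<noteq> 0"
    using tendsto_imp_eventually_ne[OF has_jet2_tendsto[OF jets(3)]] f331_pos by auto
  moreover have "\<forall>\<^sub>F r in at (0::real). r \<noteq> 0"
    by (simp add: eventually_at_filter)
  ultimately have ev: "\<forall>\<^sub>F r in at 0.
      (- z r * fuuy r + 2 * t * fuuz r - K r * (1 + r\<^sup>2 * ((Y r)\<^sup>2 + (Z r)\<^sup>2)))
        * (- z r * 2 + 2 * t * fvvz r - K r * (r\<^sup>2 * ((2 * t)\<^sup>2 + (z r)\<^sup>2)))
      - (2 * t * fuvz r - K r * (r\<^sup>2 * (Y r * (2 * t) + Z r * z r)))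
        * (2 * t * fvuz r - K r * (r\<^sup>2 * (Y r * (2 * t) + Z r * z r))) = 0
      \<and> w r * (\<kappa> r * \<nu> r $ 1) = K r * N r \<and> w r * (\<kappa> r * \<nu> r $ 2) = - (K r * z r)
      \<and> w r * (\<kappa> r * \<nu> r $ 3) = K r * (2 * t)"
    using partials curv
  proof eventually_elim
    case (elim r)
    have unit: "(\<nu> r $ 1)\<^sup>2 + (\<nu> r $ 2)\<^sup>2 + (\<nu> r $ 3)\<^sup>2 = 1"
      and orth: "\<nu> r $ 1 + \<nu> r $ 2 * (r * Y r) + \<nu> r $ 3 * (r * Z r) = 0"
        "\<nu> r $ 2 * (r * (2 * t)) + \<nu> r $ 3 * (r * z r) = 0"
      using elim by (auto simp: unit_normal_at_def norm_eq_1 inner_vec_def sum_3 power2_eq_square)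
    have "(\<nu> r $ 2 * fuuy r + \<nu> r $ 3 * fuuz r - \<kappa> r * (1 + (r * Y r)\<^sup>2 + (r * Z r)\<^sup>2))
          * (\<nu> r $ 2 * 2 + \<nu> r $ 3 * fvvz r - \<kappa> r * ((r * (2 * t))\<^sup>2 + (r * z r)\<^sup>2))
        - (\<nu> r $ 3 * fuvz r - \<kappa> r * (r * Y r * (r * (2 * t)) + r * Z r * (r * z r)))
          * (\<nu> r $ 3 * fvuz r - \<kappa> r * (r * Y r * (r * (2 * t)) + r * Z r * (r * z r))) = 0"
      using elim by (simp add: principal_curvature_def det_2 first_form_def second_form_def
          inner_vec_def sum_3 power2_eq_square mult_ac)
    from unnormalized_principal_curvature[OF elim(2,1) unit orth this]
    show ?case unfolding K_def N_def w_def by (simp add: add.assoc)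
  qed
  have jN: "has_jet2 N 0 (- k0) X2"
    unfolding N_def k0 X2 z1
    by (rule has_jet2_eq, (rule jet2_intros jets)+) (simp_all add: power2_eq_square algebra_simps)
  \<comment> \<open>It is enough to know that \<open>K\<close> has some two-jet; the quadratic
    equation then forces its coefficients.\<close>
  have "\<exists>K0 K1 K2. has_jet2 K K0 K1 K2"
    unfolding K_def by (intro exI, (rule jet2_intros jN jets \<kappa> \<nu>)+)
  then obtain K0 K1 K2 where jK: "has_jet2 K K0 K1 K2" by blast
  have jL: "has_jet2 (\<lambda>r. - z r * fuuy r + 2 * t * fuuz r) (- (2 * a0 * p0) + 4 * t * q0)
      (- (6 * a0 * p1 + 2 * p0 * z1) + 2 * t * (6 * q1 + 2 * a1 * t))
      (2 * t * (12 * q2 + 6 * a2 * t + 2 * m1 * t\<^sup>2) - (12 * a0 * p2 + 6 * p1 * z1 + 2 * p0 * z2))"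
    unfolding z1 z2
    by (rule has_jet2_eq, (rule jet2_intros jets)+) (simp_all add: algebra_simps)
  have jNN: "has_jet2 (\<lambda>r. - z r * 2 + 2 * t * fvvz r) (- 2 * a0) (6 * n0 * t\<^sup>2 - 2 * a1)
      (2 * t * (2 * m1 + 6 * n1 * t + 12 * n2 * t\<^sup>2) - 2 * z2)"
    unfolding z2
    by (rule has_jet2_eq, (rule jet2_intros jets)+) (simp_all add: power2_eq_square algebra_simps)
  have jM: "has_jet2 (\<lambda>r. 2 * t * fuvz r) (2 * a0 * t) (4 * a1 * t + 4 * m0 * t\<^sup>2) (2 * t * (3 * a2 + 4 * m1 * t + 3 * n1 * t\<^sup>2))"
    "has_jet2 (\<lambda>r. 2 * t * fvuz r) (2 * a0 * t) (4 * a1 * t + 4 * m0 * t\<^sup>2) (2 * t * (3 * a2 + 4 * m1 * t + 3 * n1 * t\<^sup>2))"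
    by (rule has_jet2_eq, (rule jet2_intros jets)+, simp_all add: power2_eq_square algebra_simps)+
  have jE: "has_jet2 (\<lambda>r. 1 + r\<^sup>2 * ((Y r)\<^sup>2 + (Z r)\<^sup>2)) 1 0 (4 * p0\<^sup>2 + (2 * q0 + a0 * t)\<^sup>2)"
    by (rule has_jet2_eq, (rule jet2_intros jets)+) (simp_all add: power_mult_distrib)
  have jF: "has_jet2 (\<lambda>r. r\<^sup>2 * (Y r * (2 * t) + Z r * z r)) 0 0 (4 * t * p0 + a0 * (2 * q0 + a0 * t))"
    by (rule has_jet2_eq, (rule jet2_intros jets)+) (simp_all add: algebra_simps)
  have jG: "has_jet2 (\<lambda>r. r\<^sup>2 * ((2 * t)\<^sup>2 + (z r)\<^sup>2)) 0 0 w0"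
    unfolding w0 by (rule has_jet2_eq, (rule jet2_intros jets)+) (simp_all add: power_mult_distrib)
  have nz: "a0 \<noteq> 0" using f331_pos by simp
  note root = bounded_root_jet[OF nz jL jNN jM jE jF jG jK eventually_mono[OF ev conjunct1]]
  have K0: "K0 = k0"
    using root(1) unfolding k0 by (simp add: algebra_simps)
  have K1: "K1 = k1"
    using root(2) unfolding k1 by simp
  have "2 * a0 * K2 = 2 * (a0 * k2)"
    using root(3) unfolding k2 K0 z1 by (simp add: power2_eq_square power3_eq_cube algebra_simps)
  then have K2: "K2 = k2"
    using nz by simp
  note jK = jK[unfolded K0 K1 K2]
  note jz = jets(3)[folded z1 z2]
  have jw: "has_jet2 w w0 (2 * a0 * z1) w2"
    unfolding w_def w0 w2
    by (rule has_jet2_eq, (rule jet2_intros jN jz)+) (simp_all add: power_mult_distrib)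
  note 1 = has_jet2_unique[OF has_jet2_mult[OF jw g[of 1]] has_jet2_mult[OF jK jN] eventually_mono[OF ev]]
  note 2 = has_jet2_unique[OF has_jet2_mult[OF jw g[of 2]] has_jet2_minus[OF has_jet2_mult[OF jK jz]] eventually_mono[OF ev]]
  note 3 = has_jet2_unique[OF has_jet2_mult[OF jw g[of 3]] has_jet2_mult[OF jK has_jet2_const[of "2 * t"]] eventually_mono[OF ev]]
  show "w0 * g0 1 = 0" "w0 * g1 1 + 2 * a0 * z1 * g0 1 = - k0\<^sup>2"
    "w0 * g2 1 + 2 * a0 * z1 * g1 1 + w2 * g0 1 = k0 * X2 - k1 * k0"
    using 1 by (simp_all add: power2_eq_square)
  show "w0 * g0 2 = - (a0 * k0)" "w0 * g1 2 + 2 * a0 * z1 * g0 2 = - (k0 * z1 + k1 * a0)"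
    "w0 * g2 2 + 2 * a0 * z1 * g1 2 + w2 * g0 2 = - (k0 * z2 + k1 * z1 + k2 * a0)"
    using 2 by (simp_all add: mult_ac)
  show "w0 * g0 3 = 2 * t * k0" "w0 * g1 3 + 2 * a0 * z1 * g0 3 = 2 * t * k1"
    "w0 * g2 3 + 2 * a0 * z1 * g1 3 + w2 * g0 3 = 2 * t * k2"
    using 3 by (simp_all add: mult_ac)
qed

end

subsection \<open>Jets of the principal curvature surface\<close>

lemma has_jet2_scale:
  assumes "has_jet2 g a b c" "k \<noteq> 0"
  shows "has_jet2 (\<lambda>x. g (k * x)) a (k * b) (k\<^sup>2 * c)"
proof -
  have "filterlim (\<lambda>x. k * x) (at 0) (at 0)"
    using assms(2) by (auto simp: filterlim_at eventually_at_filter intro!: tendsto_eq_intros)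
  from filterlim_compose[OF assms(1)[unfolded has_jet2_def] this]
  have "((\<lambda>x. (g (k * x) - (a + b * (k * x) + c * (k * x)\<^sup>2)) / (k * x)\<^sup>2 * k\<^sup>2) \<longlongrightarrow> 0 * k\<^sup>2) (at 0)"
    by (intro tendsto_intros)
  then show ?thesis
    unfolding has_jet2_def using assms(2) by (simp add: power_mult_distrib mult_ac)
qed

lemma differentiable_transform_eventually:
  assumes "f differentiable (at x)" "\<forall>\<^sub>F y in nhds x. f y = g y"
  shows "g differentiable (at x)"
proof -
  obtain f' where "(f has_derivative f') (at x)"
    using assms(1) by (auto simp: differentiable_def)
  then have "(g has_derivative f') (at x)"
    by (rule has_derivative_transform_eventually)
      (use assms(2) eventually_nhds_x_imp_x[OF assms(2)] in \<open>auto simp: eventually_at_filter elim: eventually_mono\<close>)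
  then show ?thesis by (auto simp: differentiable_def)
qed

lemma blowup_map_has_derivative:
  "(blowup_map has_derivative (\<lambda>v. (fst v * cos (snd q) - fst q * sin (snd q) * snd v,
      fst v * sin (snd q) + fst q * cos (snd q) * snd v))) (at q)"
  unfolding blowup_map_def case_prod_unfold by (auto intro!: derivative_eq_intros)

lemma continuous_blowup_map: "isCont blowup_map q"
  using blowup_map_has_derivative by (rule has_derivative_continuous)

text \<open>Partial derivatives are total functions here, so \<open>pd1 (pd1 h)\<close> is
  meaningful only once differentiability is known. On \<open>U\<close> it follows from the formula
  for \<open>h\<close>, the chain rule and the smoothness of \<open>\<nu>\<close> and
  \<open>\<kappa>\<close>.\<close>

lemma principal_curvature_surface_differentiable:
  fixes f h :: "real \<times> real \<Rightarrow> real^3"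
  assumes f: "smooth_germ f" and U: "open U" "(0, \<theta>) \<in> U" and smooth: "smooth_on U \<nu>" "smooth_on U \<kappa>"
    and h: "\<forall>p\<in>U. h p = f (blowup_map p) + \<kappa> p *\<^sub>R \<nu> p"
  shows "\<forall>\<^sub>F q in nhds (0, \<theta>). h differentiable (at q)" "pd1 h differentiable (at (0, \<theta>))"
proof -
  have "blowup_map (0, \<theta>) = 0"
    by (simp add: blowup_map_def zero_prod_def)
  then have lim: "(blowup_map \<longlongrightarrow> 0) (nhds (0, \<theta>))"
    using continuous_blowup_map[of "(0, \<theta>)"] by (simp add: isCont_def tendsto_nhds_iff)
  have ev_f: "\<forall>\<^sub>F q in nhds (0, \<theta>). f differentiable (at (blowup_map q))"
    using smooth_germ_differentiable[OF f] lim by (rule eventually_compose_filterlim)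
  have ev_U: "\<forall>\<^sub>F q in nhds (0, \<theta>). q \<in> U"
    using U by (rule eventually_nhds_in_open)
  have D: "(h has_derivative (\<lambda>v. frechet_derivative f (at (blowup_map q))
        (fst v * cos (snd q) - fst q * sin (snd q) * snd v, fst v * sin (snd q) + fst q * cos (snd q) * snd v)
      + (\<kappa> q *\<^sub>R frechet_derivative \<nu> (at q) v + frechet_derivative \<kappa> (at q) v *\<^sub>R \<nu> q))) (at q)"
    if "f differentiable (at (blowup_map q))" "q \<in> U" for q
  proof -
    have "((\<lambda>p. f (blowup_map p)) has_derivative (\<lambda>v. frechet_derivative f (at (blowup_map q))
        (fst v * cos (snd q) - fst q * sin (snd q) * snd v, fst v * sin (snd q) + fst q * cos (snd q) * snd v))) (at q)"
      using that(1) unfolding frechet_derivative_works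
      by (rule has_derivative_compose[OF blowup_map_has_derivative])
    moreover have "(\<nu> has_derivative frechet_derivative \<nu> (at q)) (at q)"
      "(\<kappa> has_derivative frechet_derivative \<kappa> (at q)) (at q)"
      using smooth that(2) smooth_on_differentiable by (auto simp: frechet_derivative_works[symmetric])
    ultimately have "((\<lambda>p. f (blowup_map p) + \<kappa> p *\<^sub>R \<nu> p) has_derivative (\<lambda>v. frechet_derivative f (at (blowup_map q))
        (fst v * cos (snd q) - fst q * sin (snd q) * snd v, fst v * sin (snd q) + fst q * cos (snd q) * snd v)
      + (\<kappa> q *\<^sub>R frechet_derivative \<nu> (at q) v + frechet_derivative \<kappa> (at q) v *\<^sub>R \<nu> q))) (at q)"
      by (intro has_derivative_add has_derivative_scaleR)
    then show ?thesis
      by (rule has_derivative_transform_within_open[OF _ U(1) that(2)]) (simp add: h)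
  qed
  show "\<forall>\<^sub>F q in nhds (0, \<theta>). h differentiable (at q)"
    using ev_f ev_U by eventually_elim (use D in \<open>auto simp: differentiable_def\<close>)
  let ?d = "\<lambda>q. (cos (snd q) *\<^sub>R pd1 f (blowup_map q) + sin (snd q) *\<^sub>R pd2 f (blowup_map q))
      + (\<kappa> q *\<^sub>R pd1 \<nu> q + pd1 \<kappa> q *\<^sub>R \<nu> q)"
  have eq: "\<forall>\<^sub>F q in nhds (0, \<theta>). ?d q = pd1 h q"
    using ev_f ev_U
  proof eventually_elim
    case (elim q)
    note lin = linear_frechet_derivative[OF elim(1)]
    have "(cos (snd q), sin (snd q)) = cos (snd q) *\<^sub>R (1, 0) + sin (snd q) *\<^sub>R (0, 1 :: real)"
      by simp
    then have "frechet_derivative f (at (blowup_map q)) (cos (snd q), sin (snd q))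
      = frechet_derivative f (at (blowup_map q)) (cos (snd q) *\<^sub>R (1, 0) + sin (snd q) *\<^sub>R (0, 1))"
      by (rule arg_cong)
    also have "\<dots> = cos (snd q) *\<^sub>R pd1 f (blowup_map q) + sin (snd q) *\<^sub>R pd2 f (blowup_map q)"
      by (simp only: linear_add[OF lin] linear_cmul[OF lin] pd1_def pd2_def)
    finally show ?case
      unfolding pd1_def[of h] frechet_derivative_at[OF D[OF elim], symmetric]
      by (simp add: pd1_def[of \<nu>] pd1_def[of \<kappa>])
  qed
  have comp: "(\<lambda>q. g (blowup_map q)) differentiable (at (0, \<theta>))" if "smooth_germ g"
    for g :: "real \<times> real \<Rightarrow> real^3"
  proof -
    have "g differentiable (at (blowup_map (0, \<theta>)))"
      unfolding \<open>blowup_map (0, \<theta>) = 0\<close>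
      using eventually_nhds_x_imp_x[OF smooth_germ_differentiable[OF that]] .
    then obtain g' where "(g has_derivative g') (at (blowup_map (0, \<theta>)))"
      unfolding differentiable_def by blast
    from has_derivative_compose[OF blowup_map_has_derivative this] show ?thesis
      unfolding differentiable_def by blast
  qed
  note pd = comp[OF smooth_germ_pd1[OF f]] comp[OF smooth_germ_pd2[OF f]]
  have trig: "(\<lambda>q. cos (snd q)) differentiable (at (0, \<theta>))" "(\<lambda>q. sin (snd q)) differentiable (at (0, \<theta>))"
    by (auto simp: differentiable_def intro!: exI derivative_eq_intros)
  have "smooth_on U (pd1 \<nu>)" "smooth_on U (pd1 \<kappa>)"
    using smooth_on_directional smooth by (auto simp: pd1_def[abs_def])
  note sm = smooth_on_differentiable[OF this(1) U(2)] smooth_on_differentiable[OF this(2) U(2)]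
    smooth_on_differentiable[OF smooth(1) U(2)] smooth_on_differentiable[OF smooth(2) U(2)]
  then have "?d differentiable (at (0, \<theta>))"
    by (intro differentiable_add differentiable_scaleR pd trig)
  then show "pd1 h differentiable (at (0, \<theta>))"
    using eq by (rule differentiable_transform_eventually)
qed

context umbrella_normal_form
begin

text \<open>The ray is parametrized by its first coordinate:
  \<open>blowup_map (r / cos \<theta>, \<theta>)\<close> is \<open>(r, r * tan \<theta>)\<close>.
  Then \<open>u\<close> and \<open>s\<close> are the Taylor coefficients of \<open>h\<close> in this
  parameter, and subtracting those of \<open>f\<close> leaves those of the vector
  \<open>\<kappa> \<nu>\<close>, to which \<open>principal_curvature_jet\<close> applies.\<close>

lemma principal_curvature_surface_jet:
  assumes surface: "principal_curvature_surface f h" and \<theta>: "cos \<theta> \<noteq> 0" and t: "t = tan \<theta>"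
    and z1: "z1 = a1 + 2 * m0 * t + 3 * n0 * t\<^sup>2"
    and z2: "z2 = a2 + 2 * m1 * t + 3 * n1 * t\<^sup>2 + 4 * n2 * t^3"
    and X2: "X2 = 2 * p0 * z1 + 3 * p1 * a0 - 2 * t * (3 * q1 + 2 * a1 * t + m0 * t\<^sup>2)"
    and w0: "w0 = a0\<^sup>2 + 4 * t\<^sup>2" and w2: "w2 = k0\<^sup>2 + z1\<^sup>2 + 2 * a0 * z2"
    and k0: "k0 = 2 * (a0 * t\<^sup>2 + 2 * q0 * t - a0 * p0)"
    and k1: "k1 = - (6 * a0 * p1 + 2 * p0 * z1) + 2 * t * (6 * q1 + 2 * a1 * t)
        + t\<^sup>2 * (6 * n0 * t\<^sup>2 - 2 * a1) + 2 * t * (4 * a1 * t + 4 * m0 * t\<^sup>2)"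
    and k2: "a0 * k2 = a0 * (2 * t * (12 * q2 + 6 * a2 * t + 2 * m1 * t\<^sup>2) - (12 * a0 * p2 + 6 * p1 * z1 + 2 * p0 * z2)
        - k0 * (4 * p0\<^sup>2 + (2 * q0 + a0 * t)\<^sup>2)
        + t\<^sup>2 * (2 * t * (2 * m1 + 6 * n1 * t + 12 * n2 * t\<^sup>2) - 2 * z2 - k0 * w0)
        + 2 * t * (2 * t * (3 * a2 + 4 * m1 * t + 3 * n1 * t\<^sup>2) - k0 * (4 * t * p0 + a0 * (2 * q0 + a0 * t)))) + 2 * t\<^sup>2 * z1\<^sup>2"
    and u: "\<And>i. u i = pd1 h (0, \<theta>) $ i / cos \<theta>"
    and s: "\<And>i. s i = pd1 (pd1 h) (0, \<theta>) $ i / (2 * (cos \<theta>)\<^sup>2)"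
  shows "w0 * h (0, \<theta>) $ 1 = 0" "w0 * (u 1 - 1) + 2 * a0 * z1 * h (0, \<theta>) $ 1 = - k0\<^sup>2"
    "w0 * s 1 + 2 * a0 * z1 * (u 1 - 1) + w2 * h (0, \<theta>) $ 1 = k0 * X2 - k1 * k0"
    "w0 * h (0, \<theta>) $ 2 = - (a0 * k0)" "w0 * u 2 + 2 * a0 * z1 * h (0, \<theta>) $ 2 = - (k0 * z1 + k1 * a0)"
    "w0 * (s 2 - (p0 + t\<^sup>2)) + 2 * a0 * z1 * u 2 + w2 * h (0, \<theta>) $ 2 = - (k0 * z2 + k1 * z1 + k2 * a0)"
    "w0 * h (0, \<theta>) $ 3 = 2 * t * k0" "w0 * u 3 + 2 * a0 * z1 * h (0, \<theta>) $ 3 = 2 * t * k1"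
    "w0 * (s 3 - (q0 + a0 * t)) + 2 * a0 * z1 * u 3 + w2 * h (0, \<theta>) $ 3 = 2 * t * k2"
proof -
  obtain U \<nu> \<kappa> where U: "open U" "exc_set0 \<subseteq> U" and sm: "smooth_on U \<nu>" "smooth_on U \<kappa>"
    and curv: "\<And>p. p \<in> U \<Longrightarrow> fst p \<noteq> 0 \<Longrightarrow> unit_normal_at f (blowup_map p) (\<nu> p) \<and>
           principal_curvature f (\<nu> p) (blowup_map p) (\<kappa> p)"
    and h: "\<forall>p\<in>U. h p = f (blowup_map p) + \<kappa> p *\<^sub>R \<nu> p"
    using surface unfolding principal_curvature_surface_def by blast
  let ?p = "(0, \<theta>)" and ?v = "(1, 0) :: real \<times> real" and ?c = "1 / cos \<theta>"
  have pU: "?p \<in> U" using U(2) \<theta> by (auto simp: exc_set0_def)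
  have ev_U: "\<forall>\<^sub>F q in nhds ?p. q \<in> U"
    using U(1) pU by (rule eventually_nhds_in_open)
  have c: "?c \<noteq> 0" using \<theta> by simp
  have ray: "?p + (?c * r) *\<^sub>R ?v = (r / cos \<theta>, \<theta>)" for r
    by simp
  have polar: "blowup_map (r / cos \<theta>, \<theta>) = (r, r * t)" for r
    using \<theta> by (simp add: blowup_map_def t tan_def)
  have "((\<lambda>r. (r / cos \<theta>, \<theta>)) \<longlongrightarrow> (0 / cos \<theta>, \<theta>)) (at 0)"
    using \<theta> by (intro tendsto_intros) auto
  then have lim: "((\<lambda>r. (r / cos \<theta>, \<theta>)) \<longlongrightarrow> ?p) (at 0)"
    by simp
  have ray_U: "\<forall>\<^sub>F r in at 0. (r / cos \<theta>, \<theta>) \<in> U"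
    using ev_U lim by (rule eventually_compose_filterlim)
  have diff: "\<forall>\<^sub>F x in nhds ?p. F differentiable (at x)"
    "(\<lambda>x. frechet_derivative F (at x) ?v) differentiable (at ?p)"
    if "smooth_on U F" for F :: "real \<times> real \<Rightarrow> 'a::real_normed_vector"
    using ev_U smooth_on_differentiable[OF that] smooth_on_differentiable[OF smooth_on_directional[OF that] pU]
    by (auto elim: eventually_mono)
  note j\<kappa> = has_jet2_scale[OF has_jet2_line[OF diff[OF sm(2)]] c, unfolded ray]
  note j\<nu> = has_jet2_scale[OF has_jet2_line_nth[OF diff[OF sm(1)]] c, unfolded ray]
  note dh = principal_curvature_surface_differentiable[OF smooth U(1) pU sm h]
  have jh: "has_jet2 (\<lambda>r. h (r / cos \<theta>, \<theta>) $ i) (h ?p $ i) (u i) (s i)" for i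
  proof (rule has_jet2_eq)
    have pd1: "pd1 F = (\<lambda>x. frechet_derivative F (at x) ?v)" for F :: "real \<times> real \<Rightarrow> real^3"
      by (simp add: pd1_def[abs_def])
    show "has_jet2 (\<lambda>r. h (r / cos \<theta>, \<theta>) $ i) (h ?p $ i) (?c * pd1 h ?p $ i) (?c\<^sup>2 * (pd1 (pd1 h) ?p $ i / 2))"
      unfolding pd1 by (rule has_jet2_scale[OF has_jet2_line_nth[OF dh[unfolded pd1]] c, unfolded ray])
  qed (simp_all add: u s power_divide)
  obtain jf: "\<forall>\<^sub>F r in at 0. f (r, r * t) $ 1 = r"
    "has_jet2 (\<lambda>r. f (r, r * t) $ 2) 0 0 (p0 + t\<^sup>2)"
    "has_jet2 (\<lambda>r. f (r, r * t) $ 3) 0 0 (q0 + a0 * t)"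
    by (rule ray_partial_derivative_jets[of t]) blast
  have jf1: "has_jet2 (\<lambda>r. f (r, r * t) $ 1) 0 1 0"
    using jf(1) has_jet2_ident by (subst has_jet2_cong) auto
  define f0 f1 f2 :: "3 \<Rightarrow> real" where "f0 i = 0" and "f1 i = (if i = 1 then 1 else 0)"
    and "f2 i = (if i = 1 then 0 else if i = 2 then p0 + t\<^sup>2 else q0 + a0 * t)" for i
  have jf': "has_jet2 (\<lambda>r. f (r, r * t) $ i) (f0 i) (f1 i) (f2 i)" for i
    using jf(2,3) jf1 exhaust_3[of i] by (auto simp: f0_def f1_def f2_def)
  have "\<forall>\<^sub>F r in at 0. \<forall>i. h (r / cos \<theta>, \<theta>) $ i - f (r, r * t) $ i = \<kappa> (r / cos \<theta>, \<theta>) * \<nu> (r / cos \<theta>, \<theta>) $ i"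
    using ray_U by eventually_elim (simp add: h polar)
  then have jg: "has_jet2 (\<lambda>r. \<kappa> (r / cos \<theta>, \<theta>) * \<nu> (r / cos \<theta>, \<theta>) $ i) (h ?p $ i - f0 i) (u i - f1 i) (s i - f2 i)" for i
    using has_jet2_diff[OF jh[of i] jf'[of i]] by (subst (asm) has_jet2_cong) (auto elim: eventually_mono)
  have "\<forall>\<^sub>F r in at (0::real). r \<noteq> 0"
    by (simp add: eventually_at_filter)
  with ray_U have "\<forall>\<^sub>F r in at 0. unit_normal_at f (r, r * t) (\<nu> (r / cos \<theta>, \<theta>)) \<and>
      principal_curvature f (\<nu> (r / cos \<theta>, \<theta>)) (r, r * t) (\<kappa> (r / cos \<theta>, \<theta>))"
  proof eventually_elim
    case (elim r)
    then have "fst (r / cos \<theta>, \<theta>) \<noteq> 0" using \<theta> by simp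
    from curv[OF elim(1) this] show ?case by (simp only: polar)
  qed
  note result = principal_curvature_jet[OF j\<kappa> j\<nu> this jg z1 z2 X2 w0 w2 k0 k1 k2]
  have f: "f0 i = 0" "f1 1 = 1" "f1 2 = 0" "f1 3 = 0" "f2 1 = 0" "f2 2 = p0 + t\<^sup>2" "f2 3 = q0 + a0 * t" for i
    by (simp_all add: f0_def f1_def f2_def)
  show "w0 * h (0, \<theta>) $ 1 = 0" "w0 * (u 1 - 1) + 2 * a0 * z1 * h (0, \<theta>) $ 1 = - k0\<^sup>2"
    "w0 * s 1 + 2 * a0 * z1 * (u 1 - 1) + w2 * h (0, \<theta>) $ 1 = k0 * X2 - k1 * k0"
    "w0 * h (0, \<theta>) $ 2 = - (a0 * k0)" "w0 * u 2 + 2 * a0 * z1 * h (0, \<theta>) $ 2 = - (k0 * z1 + k1 * a0)"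
    "w0 * (s 2 - (p0 + t\<^sup>2)) + 2 * a0 * z1 * u 2 + w2 * h (0, \<theta>) $ 2 = - (k0 * z2 + k1 * z1 + k2 * a0)"
    "w0 * h (0, \<theta>) $ 3 = 2 * t * k0" "w0 * u 3 + 2 * a0 * z1 * h (0, \<theta>) $ 3 = 2 * t * k1"
    "w0 * (s 3 - (q0 + a0 * t)) + 2 * a0 * z1 * u 3 + w2 * h (0, \<theta>) $ 3 = 2 * t * k2"
    by (rule result[unfolded f diff_0_right])+
qed

text \<open>Presents \<open>h\<close> on the exceptional set as a rational function of
  \<open>tan \<theta>\<close>, ready to be differentiated in \<open>\<theta>\<close>. The quantities
  of higher order are introduced in the proof to instantiate the jet lemma.\<close>

lemma principal_curvature_surface_exc:
  assumes "principal_curvature_surface f h" "cos \<theta> \<noteq> 0"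
  defines "t \<equiv> tan \<theta>"
  defines "k0 \<equiv> 2 * (a0 * t\<^sup>2 + 2 * q0 * t - a0 * p0)" and "w0 \<equiv> a0\<^sup>2 + 4 * t\<^sup>2"
  shows "h (0, \<theta>) = vector [0, - (a0 * k0 / w0), 2 * t * k0 / w0]"
proof -
  have nz: "a0 \<noteq> 0" using f331_pos by simp
  have "w0 > 0" unfolding w0_def using nz by (intro add_pos_nonneg) auto
  have solve: "\<exists>k. a0 * k = r" for r
    using nz by (intro exI[of _ "r / a0"]) simp
  obtain z1 where z1: "z1 = a1 + 2 * m0 * t + 3 * n0 * t\<^sup>2" by simp
  obtain z2 where z2: "z2 = a2 + 2 * m1 * t + 3 * n1 * t\<^sup>2 + 4 * n2 * t^3" by simp
  obtain X2 where X2: "X2 = 2 * p0 * z1 + 3 * p1 * a0 - 2 * t * (3 * q1 + 2 * a1 * t + m0 * t\<^sup>2)" by simp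
  obtain w2 where w2: "w2 = k0\<^sup>2 + z1\<^sup>2 + 2 * a0 * z2" by simp
  obtain k1 where k1: "k1 = - (6 * a0 * p1 + 2 * p0 * z1) + 2 * t * (6 * q1 + 2 * a1 * t)
        + t\<^sup>2 * (6 * n0 * t\<^sup>2 - 2 * a1) + 2 * t * (4 * a1 * t + 4 * m0 * t\<^sup>2)" by simp
  obtain k2 where k2: "a0 * k2 = a0 * (2 * t * (12 * q2 + 6 * a2 * t + 2 * m1 * t\<^sup>2) - (12 * a0 * p2 + 6 * p1 * z1 + 2 * p0 * z2)
        - k0 * (4 * p0\<^sup>2 + (2 * q0 + a0 * t)\<^sup>2)
        + t\<^sup>2 * (2 * t * (2 * m1 + 6 * n1 * t + 12 * n2 * t\<^sup>2) - 2 * z2 - k0 * w0)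
        + 2 * t * (2 * t * (3 * a2 + 4 * m1 * t + 3 * n1 * t\<^sup>2) - k0 * (4 * t * p0 + a0 * (2 * q0 + a0 * t)))) + 2 * t\<^sup>2 * z1\<^sup>2"
    using solve by blast
  note 1 = principal_curvature_surface_jet[OF assms(1,2) meta_eq_to_obj_eq[OF t_def] z1 z2 X2
      meta_eq_to_obj_eq[OF w0_def] w2 meta_eq_to_obj_eq[OF k0_def] k1 k2 refl refl]
  have "w0 \<noteq> 0" using \<open>w0 > 0\<close> by simp
  with 1(1) have "h (0, \<theta>) $ 1 = 0" by simp
  moreover note eq_divide_imp[OF \<open>w0 \<noteq> 0\<close> trans[OF mult.commute 1(4)]]
    eq_divide_imp[OF \<open>w0 \<noteq> 0\<close> trans[OF mult.commute 1(7)]]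
  ultimately show ?thesis
    by (simp add: Finite_Cartesian_Product.vec_eq_iff forall_3)
qed

text \<open>The factor \<open>1 + t\<^sup>2\<close> is the derivative of \<open>tan\<close>; the
  vector is the derivative in \<open>t\<close> of the rational functions just found, and
  \<open>k0'\<close> is that of \<open>k0\<close>.\<close>

lemma pd2_principal_curvature_surface_exc:
  assumes surface: "principal_curvature_surface f h" and \<theta>: "cos \<theta> \<noteq> 0"
  defines "t \<equiv> tan \<theta>"
  defines "k0 \<equiv> 2 * (a0 * t\<^sup>2 + 2 * q0 * t - a0 * p0)" and "k0' \<equiv> 4 * a0 * t + 4 * q0"
    and "w0 \<equiv> a0\<^sup>2 + 4 * t\<^sup>2"
  shows "pd2 h (0, \<theta>) = (1 + t\<^sup>2) *\<^sub>R vector [0, - a0 * (k0' * w0 - 8 * t * k0) / w0\<^sup>2,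
    (2 * (k0 + t * k0') * w0 - 16 * t\<^sup>2 * k0) / w0\<^sup>2]"
proof -
  obtain U \<nu> \<kappa> where U: "open U" "exc_set0 \<subseteq> U" and sm: "smooth_on U \<nu>" "smooth_on U \<kappa>"
    and h: "\<forall>p\<in>U. h p = f (blowup_map p) + \<kappa> p *\<^sub>R \<nu> p"
    using surface unfolding principal_curvature_surface_def by blast
  have "(0, \<theta>) \<in> U" using U(2) \<theta> by (auto simp: exc_set0_def)
  note dh = principal_curvature_surface_differentiable[OF smooth U(1) this sm h]
  have "((\<lambda>s. h (0, s)) has_vector_derivative pd2 h (0, \<theta>)) (at \<theta>)"
    using differentiable_has_derivative_pd2[OF eventually_nhds_x_imp_x[OF dh(1)]] by simp
  then have D: "((\<lambda>s. h (0, s) $ i) has_real_derivative pd2 h (0, \<theta>) $ i) (at \<theta>)" for i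
    by (rule has_vector_derivative_nth)
  have cos_ev: "\<forall>\<^sub>F s in nhds \<theta>. cos s \<noteq> 0"
    using tendsto_imp_eventually_ne[OF isCont_cos[of \<theta>, unfolded isCont_def] \<theta>] \<theta>
    by (auto simp: eventually_at_filter elim: eventually_mono)
  define K where "K x = 2 * (a0 * x\<^sup>2 + 2 * q0 * x - a0 * p0)" for x :: real
  define W where "W x = a0\<^sup>2 + 4 * x\<^sup>2" for x :: real
  have nz: "a0 \<noteq> 0" using f331_pos by simp
  have "W x > 0" for x unfolding W_def using nz by (intro add_pos_nonneg) auto
  then have W: "W x \<noteq> 0" for x by (metis less_irrefl)
  have dK: "(K has_real_derivative 4 * a0 * x + 4 * q0) (at x)" for x
    unfolding K_def by (auto intro!: derivative_eq_intros simp: algebra_simps)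
  have dW: "(W has_real_derivative 8 * x) (at x)" for x
    unfolding W_def by (auto intro!: derivative_eq_intros)
  have dt: "(tan has_real_derivative 1 + t\<^sup>2) (at \<theta>)"
    using \<theta> DERIV_tan[of \<theta>] by (simp add: t_def tan_sec power_inverse)
  have KW: "k0 = K t" "k0' = 4 * a0 * t + 4 * q0" "w0 = W t"
    by (simp_all add: k0_def k0'_def w0_def K_def W_def)
  have eq: "\<forall>\<^sub>F s in nhds \<theta>. h (0, s) = vector [0, - (a0 * K (tan s) / W (tan s)), 2 * tan s * K (tan s) / W (tan s)]"
    using cos_ev by eventually_elim (simp add: principal_curvature_surface_exc[OF surface] K_def W_def)
  have "((\<lambda>x. - (a0 * K x / W x)) has_real_derivative - (a0 * (k0' * w0 - k0 * (8 * t)) / w0\<^sup>2)) (at t)"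
    unfolding KW using DERIV_minus[OF DERIV_divide[OF DERIV_cmult[OF dK, of a0] dW W, of t]]
    by (simp add: power2_eq_square algebra_simps)
  from DERIV_chain2[of _ _ tan, OF this[unfolded t_def] dt]
  have "((\<lambda>s. - (a0 * K (tan s) / W (tan s))) has_real_derivative - (a0 * (k0' * w0 - k0 * (8 * t)) / w0\<^sup>2) * (1 + t\<^sup>2)) (at \<theta>)"
    by (simp add: t_def)
  then have "((\<lambda>s. h (0, s) $ 2) has_real_derivative - (a0 * (k0' * w0 - k0 * (8 * t)) / w0\<^sup>2) * (1 + t\<^sup>2)) (at \<theta>)"
    by (subst DERIV_cong_ev[OF refl _ refl]) (use eq in \<open>auto elim: eventually_mono\<close>)
  from DERIV_unique[OF D this] have 2: "pd2 h (0, \<theta>) $ 2 = - (a0 * (k0' * w0 - k0 * (8 * t)) / w0\<^sup>2) * (1 + t\<^sup>2)" .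
  have "((\<lambda>x. 2 * x * K x / W x) has_real_derivative ((2 * (k0 + t * k0') * w0 - 2 * t * k0 * (8 * t)) / w0\<^sup>2)) (at t)"
    unfolding KW using DERIV_divide[OF DERIV_mult[OF DERIV_cmult[OF DERIV_ident, of 2] dK] dW W, of t]
    by (simp add: power2_eq_square algebra_simps)
  from DERIV_chain2[of _ _ tan, OF this[unfolded t_def] dt]
  have "((\<lambda>s. 2 * tan s * K (tan s) / W (tan s)) has_real_derivative ((2 * (k0 + t * k0') * w0 - 2 * t * k0 * (8 * t)) / w0\<^sup>2) * (1 + t\<^sup>2)) (at \<theta>)"
    by (simp add: t_def)
  then have "((\<lambda>s. h (0, s) $ 3) has_real_derivative ((2 * (k0 + t * k0') * w0 - 2 * t * k0 * (8 * t)) / w0\<^sup>2) * (1 + t\<^sup>2)) (at \<theta>)"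
    by (subst DERIV_cong_ev[OF refl _ refl]) (use eq in \<open>auto elim: eventually_mono\<close>)
  from DERIV_unique[OF D this] have 3: "pd2 h (0, \<theta>) $ 3 = ((2 * (k0 + t * k0') * w0 - 2 * t * k0 * (8 * t)) / w0\<^sup>2) * (1 + t\<^sup>2)" .
  have "((\<lambda>s. h (0, s) $ 1) has_real_derivative 0) (at \<theta>)"
    by (subst DERIV_cong_ev[OF refl _ refl, where g = "\<lambda>s. 0"]) (use eq in \<open>auto elim: eventually_mono\<close>)
  from DERIV_unique[OF D this] have 1: "pd2 h (0, \<theta>) $ 1 = 0" .
  show ?thesis
    using 1 2 3 by (simp add: Finite_Cartesian_Product.vec_eq_iff forall_3 power2_eq_square mult_ac)
qed

end

subsection \<open>The numerators of the radial curvatures\<close>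

text \<open>Away from their first coordinates, all vectors are expanded in the orthogonal frame
  \<open>(- a, 2 t)\<close>, \<open>(2 t, a)\<close> of vectors of squared length \<open>w\<close>. In these coordinates the products of two
  vectors are divisible by one more power of \<open>w\<close> than expected, which is what keeps the degrees in
  \<open>t\<close> down to 14 and 19. The factor \<open>a\<close> clears the denominator of \<open>k2\<close>.\<close>

lemma radial_curvature_numerators:
  fixes a t :: real
  assumes a: "a \<noteq> 0" and w: "w = a\<^sup>2 + 4 * t\<^sup>2" and w2: "w2 = k0\<^sup>2 + z1\<^sup>2 + 2 * a * z2"
    and k0: "k0 = 2 * (2 * t * y3 - a * y2)"
    and x: "w * g1 = 0" "w * (u1 - 1) + 2 * a * z1 * g1 = - k0\<^sup>2"
      "w * s1 + 2 * a * z1 * (u1 - 1) + w2 * g1 = k0 * X2 - k1 * k0"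
    and y: "w * g2 = - (a * k0)" "w * u2 + 2 * a * z1 * g2 = - (k0 * z1 + k1 * a)"
      "w * (s2 - y2) + 2 * a * z1 * u2 + w2 * g2 = - (k0 * z2 + k1 * z1 + k2 * a)"
    and z: "w * g3 = 2 * t * k0" "w * u3 + 2 * a * z1 * g3 = 2 * t * k1"
      "w * (s3 - y3) + 2 * a * z1 * u3 + w2 * g3 = 2 * t * k2"
    and v: "v2 = - a * (k0' * w - 8 * t * k0) / w\<^sup>2" "v3 = (2 * (k0 + t * k0') * w - 16 * t\<^sup>2 * k0) / w\<^sup>2"
    and X: "X = w - k0\<^sup>2" and V: "V = k0' * w - 4 * t * k0"
    and P: "P = w * (a * k0 / 2 + a * k2) - a * (a * k1 * z1 + a * k0 * z2 + k0^3)"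
    and Q: "Q = a * (w * (2 * t * y2 + a * y3) - 2 * t * (k1 * z1 + k0 * z2))"
    and H: "H = a * (w * k0 * (X2 - k1) + 2 * a * k0\<^sup>2 * z1)"
    and uxv: "uxv = 2 * k0 * (a * k1 + (t * k0' - k0) * z1)"
    and uv: "uv = k1 * V - a * k0 * k0' * z1"
    and sv: "sv = P * V + a * (k0 * (a\<^sup>2 - 4 * t\<^sup>2) * z1\<^sup>2 * k0' + 4 * t * k0\<^sup>2 * z1\<^sup>2) + 2 * a * k0 * Q"
    and vxs: "vxs = 2 * a * k0 * P + 2 * a\<^sup>2 * k0\<^sup>2 * z1\<^sup>2 - Q * V - 4 * a\<^sup>2 * t * k0 * k0' * z1\<^sup>2"
    and uxs: "uxs = k1 * (w * Q + 4 * a\<^sup>2 * t * k0 * z1\<^sup>2) - a * k0 * z1 * Q - 2 * a * t * k0\<^sup>2 * z1^3 + 2 * t * k0 * z1 * P"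
  shows "w * u1 = X" "w\<^sup>2 * (u2 * v3 - u3 * v2) = - uxv"
    "a * w^4 * (s1 * (u2 * v3 - u3 * v2) + u1 * (v2 * s3 - v3 * s2)) = X * vxs - H * uxv"
    "a * w^5 * (u1\<^sup>2 * (s2 * v2 + s3 * v3) - u1 * s1 * (u2 * v2 + u3 * v3) + (u2 * s3 - u3 * s2) * (u2 * v3 - u3 * v2))
      = X * (X * sv - H * uv) + uxs * uxv"
    "v2 = 0 \<and> v3 = 0 \<longrightarrow> k0 = 0 \<and> k0' = 0"
proof -
  have "w > 0" unfolding w using a by (intro add_pos_nonneg) auto
  then have wnz: "w \<noteq> 0" by simp
  have g1: "g1 = 0" using x(1) wnz by simp
  show u1: "w * u1 = X" using x(2) unfolding g1 X by (simp add: algebra_simps)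
  have ws1: "w * (w * s1) = w * (k0 * X2 - k1 * k0) - 2 * a * z1 * (w * u1 - w)"
    using arg_cong[OF x(3), of "(*) w"] unfolding g1 by (simp add: algebra_simps)
  have s1: "a * (w\<^sup>2 * s1) = H"
    using arg_cong[OF ws1, of "(*) a"] unfolding u1 X H by (simp add: power2_eq_square algebra_simps)
  \<comment> \<open>The vector \<open>(g2, g3)\<close> is the value of \<open>h\<close> on the
    exceptional set. It points along the limiting normal \<open>(- a, 2 * t)\<close>: its product
    with that vector is \<open>k0\<close>, and its product with the orthogonal vector is 0.\<close>
  have gN: "- a * g2 + 2 * t * g3 = k0"
  proof -
    have "w * (- a * g2 + 2 * t * g3) = - a * (w * g2) + 2 * t * (w * g3)" by (simp add: algebra_simps)
    also have "\<dots> = w * k0" unfolding y(1) z(1) by (simp add: w power2_eq_square algebra_simps)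
    finally show ?thesis using wnz by simp
  qed
  have gT: "2 * t * g2 + a * g3 = 0"
  proof -
    have "w * (2 * t * g2 + a * g3) = 2 * t * (w * g2) + a * (w * g3)" by (simp add: algebra_simps)
    also have "\<dots> = 0" unfolding y(1) z(1) by (simp add: algebra_simps)
    finally show ?thesis using wnz by simp
  qed
  \<comment> \<open>The suffixes \<open>N\<close> and \<open>T\<close> denote inner products with
    \<open>(- a, 2 * t)\<close>, the normal direction at \<open>r = 0\<close>, and with the
    orthogonal vector \<open>(2 * t, a)\<close>.\<close>
  define uN uT sN sT vN vT where "uN = - a * u2 + 2 * t * u3" and "uT = 2 * t * u2 + a * u3"
    and "sN = - a * s2 + 2 * t * s3" and "sT = 2 * t * s2 + a * s3"
    and "vN = - a * v2 + 2 * t * v3" and "vT = 2 * t * v2 + a * v3"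
  note frame = this
  define A1 B1 A2 B2 where "A1 = k1 * w - a * k0 * z1" and "B1 = - 2 * t * k0 * z1"
    and "A2 = w * P + a * k0 * (a\<^sup>2 - 4 * t\<^sup>2) * z1\<^sup>2"
    and "B2 = w * Q + 4 * a\<^sup>2 * t * k0 * z1\<^sup>2"
  note AB = this
  have k0h: "k0 / 2 = 2 * t * y3 - a * y2" by (simp add: k0)
  have uN: "w * uN = A1"
  proof -
    have "w * uN + 2 * a * z1 * (- a * g2 + 2 * t * g3)
        = - a * (w * u2 + 2 * a * z1 * g2) + 2 * t * (w * u3 + 2 * a * z1 * g3)"
      unfolding frame by (simp add: algebra_simps)
    also have "\<dots> = a * k0 * z1 + k1 * w" unfolding y(2) z(2) by (simp add: w power2_eq_square algebra_simps)
    finally show ?thesis unfolding gN AB by (simp add: algebra_simps)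
  qed
  have uT: "w * uT = B1"
  proof -
    have "w * uT + 2 * a * z1 * (2 * t * g2 + a * g3)
        = 2 * t * (w * u2 + 2 * a * z1 * g2) + a * (w * u3 + 2 * a * z1 * g3)"
      unfolding frame by (simp add: algebra_simps)
    also have "\<dots> = - 2 * t * k0 * z1" unfolding y(2) z(2) by (simp add: algebra_simps)
    finally show ?thesis unfolding gT AB by simp
  qed
  have sN: "a * (w\<^sup>2 * sN) = A2"
  proof -
    have "w * (sN - k0 / 2) + 2 * a * z1 * uN + w2 * (- a * g2 + 2 * t * g3)
        = - a * (w * (s2 - y2) + 2 * a * z1 * u2 + w2 * g2) + 2 * t * (w * (s3 - y3) + 2 * a * z1 * u3 + w2 * g3)"
      unfolding frame k0h by (simp add: algebra_simps)
    also have "\<dots> = a * k0 * z2 + a * k1 * z1 + k2 * w" unfolding y(3) z(3) by (simp add: w power2_eq_square algebra_simps)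
    finally have wsN: "w * sN = w * k0 / 2 + a * k0 * z2 + a * k1 * z1 + k2 * w - w2 * k0 - 2 * a * z1 * uN"
      unfolding gN by (simp add: algebra_simps)
    have wwsN: "w * (w * sN) = w * (w * k0 / 2 + a * k0 * z2 + a * k1 * z1 + k2 * w - w2 * k0) - 2 * a * z1 * (w * uN)"
      unfolding wsN by (simp add: algebra_simps)
    have "a * (w\<^sup>2 * sN) = a * (w * (w * sN))" by (simp add: power2_eq_square)
    also have "\<dots> = A2"
      unfolding wwsN uN AB P w2 unfolding w by (simp add: power2_eq_square power3_eq_cube algebra_simps)
    finally show ?thesis .
  qed
  have sT: "a * (w\<^sup>2 * sT) = B2"
  proof -
    have "w * (sT - (2 * t * y2 + a * y3)) + 2 * a * z1 * uT + w2 * (2 * t * g2 + a * g3)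
        = 2 * t * (w * (s2 - y2) + 2 * a * z1 * u2 + w2 * g2) + a * (w * (s3 - y3) + 2 * a * z1 * u3 + w2 * g3)"
      unfolding frame by (simp add: algebra_simps)
    also have "\<dots> = - 2 * t * (k0 * z2 + k1 * z1)" unfolding y(3) z(3) by (simp add: algebra_simps)
    finally have wsT: "w * sT = w * (2 * t * y2 + a * y3) - 2 * t * (k0 * z2 + k1 * z1) - 2 * a * z1 * uT"
      unfolding gT by (simp add: algebra_simps)
    have wwsT: "w * (w * sT) = w * (w * (2 * t * y2 + a * y3) - 2 * t * (k0 * z2 + k1 * z1)) - 2 * a * z1 * (w * uT)"
      unfolding wsT by (simp add: algebra_simps)
    have "a * (w\<^sup>2 * sT) = a * (w * (w * sT))" by (simp add: power2_eq_square)
    also have "\<dots> = B2"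
      unfolding wwsT uT AB Q by (simp add: power2_eq_square algebra_simps)
    finally show ?thesis .
  qed
  have v': "w\<^sup>2 * v2 = - a * (k0' * w - 8 * t * k0)" "w\<^sup>2 * v3 = 2 * (k0 + t * k0') * w - 16 * t\<^sup>2 * k0"
    using wnz by (simp_all add: v)
  have vN: "w * vN = V"
  proof -
    have "w * (w * vN) = - a * (w\<^sup>2 * v2) + 2 * t * (w\<^sup>2 * v3)"
      unfolding frame by (simp add: power2_eq_square algebra_simps)
    also have "\<dots> = w * V" unfolding v' V by (simp add: w power2_eq_square algebra_simps)
    finally show ?thesis using wnz by simp
  qed
  have vT: "w * vT = 2 * a * k0"
  proof -
    have "w * (w * vT) = 2 * t * (w\<^sup>2 * v2) + a * (w\<^sup>2 * v3)"
      unfolding frame by (simp add: power2_eq_square algebra_simps)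
    also have "\<dots> = w * (2 * a * k0)" unfolding v' by (simp add: w power2_eq_square algebra_simps)
    finally show ?thesis using wnz by simp
  qed
  have cancel: "x = y" if "w * x = w * y" for x y
    using that wnz by simp
  have W: "a * a + 4 * t * t = w" by (simp add: w power2_eq_square)
  \<comment> \<open>Up to sign, \<open>w\<close> times a product of two plane vectors is the same
    product of their frame components. After insertion of these components a further factor
    \<open>w\<close> appears on the right and is removed by \<open>cancel\<close>. The four products
    below are treated alike.\<close>
  have "w * (w\<^sup>2 * (u2 * v3 - u3 * v2)) = - ((w * uN) * (w * vT) - (w * uT) * (w * vN))"
    unfolding frame W[symmetric] by (simp add: power2_eq_square algebra_simps)
  also have "\<dots> = w * (- uxv)" unfolding uN uT vN vT AB V uxv unfolding w by (simp add: power2_eq_square algebra_simps)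
  finally show ruxv: "w\<^sup>2 * (u2 * v3 - u3 * v2) = - uxv" by (rule cancel)
  have "w * (w\<^sup>2 * (u2 * v2 + u3 * v3)) = (w * uN) * (w * vN) + (w * uT) * (w * vT)"
    unfolding frame W[symmetric] by (simp add: power2_eq_square algebra_simps)
  also have "\<dots> = w * uv" unfolding uN uT vN vT AB V uv unfolding w by (simp add: power2_eq_square algebra_simps)
  finally have ruv: "w\<^sup>2 * (u2 * v2 + u3 * v3) = uv" by (rule cancel)
  have "w * (a * w^3 * (s2 * v2 + s3 * v3)) = (a * (w\<^sup>2 * sN)) * (w * vN) + (a * (w\<^sup>2 * sT)) * (w * vT)"
    unfolding frame W[symmetric] by (simp add: power2_eq_square power3_eq_cube algebra_simps)
  also have "\<dots> = w * sv" unfolding sN sT vN vT AB V sv unfolding w by (simp add: power2_eq_square algebra_simps)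
  finally have rsv: "a * w^3 * (s2 * v2 + s3 * v3) = sv" by (rule cancel)
  have "w * (a * w^3 * (v2 * s3 - v3 * s2)) = (a * (w\<^sup>2 * sN)) * (w * vT) - (a * (w\<^sup>2 * sT)) * (w * vN)"
    unfolding frame W[symmetric] by (simp add: power2_eq_square power3_eq_cube algebra_simps)
  also have "\<dots> = w * vxs" unfolding sN sT vN vT AB V vxs unfolding w by (simp add: power2_eq_square algebra_simps)
  finally have rvxs: "a * w^3 * (v2 * s3 - v3 * s2) = vxs" by (rule cancel)
  have "w * (a * w^3 * (u2 * s3 - u3 * s2)) = - ((w * uN) * (a * (w\<^sup>2 * sT)) - (w * uT) * (a * (w\<^sup>2 * sN)))"
    unfolding frame W[symmetric] by (simp add: power2_eq_square power3_eq_cube algebra_simps)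
  also have "\<dots> = w * (- uxs)" unfolding uN uT sN sT AB uxs unfolding w by (simp add: power2_eq_square power3_eq_cube algebra_simps)
  finally have ruxs: "a * w^3 * (u2 * s3 - u3 * s2) = - uxs" by (rule cancel)
  \<comment> \<open>For \<open>v\<close> with vanishing first component this is the inner product of
    \<open>s\<close> with the cross product of \<open>u\<close> and \<open>v\<close>, the numerator
    of the normal curvature.\<close>
  have "a * w^4 * (s1 * (u2 * v3 - u3 * v2) + u1 * (v2 * s3 - v3 * s2))
      = (a * (w\<^sup>2 * s1)) * (w\<^sup>2 * (u2 * v3 - u3 * v2)) + (w * u1) * (a * w^3 * (v2 * s3 - v3 * s2))"
    by (simp add: power2_eq_square power3_eq_cube power4_eq_xxxx algebra_simps)
  then show "a * w^4 * (s1 * (u2 * v3 - u3 * v2) + u1 * (v2 * s3 - v3 * s2)) = X * vxs - H * uxv"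
    unfolding s1 ruxv u1 rvxs by simp
  \<comment> \<open>The determinant of \<open>u\<close>, \<open>s\<close> and the cross product of
    \<open>u\<close> and \<open>v\<close> is \<open>(u . u) (s . v) - (u . v) (s . u)\<close>. With
    vanishing first component of \<open>v\<close> it becomes the expression below, the numerator of
    the geodesic curvature.\<close>
  have "w^5 = w * w * w * w * w" by (simp add: numeral_eq_Suc)
  then have "a * w^5 * (u1\<^sup>2 * (s2 * v2 + s3 * v3) - u1 * s1 * (u2 * v2 + u3 * v3) + (u2 * s3 - u3 * s2) * (u2 * v3 - u3 * v2))
     = (w * u1) * ((w * u1) * (a * w^3 * (s2 * v2 + s3 * v3)) - (a * (w\<^sup>2 * s1)) * (w\<^sup>2 * (u2 * v2 + u3 * v3)))
       + (a * w^3 * (u2 * s3 - u3 * s2)) * (w\<^sup>2 * (u2 * v3 - u3 * v2))"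
    by (simp add: power2_eq_square power3_eq_cube algebra_simps)
  then show "a * w^5 * (u1\<^sup>2 * (s2 * v2 + s3 * v3) - u1 * s1 * (u2 * v2 + u3 * v3) + (u2 * s3 - u3 * s2) * (u2 * v3 - u3 * v2))
      = X * (X * sv - H * uv) + uxs * uxv"
    unfolding s1 ruxv u1 rsv ruv ruxs by simp
  show "v2 = 0 \<and> v3 = 0 \<longrightarrow> k0 = 0 \<and> k0' = 0"
    using vN vT a wnz unfolding frame V by auto
qed

text \<open>The letters \<open>p\<close>, \<open>q\<close>, \<open>m\<close>, \<open>n\<close>, \<open>a\<close> stand for the Taylor coefficients of
  \<open>f21\<close>, \<open>f31\<close>, \<open>f321\<close>, \<open>f322\<close>, \<open>f331\<close>. Evaluated at \<open>t = tan \<theta>\<close>, the polynomials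
  \<open>fam_w\<close>, \<open>fam_k0\<close>, \<dots> are the quantities of lemma \<open>radial_curvature_numerators\<close>;
  \<open>fam_dk0\<close> is \<open>k0'\<close> and \<open>fam_ak2\<close> is \<open>a k2\<close>.\<close>

definition jet_p0 :: "jet_coords \<Rightarrow> real" where "jet_p0 x = fst (fst x)"
definition jet_p1 :: "jet_coords \<Rightarrow> real" where "jet_p1 x = fst (snd (fst x))"
definition jet_p2 :: "jet_coords \<Rightarrow> real" where "jet_p2 x = snd (snd (fst x))"
definition jet_q0 :: "jet_coords \<Rightarrow> real" where "jet_q0 x = fst (fst (snd x))"
definition jet_q1 :: "jet_coords \<Rightarrow> real" where "jet_q1 x = fst (snd (fst (snd x)))"
definition jet_q2 :: "jet_coords \<Rightarrow> real" where "jet_q2 x = snd (snd (fst (snd x)))"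
definition jet_m0 :: "jet_coords \<Rightarrow> real" where "jet_m0 x = fst (fst (snd (snd x)))"
definition jet_m1 :: "jet_coords \<Rightarrow> real" where "jet_m1 x = snd (fst (snd (snd x)))"
definition jet_n0 :: "jet_coords \<Rightarrow> real" where "jet_n0 x = fst (fst (snd (snd (snd x))))"
definition jet_n1 :: "jet_coords \<Rightarrow> real" where "jet_n1 x = fst (snd (fst (snd (snd (snd x)))))"
definition jet_n2 :: "jet_coords \<Rightarrow> real" where "jet_n2 x = snd (snd (fst (snd (snd (snd x)))))"
definition jet_a :: "jet_coords \<Rightarrow> real" where "jet_a x = fst (snd (snd (snd (snd x))))"
definition jet_a1 :: "jet_coords \<Rightarrow> real" where "jet_a1 x = fst (snd (snd (snd (snd (snd x)))))"
definition jet_a2 :: "jet_coords \<Rightarrow> real" where "jet_a2 x = snd (snd (snd (snd (snd (snd x)))))"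

lemmas jet_coord_defs = jet_p0_def jet_p1_def jet_p2_def jet_q0_def jet_q1_def jet_q2_def jet_m0_def jet_m1_def jet_n0_def jet_n1_def jet_n2_def jet_a_def jet_a1_def jet_a2_def

definition fam_w :: "jet_coords \<Rightarrow> real poly" where
  "fam_w x = [:(jet_a x)\<^sup>2, 0, 4:]"

definition fam_k0 :: "jet_coords \<Rightarrow> real poly" where
  "fam_k0 x = [:- 2 * jet_a x * jet_p0 x, 4 * jet_q0 x, 2 * jet_a x:]"

definition fam_dk0 :: "jet_coords \<Rightarrow> real poly" where
  "fam_dk0 x = [:4 * jet_q0 x, 4 * jet_a x:]"

definition fam_z1 :: "jet_coords \<Rightarrow> real poly" where
  "fam_z1 x = [:jet_a1 x, 2 * jet_m0 x, 3 * jet_n0 x:]"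

definition fam_z2 :: "jet_coords \<Rightarrow> real poly" where
  "fam_z2 x = [:jet_a2 x, 2 * jet_m1 x, 3 * jet_n1 x, 4 * jet_n2 x:]"

definition fam_X2 :: "jet_coords \<Rightarrow> real poly" where
  "fam_X2 x = [:2 * jet_p0 x:] * fam_z1 x + [:3 * jet_p1 x * jet_a x, - 6 * jet_q1 x, - 4 * jet_a1 x, - 2 * jet_m0 x:]"

definition fam_k1 :: "jet_coords \<Rightarrow> real poly" where
  "fam_k1 x = [:- 6 * jet_a x * jet_p1 x, 12 * jet_q1 x, 10 * jet_a1 x, 8 * jet_m0 x, 6 * jet_n0 x:] - [:2 * jet_p0 x:] * fam_z1 x"

definition fam_ak2 :: "jet_coords \<Rightarrow> real poly" where
  "fam_ak2 x = [:jet_a x:] * ([:- 12 * jet_a x * jet_p2 x, 24 * jet_q2 x, 12 * jet_a2 x, 4 * jet_m1 x:] - ([:6 * jet_p1 x:] * fam_z1 x + [:2 * jet_p0 x:] * fam_z2 x)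
      - fam_k0 x * ([:4 * (jet_p0 x)\<^sup>2:] + [:2 * jet_q0 x, jet_a x:]\<^sup>2)
      + [:0, 0, 1:] * ([:0, 4 * jet_m1 x, 12 * jet_n1 x, 24 * jet_n2 x:] - [:2:] * fam_z2 x - fam_k0 x * fam_w x)
      + [:0, 2:] * ([:0, 6 * jet_a2 x, 8 * jet_m1 x, 6 * jet_n1 x:] - fam_k0 x * ([:0, 4 * jet_p0 x:] + [:jet_a x:] * [:2 * jet_q0 x, jet_a x:])))
      + [:0, 0, 2:] * (fam_z1 x)\<^sup>2"

text \<open>This is the term \<open>2 * t * y2 + a * y3\<close> inside \<open>Q\<close>, for
  \<open>y2 = p0 + t\<^sup>2\<close> and \<open>y3 = q0 + a * t\<close>: the component along
  \<open>(2 * t, a)\<close> of the second Taylor coefficient of \<open>f\<close> on the ray.\<close>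

definition fam_tau :: "jet_coords \<Rightarrow> real poly" where
  "fam_tau x = [:jet_a x * jet_q0 x, 2 * jet_p0 x + (jet_a x)\<^sup>2, 0, 2:]"

definition fam_V :: "jet_coords \<Rightarrow> real poly" where
  "fam_V x = fam_dk0 x * fam_w x - [:0, 4:] * fam_k0 x"

definition fam_X :: "jet_coords \<Rightarrow> real poly" where
  "fam_X x = fam_w x - (fam_k0 x)\<^sup>2"

definition fam_P :: "jet_coords \<Rightarrow> real poly" where
  "fam_P x = fam_w x * ([:jet_a x / 2:] * fam_k0 x + fam_ak2 x) - [:jet_a x:] * ([:jet_a x:] * fam_k1 x * fam_z1 x + [:jet_a x:] * fam_k0 x * fam_z2 x + (fam_k0 x)^3)"

definition fam_Q :: "jet_coords \<Rightarrow> real poly" where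
  "fam_Q x = [:jet_a x:] * (fam_w x * fam_tau x - [:0, 2:] * (fam_k1 x * fam_z1 x + fam_k0 x * fam_z2 x))"

definition fam_H :: "jet_coords \<Rightarrow> real poly" where
  "fam_H x = [:jet_a x:] * (fam_w x * fam_k0 x * (fam_X2 x - fam_k1 x) + [:2 * jet_a x:] * (fam_k0 x)\<^sup>2 * fam_z1 x)"

text \<open>The factor of \<open>fam_uxv\<close> besides \<open>2 * k0\<close>. It is singled out
  because \<open>k0\<close> cannot vanish at a zero of \<open>fam_X\<close> when \<open>a\<close> is
  nonzero, so this factor decides whether \<open>h\<close> is an immersion there.\<close>

definition fam_c :: "jet_coords \<Rightarrow> real poly" where
  "fam_c x = [:jet_a x:] * fam_k1 x + ([:0, 1:] * fam_dk0 x - fam_k0 x) * fam_z1 x"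

definition fam_uxv :: "jet_coords \<Rightarrow> real poly" where
  "fam_uxv x = [:2:] * fam_k0 x * fam_c x"

definition fam_uv :: "jet_coords \<Rightarrow> real poly" where
  "fam_uv x = fam_k1 x * fam_V x - [:jet_a x:] * fam_k0 x * fam_dk0 x * fam_z1 x"

definition fam_sv :: "jet_coords \<Rightarrow> real poly" where
  "fam_sv x = fam_P x * fam_V x + [:jet_a x:] * (fam_k0 x * [:(jet_a x)\<^sup>2, 0, - 4:] * (fam_z1 x)\<^sup>2 * fam_dk0 x + [:0, 4:] * (fam_k0 x)\<^sup>2 * (fam_z1 x)\<^sup>2) + [:2 * jet_a x:] * fam_k0 x * fam_Q x"

definition fam_vxs :: "jet_coords \<Rightarrow> real poly" where
  "fam_vxs x = [:2 * jet_a x:] * fam_k0 x * fam_P x + [:2 * (jet_a x)\<^sup>2:] * (fam_k0 x)\<^sup>2 * (fam_z1 x)\<^sup>2 - fam_Q x * fam_V x - [:0, 4 * (jet_a x)\<^sup>2:] * fam_k0 x * fam_dk0 x * (fam_z1 x)\<^sup>2"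

definition fam_uxs :: "jet_coords \<Rightarrow> real poly" where
  "fam_uxs x = fam_k1 x * (fam_w x * fam_Q x + [:0, 4 * (jet_a x)\<^sup>2:] * fam_k0 x * (fam_z1 x)\<^sup>2) - [:jet_a x:] * fam_k0 x * fam_z1 x * fam_Q x - [:0, 2 * jet_a x:] * (fam_k0 x)\<^sup>2 * (fam_z1 x)^3 + [:0, 2:] * fam_k0 x * fam_z1 x * fam_P x"

definition fam_rn :: "jet_coords \<Rightarrow> real poly" where
  "fam_rn x = fam_X x * fam_vxs x - fam_H x * fam_uxv x"

definition fam_rg :: "jet_coords \<Rightarrow> real poly" where
  "fam_rg x = fam_X x * (fam_X x * fam_sv x - fam_H x * fam_uv x) + fam_uxs x * fam_uxv x"

section \<open>Polynomial dependence on the jet, and degree bounds in \<open>t\<close>\<close>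

lemma real_polynomial_function_jet_coords:
  "real_polynomial_function jet_p0"
  "real_polynomial_function jet_p1"
  "real_polynomial_function jet_p2"
  "real_polynomial_function jet_q0"
  "real_polynomial_function jet_q1"
  "real_polynomial_function jet_q2"
  "real_polynomial_function jet_m0"
  "real_polynomial_function jet_m1"
  "real_polynomial_function jet_n0"
  "real_polynomial_function jet_n1"
  "real_polynomial_function jet_n2"
  "real_polynomial_function jet_a"
  "real_polynomial_function jet_a1"
  "real_polynomial_function jet_a2"
  unfolding jet_coord_defs
  by (intro real_polynomial_function.intros(1);
      (rule bounded_linear_compose[OF bounded_linear_fst] bounded_linear_compose[OF bounded_linear_snd]
        bounded_linear_ident)+)+

lemma poly_family_add_max:
  "poly_family d P \<Longrightarrow> poly_family e Q \<Longrightarrow> poly_family (max d e) (\<lambda>x. P x + Q x)"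
  by (intro poly_family_add) (auto elim: poly_family_mono)

lemma poly_family_diff_max:
  "poly_family d P \<Longrightarrow> poly_family e Q \<Longrightarrow> poly_family (max d e) (\<lambda>x. P x - Q x)"
  by (intro poly_family_diff) (auto elim: poly_family_mono)

lemmas poly_family_intros = real_polynomial_function_jet_coords poly_family_coeff_const poly_family_pCons
  poly_family_add_max poly_family_diff_max poly_family_power poly_family_mult
  real_polynomial_function.intros(2) real_polynomial_function_minus real_polynomial_function_power
  real_polynomial_function_divide real_polynomial_function.intros(3,4)

text \<open>The introduction rules assemble a bound from sums, multiples and maxima;
  \<open>poly_family_mono\<close> leaves its comparison with the stated number to
  \<open>simp\<close>. The later families follow the same scheme and reuse the earlier
  bounds.\<close>

lemma poly_family_w: "poly_family 2 fam_w"
  unfolding fam_w_def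
  by (rule poly_family_mono, (rule poly_family_intros)+) simp

lemma poly_family_k0: "poly_family 2 fam_k0"
  unfolding fam_k0_def
  by (rule poly_family_mono, (rule poly_family_w poly_family_intros)+) simp

lemma poly_family_dk0: "poly_family 1 fam_dk0"
  unfolding fam_dk0_def
  by (rule poly_family_mono, (rule poly_family_w poly_family_k0 poly_family_intros)+) simp

lemma poly_family_z1: "poly_family 2 fam_z1"
  unfolding fam_z1_def
  by (rule poly_family_mono, (rule poly_family_w poly_family_k0 poly_family_dk0 poly_family_intros)+) simp

lemma poly_family_z2: "poly_family 3 fam_z2"
  unfolding fam_z2_def
  by (rule poly_family_mono, (rule poly_family_w poly_family_k0 poly_family_dk0 poly_family_z1 poly_family_intros)+) simp

lemma poly_family_X2: "poly_family 3 fam_X2"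
  unfolding fam_X2_def
  by (rule poly_family_mono, (rule poly_family_w poly_family_k0 poly_family_dk0 poly_family_z1 poly_family_z2 poly_family_intros)+) simp

lemma poly_family_k1: "poly_family 4 fam_k1"
  unfolding fam_k1_def
  by (rule poly_family_mono, (rule poly_family_w poly_family_k0 poly_family_dk0 poly_family_z1 poly_family_z2 poly_family_X2 poly_family_intros)+) simp

lemma poly_family_ak2: "poly_family 6 fam_ak2"
  unfolding fam_ak2_def
  by (rule poly_family_mono, (rule poly_family_w poly_family_k0 poly_family_dk0 poly_family_z1 poly_family_z2 poly_family_X2 poly_family_k1 poly_family_intros)+) simp

lemma poly_family_tau: "poly_family 3 fam_tau"
  unfolding fam_tau_def
  by (rule poly_family_mono, (rule poly_family_w poly_family_k0 poly_family_dk0 poly_family_z1 poly_family_z2 poly_family_X2 poly_family_k1 poly_family_ak2 poly_family_intros)+) simp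

lemma poly_family_V: "poly_family 3 fam_V"
  unfolding fam_V_def
  by (rule poly_family_mono, (rule poly_family_w poly_family_k0 poly_family_dk0 poly_family_z1 poly_family_z2 poly_family_X2 poly_family_k1 poly_family_ak2 poly_family_tau poly_family_intros)+) simp

lemma poly_family_X: "poly_family 4 fam_X"
  unfolding fam_X_def
  by (rule poly_family_mono, (rule poly_family_w poly_family_k0 poly_family_dk0 poly_family_z1 poly_family_z2 poly_family_X2 poly_family_k1 poly_family_ak2 poly_family_tau poly_family_V poly_family_intros)+) simp

lemma poly_family_P: "poly_family 8 fam_P"
  unfolding fam_P_def
  by (rule poly_family_mono, (rule poly_family_w poly_family_k0 poly_family_dk0 poly_family_z1 poly_family_z2 poly_family_X2 poly_family_k1 poly_family_ak2 poly_family_tau poly_family_V poly_family_X poly_family_intros)+) simp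

lemma poly_family_Q: "poly_family 7 fam_Q"
  unfolding fam_Q_def
  by (rule poly_family_mono, (rule poly_family_w poly_family_k0 poly_family_dk0 poly_family_z1 poly_family_z2 poly_family_X2 poly_family_k1 poly_family_ak2 poly_family_tau poly_family_V poly_family_X poly_family_P poly_family_intros)+) simp

lemma poly_family_H: "poly_family 8 fam_H"
  unfolding fam_H_def
  by (rule poly_family_mono, (rule poly_family_w poly_family_k0 poly_family_dk0 poly_family_z1 poly_family_z2 poly_family_X2 poly_family_k1 poly_family_ak2 poly_family_tau poly_family_V poly_family_X poly_family_P poly_family_Q poly_family_intros)+) simp

lemma poly_family_c: "poly_family 4 fam_c"
  unfolding fam_c_def
  by (rule poly_family_mono, (rule poly_family_w poly_family_k0 poly_family_dk0 poly_family_z1 poly_family_z2 poly_family_X2 poly_family_k1 poly_family_ak2 poly_family_tau poly_family_V poly_family_X poly_family_P poly_family_Q poly_family_H poly_family_intros)+) simp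

lemma poly_family_uxv: "poly_family 6 fam_uxv"
  unfolding fam_uxv_def
  by (rule poly_family_mono, (rule poly_family_w poly_family_k0 poly_family_dk0 poly_family_z1 poly_family_z2 poly_family_X2 poly_family_k1 poly_family_ak2 poly_family_tau poly_family_V poly_family_X poly_family_P poly_family_Q poly_family_H poly_family_c poly_family_intros)+) simp

lemma poly_family_uv: "poly_family 7 fam_uv"
  unfolding fam_uv_def
  by (rule poly_family_mono, (rule poly_family_w poly_family_k0 poly_family_dk0 poly_family_z1 poly_family_z2 poly_family_X2 poly_family_k1 poly_family_ak2 poly_family_tau poly_family_V poly_family_X poly_family_P poly_family_Q poly_family_H poly_family_c poly_family_uxv poly_family_intros)+) simp

lemma poly_family_sv: "poly_family 11 fam_sv"
  unfolding fam_sv_def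
  by (rule poly_family_mono, (rule poly_family_w poly_family_k0 poly_family_dk0 poly_family_z1 poly_family_z2 poly_family_X2 poly_family_k1 poly_family_ak2 poly_family_tau poly_family_V poly_family_X poly_family_P poly_family_Q poly_family_H poly_family_c poly_family_uxv poly_family_uv poly_family_intros)+) simp

lemma poly_family_vxs: "poly_family 10 fam_vxs"
  unfolding fam_vxs_def
  by (rule poly_family_mono, (rule poly_family_w poly_family_k0 poly_family_dk0 poly_family_z1 poly_family_z2 poly_family_X2 poly_family_k1 poly_family_ak2 poly_family_tau poly_family_V poly_family_X poly_family_P poly_family_Q poly_family_H poly_family_c poly_family_uxv poly_family_uv poly_family_sv poly_family_intros)+) simp

lemma poly_family_uxs: "poly_family 13 fam_uxs"
  unfolding fam_uxs_def
  by (rule poly_family_mono, (rule poly_family_w poly_family_k0 poly_family_dk0 poly_family_z1 poly_family_z2 poly_family_X2 poly_family_k1 poly_family_ak2 poly_family_tau poly_family_V poly_family_X poly_family_P poly_family_Q poly_family_H poly_family_c poly_family_uxv poly_family_uv poly_family_sv poly_family_vxs poly_family_intros)+) simp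

text \<open>The bounds of the two products agree: 4 + 10 and 8 + 6.\<close>

lemma poly_family_rn: "poly_family 14 fam_rn"
  unfolding fam_rn_def
  by (rule poly_family_mono, (rule poly_family_w poly_family_k0 poly_family_dk0 poly_family_z1 poly_family_z2 poly_family_X2 poly_family_k1 poly_family_ak2 poly_family_tau poly_family_V poly_family_X poly_family_P poly_family_Q poly_family_H poly_family_c poly_family_uxv poly_family_uv poly_family_sv poly_family_vxs poly_family_uxs poly_family_intros)+) simp

text \<open>All three products have the same bound: 4 + 4 + 11, 4 + 8 + 7 and 13 + 6.\<close>

lemma poly_family_rg: "poly_family 19 fam_rg"
  unfolding fam_rg_def
  by (rule poly_family_mono, (rule poly_family_w poly_family_k0 poly_family_dk0 poly_family_z1 poly_family_z2 poly_family_X2 poly_family_k1 poly_family_ak2 poly_family_tau poly_family_V poly_family_X poly_family_P poly_family_Q poly_family_H poly_family_c poly_family_uxv poly_family_uv poly_family_sv poly_family_vxs poly_family_uxs poly_family_rn poly_family_intros)+) simp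

text \<open>At this jet, \<open>fam_rn\<close> has degree exactly 14, \<open>fam_rg\<close> has degree exactly 19, and both are squarefree.
  The Bezout identities below are outputs of the extended Euclidean algorithm.\<close>

definition sample_jet :: jet_coords where
  "sample_jet = ((1, 0, 0), (0, 0, 0), (0, 0), (0, 0, 0), (1, 1, 0))"

lemma sample_jet_coords:
  "jet_p0 sample_jet = 1"
  "jet_p1 sample_jet = 0"
  "jet_p2 sample_jet = 0"
  "jet_q0 sample_jet = 0"
  "jet_q1 sample_jet = 0"
  "jet_q2 sample_jet = 0"
  "jet_m0 sample_jet = 0"
  "jet_m1 sample_jet = 0"
  "jet_n0 sample_jet = 0"
  "jet_n1 sample_jet = 0"
  "jet_n2 sample_jet = 0"
  "jet_a sample_jet = 1"
  "jet_a1 sample_jet = 1"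
  "jet_a2 sample_jet = 0"
  by (simp_all add: sample_jet_def jet_coord_defs)

section \<open>Evaluation of the families at the sample jet\<close>

lemma sample_w: "fam_w sample_jet = [:1, 0, 4:]"
  by (simp add: fam_w_def sample_jet_coords power2_eq_square power3_eq_cube)

lemma sample_k0: "fam_k0 sample_jet = [:-2, 0, 2:]"
  by (simp add: fam_k0_def sample_jet_coords sample_w power2_eq_square power3_eq_cube)

lemma sample_dk0: "fam_dk0 sample_jet = [:0, 4:]"
  by (simp add: fam_dk0_def sample_jet_coords sample_w sample_k0 power2_eq_square power3_eq_cube)

lemma sample_z1: "fam_z1 sample_jet = [:1:]"
  by (simp add: fam_z1_def sample_jet_coords sample_w sample_k0 sample_dk0 power2_eq_square power3_eq_cube)

lemma sample_z2: "fam_z2 sample_jet = 0"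
  by (simp add: fam_z2_def sample_jet_coords sample_w sample_k0 sample_dk0 sample_z1 power2_eq_square power3_eq_cube)

lemma sample_X2: "fam_X2 sample_jet = [:2, 0, -4:]"
  by (simp add: fam_X2_def sample_jet_coords sample_w sample_k0 sample_dk0 sample_z1 sample_z2 power2_eq_square power3_eq_cube)

lemma sample_k1: "fam_k1 sample_jet = [:-2, 0, 10:]"
  by (simp add: fam_k1_def sample_jet_coords sample_w sample_k0 sample_dk0 sample_z1 sample_z2 sample_X2 power2_eq_square power3_eq_cube)

lemma sample_ak2: "fam_ak2 sample_jet = [:8, 0, 18, 0, -16, 0, -8:]"
  by (simp add: fam_ak2_def sample_jet_coords sample_w sample_k0 sample_dk0 sample_z1 sample_z2 sample_X2 sample_k1 power2_eq_square power3_eq_cube)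

lemma sample_tau: "fam_tau sample_jet = [:0, 3, 0, 2:]"
  by (simp add: fam_tau_def sample_jet_coords sample_w sample_k0 sample_dk0 sample_z1 sample_z2 sample_X2 sample_k1 sample_ak2 power2_eq_square power3_eq_cube)

lemma sample_V: "fam_V sample_jet = [:0, 12, 0, 8:]"
  by (simp add: fam_V_def sample_jet_coords sample_w sample_k0 sample_dk0 sample_z1 sample_z2 sample_X2 sample_k1 sample_ak2 sample_tau power2_eq_square power3_eq_cube)

lemma sample_X: "fam_X sample_jet = [:-3, 0, 12, 0, -4:]"
  by (simp add: fam_X_def sample_jet_coords sample_w sample_k0 sample_dk0 sample_z1 sample_z2 sample_X2 sample_k1 sample_ak2 sample_tau sample_V power2_eq_square power3_eq_cube)

lemma sample_P: "fam_P sample_jet = [:17, 0, 13, 0, 84, 0, -80, 0, -32:]"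
  by (simp add: fam_P_def sample_jet_coords sample_w sample_k0 sample_dk0 sample_z1 sample_z2 sample_X2 sample_k1 sample_ak2 sample_tau sample_V sample_X power2_eq_square power3_eq_cube)

lemma sample_Q: "fam_Q sample_jet = [:0, 7, 0, -6, 0, 8:]"
  by (simp add: fam_Q_def sample_jet_coords sample_w sample_k0 sample_dk0 sample_z1 sample_z2 sample_X2 sample_k1 sample_ak2 sample_tau sample_V sample_X sample_P power2_eq_square power3_eq_cube)

lemma sample_H: "fam_H sample_jet = [:0, 0, -12, 0, 124, 0, -112:]"
  by (simp add: fam_H_def sample_jet_coords sample_w sample_k0 sample_dk0 sample_z1 sample_z2 sample_X2 sample_k1 sample_ak2 sample_tau sample_V sample_X sample_P sample_Q power2_eq_square power3_eq_cube)

lemma sample_c: "fam_c sample_jet = [:0, 0, 12:]"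
  by (simp add: fam_c_def sample_jet_coords sample_w sample_k0 sample_dk0 sample_z1 sample_z2 sample_X2 sample_k1 sample_ak2 sample_tau sample_V sample_X sample_P sample_Q sample_H power2_eq_square power3_eq_cube)

lemma sample_uxv: "fam_uxv sample_jet = [:0, 0, -48, 0, 48:]"
  by (simp add: fam_uxv_def sample_jet_coords sample_w sample_k0 sample_dk0 sample_z1 sample_z2 sample_X2 sample_k1 sample_ak2 sample_tau sample_V sample_X sample_P sample_Q sample_H sample_c power2_eq_square power3_eq_cube)

lemma sample_uv: "fam_uv sample_jet = [:0, -16, 0, 96, 0, 80:]"
  by (simp add: fam_uv_def sample_jet_coords sample_w sample_k0 sample_dk0 sample_z1 sample_z2 sample_X2 sample_k1 sample_ak2 sample_tau sample_V sample_X sample_P sample_Q sample_H sample_c sample_uxv power2_eq_square power3_eq_cube)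

lemma sample_sv: "fam_sv sample_jet = [:0, 184, 0, 352, 0, 1040, 0, -256, 0, -1024, 0, -256:]"
  by (simp add: fam_sv_def sample_jet_coords sample_w sample_k0 sample_dk0 sample_z1 sample_z2 sample_X2 sample_k1 sample_ak2 sample_tau sample_V sample_X sample_P sample_Q sample_H sample_c sample_uxv sample_uv power2_eq_square power3_eq_cube)

lemma sample_vxs: "fam_vxs sample_jet = [:-60, 0, -52, 0, -292, 0, 608, 0, -256, 0, -128:]"
  by (simp add: fam_vxs_def sample_jet_coords sample_w sample_k0 sample_dk0 sample_z1 sample_z2 sample_X2 sample_k1 sample_ak2 sample_tau sample_V sample_X sample_P sample_Q sample_H sample_c sample_uxv sample_uv sample_sv power2_eq_square power3_eq_cube)

lemma sample_uxs: "fam_uxs sample_jet = [:0, -60, 0, -64, 0, 68, 0, 416, 0, 128, 0, -128:]"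
  by (simp add: fam_uxs_def sample_jet_coords sample_w sample_k0 sample_dk0 sample_z1 sample_z2 sample_X2 sample_k1 sample_ak2 sample_tau sample_V sample_X sample_P sample_Q sample_H sample_c sample_uxv sample_uv sample_sv sample_vxs power2_eq_square power3_eq_cube)

lemma sample_rn: "fam_rn sample_jet = [:180, 0, -564, 0, -84, 0, 1408, 0, -2096, 0, 256, 0, -512, 0, 512:]"
  by (simp add: fam_rn_def sample_jet_coords sample_w sample_k0 sample_dk0 sample_z1 sample_z2 sample_X2 sample_k1 sample_ak2 sample_tau sample_V sample_X sample_P sample_Q sample_H sample_c sample_uxv sample_uv sample_sv sample_vxs sample_uxs power2_eq_square power3_eq_cube)

lemma sample_rg: "fam_rg sample_jet = [:0, 1656, 0, -6624, 0, 3408, 0, 34560, 0, -31488, 0, -17920, 0, 4096, 0, 9216, 0, 8192, 0, -4096:]"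
  by (simp add: fam_rg_def sample_jet_coords sample_w sample_k0 sample_dk0 sample_z1 sample_z2 sample_X2 sample_k1 sample_ak2 sample_tau sample_V sample_X sample_P sample_Q sample_H sample_c sample_uxv sample_uv sample_sv sample_vxs sample_uxs sample_rn power2_eq_square power3_eq_cube)

lemma bezout_rn:
  "[:23316112735661956098090, 0, -14552959196099573003076, 0, -27727138508106629295168, 0, 477077450961913168851808, 0, -31905656265703932621568, 0, 85015932057015931145472, 0, -210137851935170243128576:]
     * fam_rn sample_jet
   + [:0, -13980337090612824804855, 0, 5279985680666020144323, 0, 13903918143439699392076, 0, -59832326957671800977060, 0, 3452808357658563352192, 0, -8216830370757977154560, 0, 15009846566797874509184:]
     * pderiv (fam_rn sample_jet) = [:4196900292419152097656200:]"
  by (simp add: sample_rn pderiv_pCons)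

lemma bezout_rg:
  "[:0, 79467768484511809463227709452280061, 0, 22667422725728405883320003377009419, 0, -706026123787545392958652561295024256, 0, 559910217339547707488492304594571824, 0, 499187476026865255018959669968127232, 0, -32576111605193054386860936014815808, 0, -256251437026463367248567006696274240, 0, -349946514421528311476019193180640000, 0, 174471754446333649050484948644925184:]
     * fam_rg sample_jet
   + [:4903051940480978453048478750133650, 0, -20631145198740068026645964450676261, 0, -2821785052873501765587114520857807, 0, 95311588349549582963026826877539040, 0, -63343947088046946472936164006732720, 0, -44216926213047797141079905219940992, 0, 3520050483110677015521171834381248, 0, 17418524899481200490312598041932992, 0, 20351442636549508349712754750725376, 0, -9182723918228086792130786770785536:]
     * pderiv (fam_rg sample_jet) = [:8119454013436500318248280810221324400:]"
  by (simp add: sample_rg pderiv_pCons)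

subsection \<open>Zeros of the radial curvatures\<close>

text \<open>Orthogonality to \<open>u\<close> and \<open>v\<close> annihilates the cross product of
  \<open>n\<close> with \<open>cross3 u v\<close>; one more cross product then exhibits
  \<open>n\<close> as parallel to it. Zeros of the curvatures can thus be tested on the unnormalized
  vector, whatever the sign of \<open>n\<close>.\<close>

lemma unit_normal_multiple_of_cross:
  fixes u v n :: "real^3"
  assumes "cross3 u v \<noteq> 0" "norm n = 1" "n \<bullet> u = 0" "n \<bullet> v = 0"
  shows "\<exists>l. l \<noteq> 0 \<and> n = l *\<^sub>R cross3 u v"
proof -
  let ?p = "cross3 u v"
  have "cross3 n ?p = 0"
    using assms(3,4) by (simp add: Lagrange)
  then have "cross3 ?p (cross3 n ?p) = 0"
    by simp
  then have "(?p \<bullet> ?p) *\<^sub>R n = (?p \<bullet> n) *\<^sub>R ?p"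
    by (simp only: Lagrange[of ?p n ?p] right_minus_eq)
  moreover have p: "?p \<bullet> ?p \<noteq> 0"
    using assms(1) by simp
  ultimately have "n = ((?p \<bullet> n) / (?p \<bullet> ?p)) *\<^sub>R ?p"
    by (metis divideR_right divide_inverse_commute scaleR_scaleR)
  then show ?thesis
    using assms(2) by (metis norm_zero scaleR_zero_left zero_neq_one)
qed

context umbrella_normal_form
begin

definition jet :: jet_coords where
  "jet = ((p0, p1, p2), (q0, q1, q2), (m0, m1), (n0, n1, n2), (a0, a1, a2))"

lemma jet_eq: "(jet2 f21, jet2 f31, jet1 f321, jet1_2var f322, jet2 f331) = jet"
  using smooth_coefficients by (simp add: jet_def jet2_eq_rderiv jet1_2var_def zero_prod_def)

lemma jet_coords:
  "jet_p0 jet = p0" "jet_p1 jet = p1" "jet_p2 jet = p2" "jet_q0 jet = q0" "jet_q1 jet = q1" "jet_q2 jet = q2"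
  "jet_m0 jet = m0" "jet_m1 jet = m1" "jet_n0 jet = n0" "jet_n1 jet = n1" "jet_n2 jet = n2"
  "jet_a jet = a0" "jet_a1 jet = a1" "jet_a2 jet = a2"
  by (simp_all add: jet_def jet_coord_defs)

text \<open>The two conditions on the jet make \<open>h\<close> an immersion along the exceptional
  set, so \<open>n \<theta>\<close> is a nonzero multiple of the cross product of the partial
  derivatives. What separates the curvatures from the polynomial numerators are then factors without
  zeros: powers of \<open>w\<close>, \<open>cos \<theta>\<close> and \<open>1 + t\<^sup>2\<close>,
  together with \<open>a0\<close>.\<close>

lemma radial_curvature_zeros:
  assumes surface: "principal_curvature_surface f h" and \<theta>: "cos \<theta> \<noteq> 0"
    and n: "unit_normal_at h (0, \<theta>) (n \<theta>)"
    and disc: "q0\<^sup>2 + a0\<^sup>2 * p0 \<noteq> 0"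
    and no_root: "\<forall>t. poly (fam_X jet) t = 0 \<longrightarrow> poly (fam_c jet) t \<noteq> 0"
  shows "pd1 h (0, \<theta>) \<noteq> 0"
    "radial_geodesic_curvature h n \<theta> = 0 \<longleftrightarrow> poly (fam_rg jet) (tan \<theta>) = 0"
    "radial_normal_curvature h n \<theta> = 0 \<longleftrightarrow> poly (fam_rn jet) (tan \<theta>) = 0"
proof -
  define t where "t = tan \<theta>"
  have nz: "a0 \<noteq> 0" using f331_pos by simp
  define w k0 k0' z1 z2 X2 k1 k2 where "w = poly (fam_w jet) t" and "k0 = poly (fam_k0 jet) t"
    and "k0' = poly (fam_dk0 jet) t" and "z1 = poly (fam_z1 jet) t" and "z2 = poly (fam_z2 jet) t"
    and "X2 = poly (fam_X2 jet) t" and "k1 = poly (fam_k1 jet) t" and "k2 = poly (fam_ak2 jet) t / a0"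
  note def0 = this
  define w2 where "w2 = k0\<^sup>2 + z1\<^sup>2 + 2 * a0 * z2"
  have ak2: "a0 * k2 = poly (fam_ak2 jet) t" using nz by (simp add: def0)
  have w: "w = a0\<^sup>2 + 4 * t\<^sup>2"
    by (simp add: def0 fam_w_def jet_coords power2_eq_square)
  have k0: "k0 = 2 * (a0 * t\<^sup>2 + 2 * q0 * t - a0 * p0)"
    by (simp add: def0 fam_k0_def jet_coords power2_eq_square algebra_simps)
  have k0': "k0' = 4 * a0 * t + 4 * q0"
    by (simp add: def0 fam_dk0_def jet_coords)
  have z1: "z1 = a1 + 2 * m0 * t + 3 * n0 * t\<^sup>2"
    by (simp add: def0 fam_z1_def jet_coords power2_eq_square algebra_simps)
  have z2: "z2 = a2 + 2 * m1 * t + 3 * n1 * t\<^sup>2 + 4 * n2 * t^3"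
    by (simp add: def0 fam_z2_def jet_coords power2_eq_square power3_eq_cube algebra_simps)
  have X2: "X2 = 2 * p0 * z1 + 3 * p1 * a0 - 2 * t * (3 * q1 + 2 * a1 * t + m0 * t\<^sup>2)"
    by (simp add: def0 fam_X2_def jet_coords power2_eq_square algebra_simps)
  have k1: "k1 = - (6 * a0 * p1 + 2 * p0 * z1) + 2 * t * (6 * q1 + 2 * a1 * t)
        + t\<^sup>2 * (6 * n0 * t\<^sup>2 - 2 * a1) + 2 * t * (4 * a1 * t + 4 * m0 * t\<^sup>2)"
    by (simp add: def0 fam_k1_def jet_coords power2_eq_square algebra_simps)
  have k2: "a0 * k2 = a0 * (2 * t * (12 * q2 + 6 * a2 * t + 2 * m1 * t\<^sup>2) - (12 * a0 * p2 + 6 * p1 * z1 + 2 * p0 * z2)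
        - k0 * (4 * p0\<^sup>2 + (2 * q0 + a0 * t)\<^sup>2)
        + t\<^sup>2 * (2 * t * (2 * m1 + 6 * n1 * t + 12 * n2 * t\<^sup>2) - 2 * z2 - k0 * w)
        + 2 * t * (2 * t * (3 * a2 + 4 * m1 * t + 3 * n1 * t\<^sup>2) - k0 * (4 * t * p0 + a0 * (2 * q0 + a0 * t)))) + 2 * t\<^sup>2 * z1\<^sup>2"
    unfolding ak2 fam_ak2_def poly_add poly_mult poly_diff poly_power def0(1,2,4,5)[symmetric] jet_coords
    by (simp add: power2_eq_square algebra_simps)
  define u s v where "u i = pd1 h (0, \<theta>) $ i / cos \<theta>" and "s i = pd1 (pd1 h) (0, \<theta>) $ i / (2 * (cos \<theta>)\<^sup>2)"
    and "v i = pd2 h (0, \<theta>) $ i / (1 + t\<^sup>2)" for i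
  have t2: "1 + t\<^sup>2 > 0" by (intro add_pos_nonneg) auto
  have us: "pd1 h (0, \<theta>) $ i = cos \<theta> * u i" "pd1 (pd1 h) (0, \<theta>) $ i = 2 * (cos \<theta>)\<^sup>2 * s i"
    "pd2 h (0, \<theta>) $ i = (1 + t\<^sup>2) * v i" for i
    using \<theta> t2 by (simp_all add: u_def s_def v_def)
  have v: "v 1 = 0" "v 2 = - a0 * (k0' * w - 8 * t * k0) / w\<^sup>2" "v 3 = (2 * (k0 + t * k0') * w - 16 * t\<^sup>2 * k0) / w\<^sup>2"
    using t2 pd2_principal_curvature_surface_exc[OF surface \<theta>, folded t_def, folded k0 k0' w]
    by (simp_all add: v_def)
  have k0y: "k0 = 2 * (2 * t * (q0 + a0 * t) - a0 * (p0 + t\<^sup>2))"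
    unfolding k0 by (simp add: power2_eq_square algebra_simps)
  note numerators = radial_curvature_numerators[OF nz w w2_def k0y
      principal_curvature_surface_jet[OF surface \<theta> t_def z1 z2 X2 w w2_def k0 k1 k2 u_def s_def] v(2,3),
      where X = "poly (fam_X jet) t" and V = "poly (fam_V jet) t" and P = "poly (fam_P jet) t"
        and Q = "poly (fam_Q jet) t" and H = "poly (fam_H jet) t" and uxv = "poly (fam_uxv jet) t"
        and uv = "poly (fam_uv jet) t" and sv = "poly (fam_sv jet) t" and vxs = "poly (fam_vxs jet) t"
        and uxs = "poly (fam_uxs jet) t"]
  have eval:
    "poly (fam_X jet) t = w - k0\<^sup>2" "poly (fam_V jet) t = k0' * w - 4 * t * k0"
    "poly (fam_P jet) t = w * (a0 * k0 / 2 + a0 * k2) - a0 * (a0 * k1 * z1 + a0 * k0 * z2 + k0^3)"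
    "poly (fam_Q jet) t = a0 * (w * (2 * t * (p0 + t\<^sup>2) + a0 * (q0 + a0 * t)) - 2 * t * (k1 * z1 + k0 * z2))"
    "poly (fam_H jet) t = a0 * (w * k0 * (X2 - k1) + 2 * a0 * k0\<^sup>2 * z1)"
    "poly (fam_uxv jet) t = 2 * k0 * (a0 * k1 + (t * k0' - k0) * z1)"
    "poly (fam_uv jet) t = k1 * poly (fam_V jet) t - a0 * k0 * k0' * z1"
    "poly (fam_sv jet) t = poly (fam_P jet) t * poly (fam_V jet) t
      + a0 * (k0 * (a0\<^sup>2 - 4 * t\<^sup>2) * z1\<^sup>2 * k0' + 4 * t * k0\<^sup>2 * z1\<^sup>2) + 2 * a0 * k0 * poly (fam_Q jet) t"
    "poly (fam_vxs jet) t = 2 * a0 * k0 * poly (fam_P jet) t + 2 * a0\<^sup>2 * k0\<^sup>2 * z1\<^sup>2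
      - poly (fam_Q jet) t * poly (fam_V jet) t - 4 * a0\<^sup>2 * t * k0 * k0' * z1\<^sup>2"
    "poly (fam_uxs jet) t = k1 * (w * poly (fam_Q jet) t + 4 * a0\<^sup>2 * t * k0 * z1\<^sup>2) - a0 * k0 * z1 * poly (fam_Q jet) t
      - 2 * a0 * t * k0\<^sup>2 * z1^3 + 2 * t * k0 * z1 * poly (fam_P jet) t"
    unfolding fam_X_def fam_V_def fam_P_def fam_Q_def fam_H_def fam_uxv_def fam_c_def fam_uv_def fam_sv_def
      fam_vxs_def fam_uxs_def fam_tau_def poly_add poly_mult poly_diff poly_power jet_coords
      def0(1-7)[symmetric] ak2[symmetric]
    by (simp_all add: power2_eq_square algebra_simps)
  note numerators = numerators[OF eval]
  have rn: "poly (fam_rn jet) t = poly (fam_X jet) t * poly (fam_vxs jet) t - poly (fam_H jet) t * poly (fam_uxv jet) t"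
    and rg: "poly (fam_rg jet) t = poly (fam_X jet) t * (poly (fam_X jet) t * poly (fam_sv jet) t - poly (fam_H jet) t * poly (fam_uv jet) t)
      + poly (fam_uxs jet) t * poly (fam_uxv jet) t"
    by (simp_all add: fam_rn_def fam_rg_def)
  have "w > 0" unfolding w using nz by (intro add_pos_nonneg) auto
  \<comment> \<open>\<open>k0'\<close> is the derivative of the quadratic \<open>k0\<close> in
    \<open>t\<close>, and \<open>disc\<close> says that \<open>k0\<close> has no double root; hence
    the derivative of \<open>h\<close> along the exceptional set does not vanish.\<close>
  have v_nz: "\<not> (v 2 = 0 \<and> v 3 = 0)"
  proof
    assume "v 2 = 0 \<and> v 3 = 0"
    then have "k0 = 0" "k0' = 0" using numerators(5) by auto
    then have "a0 * t = - q0" "a0 * t\<^sup>2 + 2 * q0 * t - a0 * p0 = 0" unfolding k0 k0' by simp_all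
    moreover have "a0 * (a0 * t\<^sup>2 + 2 * q0 * t - a0 * p0) = (a0 * t)\<^sup>2 + 2 * q0 * (a0 * t) - a0\<^sup>2 * p0"
      by (simp add: power2_eq_square algebra_simps)
    ultimately have "(- q0)\<^sup>2 + 2 * q0 * (- q0) - a0\<^sup>2 * p0 = 0" by simp
    then show False using disc by (simp add: power2_eq_square algebra_simps)
  qed
  let ?u = "pd1 h (0, \<theta>)" and ?v = "pd2 h (0, \<theta>)" and ?s = "pd1 (pd1 h) (0, \<theta>)"
  have cross: "cross3 ?u ?v \<noteq> 0"
  proof
    assume c0: "cross3 ?u ?v = 0"
    have comp: "cross3 ?u ?v $ 1 = cos \<theta> * (1 + t\<^sup>2) * (u 2 * v 3 - u 3 * v 2)"
      "cross3 ?u ?v $ 2 = - (cos \<theta> * (1 + t\<^sup>2) * (u 1 * v 3))" "cross3 ?u ?v $ 3 = cos \<theta> * (1 + t\<^sup>2) * (u 1 * v 2)"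
      by (simp_all add: cross_components us v(1) algebra_simps)
    from comp c0 \<theta> t2 have "u 2 * v 3 - u 3 * v 2 = 0" "u 1 * v 3 = 0" "u 1 * v 2 = 0"
      by auto
    then have "poly (fam_X jet) t = 0" "poly (fam_uxv jet) t = 0"
      using v_nz numerators(1,2) by auto
    \<comment> \<open>Where \<open>fam_X\<close> vanishes, \<open>k0\<^sup>2\<close> equals the
      positive number \<open>w\<close>. A common zero of \<open>fam_X\<close> and
      \<open>fam_uxv\<close> must therefore be a zero of \<open>fam_c\<close>.\<close>
    moreover have "k0 \<noteq> 0" using \<open>w > 0\<close> eval(1) calculation(1) by auto
    ultimately have "poly (fam_c jet) t = 0"
      by (simp add: fam_uxv_def def0)
    then show False using no_root \<open>poly (fam_X jet) t = 0\<close> by blast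
  qed
  then show u_nz: "?u \<noteq> 0" by auto
  obtain l where l: "l \<noteq> 0" "n \<theta> = l *\<^sub>R cross3 ?u ?v"
    using unit_normal_multiple_of_cross[OF cross] n unfolding unit_normal_at_def by blast
  have "?s \<bullet> cross3 ?u ?v = 2 * (cos \<theta>)^3 * (1 + t\<^sup>2) * (s 1 * (u 2 * v 3 - u 3 * v 2) + u 1 * (v 2 * s 3 - v 3 * s 2))"
    unfolding inner_vec_def sum_3 cross_components us v(1) inner_real_def
    by (simp add: power2_eq_square power3_eq_cube algebra_simps)
  moreover have "radial_normal_curvature h n \<theta> = 0 \<longleftrightarrow> ?s \<bullet> cross3 ?u ?v = 0"
    using l u_nz by (simp add: radial_normal_curvature_def)
  moreover have "a0 * w^4 \<noteq> 0" "2 * (cos \<theta>)^3 * (1 + t\<^sup>2) \<noteq> 0"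
    using nz \<open>w > 0\<close> \<theta> t2 by auto
  ultimately show "radial_normal_curvature h n \<theta> = 0 \<longleftrightarrow> poly (fam_rn jet) (tan \<theta>) = 0"
    unfolding t_def[symmetric] rn numerators(3)[symmetric] by (metis mult_eq_0_iff)
  have "det (vector [?u, ?s, cross3 ?u ?v] :: real^3^3) = 2 * (cos \<theta>)^4 * (1 + t\<^sup>2) *
     ((u 1)\<^sup>2 * (s 2 * v 2 + s 3 * v 3) - u 1 * s 1 * (u 2 * v 2 + u 3 * v 3) + (u 2 * s 3 - u 3 * s 2) * (u 2 * v 3 - u 3 * v 2))"
    unfolding dot_cross_det[symmetric] inner_vec_def sum_3 cross_components us v(1) inner_real_def
    by (simp add: power2_eq_square power4_eq_xxxx algebra_simps)
  moreover have "det (vector [?u, ?s, n \<theta>] :: real^3^3) = l * det (vector [?u, ?s, cross3 ?u ?v] :: real^3^3)"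
    unfolding l(2) dot_cross_det[symmetric] by (simp add: cross_mult_right)
  then have "radial_geodesic_curvature h n \<theta> = 0 \<longleftrightarrow> det (vector [?u, ?s, cross3 ?u ?v] :: real^3^3) = 0"
    using l u_nz by (simp add: radial_geodesic_curvature_def)
  moreover have "a0 * w^5 \<noteq> 0" "2 * (cos \<theta>)^4 * (1 + t\<^sup>2) \<noteq> 0"
    using nz \<open>w > 0\<close> \<theta> t2 by auto
  ultimately show "radial_geodesic_curvature h n \<theta> = 0 \<longleftrightarrow> poly (fam_rg jet) (tan \<theta>) = 0"
    unfolding t_def[symmetric] rg numerators(4)[symmetric] by (metis mult_eq_0_iff)
qed

end

text \<open>At \<open>r = 0\<close> the relation identifies angles that differ by a multiple of
  \<open>pi\<close>, so a point with nonzero cosine is determined by its tangent. The map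
  \<open>g\<close> chooses the representative \<open>arctan t\<close> and is injective.\<close>

lemma card_zeros_exc:
  assumes "\<And>\<theta>. cos \<theta> \<noteq> 0 \<Longrightarrow> c \<theta> = 0 \<longleftrightarrow> P (tan \<theta>)"
  shows "finite (zeros_exc c) \<longleftrightarrow> finite {t. P t}" "card (zeros_exc c) = card {t. P t}"
proof -
  define g where "g t = blowup_rel `` {(0, arctan t)}" for t
  have "inj g"
  proof
    fix t t' assume "g t = g t'"
    then have "((0, arctan t), (0, arctan t')) \<in> blowup_rel"
      unfolding g_def using equiv_blowup_rel eq_equiv_class by fastforce
    then obtain k :: int where "arctan t' = arctan t + of_int k * pi"
      by (auto simp: blowup_rel_def)
    then have "tan (arctan t') = tan (arctan t)" by simp
    then show "t = t'" by (simp add: tan_arctan)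
  qed
  moreover have "zeros_exc c = g ` {t. P t}"
  proof -
    have "blowup_rel `` {(0, \<theta>)} = g (tan \<theta>)" if "cos \<theta> \<noteq> 0" for \<theta>
    proof -
      let ?\<alpha> = "arctan (tan \<theta>)"
      have "tan \<theta> = tan ?\<alpha>" by (simp add: tan_arctan)
      then have "sin (?\<alpha> - \<theta>) = 0"
        using that cos_arctan_not_zero[of "tan \<theta>"] by (simp add: tan_def sin_diff field_simps)
      then obtain k :: int where "?\<alpha> - \<theta> = of_int k * pi"
        unfolding sin_zero_iff_int2 by blast
      then have "((0, \<theta>), (0, ?\<alpha>)) \<in> blowup_rel"
        by (auto simp: blowup_rel_def intro!: exI[of _ k])
      then show ?thesis
        unfolding g_def using equiv_class_eq[OF equiv_blowup_rel] by blast
    qed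
    then have g: "blowup_rel `` {(0, \<theta>)} = g (tan \<theta>)" if "\<theta> \<in> {\<theta>. cos \<theta> \<noteq> 0 \<and> P (tan \<theta>)}" for \<theta>
      using that by blast
    have "{p \<in> exc_set0. c (snd p) = 0} = Pair 0 ` {\<theta>. cos \<theta> \<noteq> 0 \<and> P (tan \<theta>)}"
      using assms by (auto simp: exc_set0_def)
    then have "zeros_exc c = (\<lambda>\<theta>. blowup_rel `` {(0, \<theta>)}) ` {\<theta>. cos \<theta> \<noteq> 0 \<and> P (tan \<theta>)}"
      by (auto simp: zeros_exc_def quotient_def)
    also have "\<dots> = (\<lambda>\<theta>. g (tan \<theta>)) ` {\<theta>. cos \<theta> \<noteq> 0 \<and> P (tan \<theta>)}"
      using g by (rule image_cong[OF refl])
    also have "\<dots> = g ` {t. P t}"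
    proof -
      have "tan ` {\<theta>. cos \<theta> \<noteq> 0 \<and> P (tan \<theta>)} = {t. P t}"
        by (auto simp: image_iff tan_arctan intro!: exI[of _ "arctan _"])
      then show ?thesis by (metis image_image)
    qed
    finally show ?thesis .
  qed
  ultimately show "finite (zeros_exc c) \<longleftrightarrow> finite {t. P t}" "card (zeros_exc c) = card {t. P t}"
    by (auto simp: finite_image_iff card_image inj_on_subset)
qed

text \<open>\<open>D\<close> is left open so that the simple-root condition of either curvature can
  be inserted. The exceptional set is the zero set of \<open>D\<close> times the two immersion
  conditions, and the sample jet lies outside it. The witness for \<open>x\<close> is the jet of
  \<open>f\<close>.\<close>

lemma generic_radial_curvatures:
  assumes roots: "real_polynomial_function D" "D sample_jet \<noteq> 0"
  obtains A where "algebraic_in_jet_space A" "A \<subset> jet_space"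
    "\<forall>f h n. umbrella_in f (jet_space - A) \<and> principal_curvature_surface f h \<and> unit_normals_exc h n \<longrightarrow>
      radial_nonsingular h \<and>
      (\<exists>x. D x \<noteq> 0 \<and>
        (\<forall>\<theta>. cos \<theta> \<noteq> 0 \<longrightarrow> (radial_geodesic_curvature h n \<theta> = 0 \<longleftrightarrow> poly (fam_rg x) (tan \<theta>) = 0)) \<and>
        (\<forall>\<theta>. cos \<theta> \<noteq> 0 \<longrightarrow> (radial_normal_curvature h n \<theta> = 0 \<longleftrightarrow> poly (fam_rn x) (tan \<theta>) = 0)))"
proof -
  \<comment> \<open>At the sample jet \<open>fam_X\<close> is \<open>- 3 + 12 t^2 - 4 t^4\<close>
    and \<open>fam_c\<close> is \<open>12 t^2\<close>, so division with remainder gives these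
    cofactors.\<close>
  have "[:-1:] * fam_X sample_jet + [:1, 0, - 1 / 3:] * fam_c sample_jet = [:3:]"
    by (simp add: sample_X sample_c)
  then obtain S where S: "real_polynomial_function S" "S sample_jet \<noteq> 0"
    and no_root: "\<And>x t. S x \<noteq> 0 \<Longrightarrow> poly (fam_X x) t = 0 \<Longrightarrow> poly (fam_c x) t \<noteq> 0"
    using generic_no_common_root[OF poly_family_X poly_family_c, of sample_jet "[:-1:]" "[:1, 0, - 1 / 3:]" 3]
    by (auto simp: sample_X)
  \<comment> \<open>Up to a positive constant this is the discriminant of the quadratic
    \<open>fam_k0 x\<close>.\<close>
  define disc where "disc x = (jet_q0 x)\<^sup>2 + (jet_a x)\<^sup>2 * jet_p0 x" for x
  have disc: "real_polynomial_function disc" "disc sample_jet \<noteq> 0"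
    unfolding disc_def
    by (intro real_polynomial_function.intros(3,4) real_polynomial_function_power real_polynomial_function_jet_coords)
      (simp add: sample_jet_coords)
  define p where "p x = D x * (S x * disc x)" for x
  have p: "real_polynomial_function p"
    unfolding p_def by (intro real_polynomial_function.intros(4) roots S disc)
  define A where "A = {x \<in> jet_space. p x = 0}"
  show thesis
  proof (rule that)
    show "algebraic_in_jet_space A"
      unfolding algebraic_in_jet_space_def A_def using p by (intro exI[of _ "{p}"]) auto
    have "sample_jet \<in> jet_space"
      by (simp add: sample_jet_def jet_space_def)
    then show "A \<subset> jet_space"
      using roots S disc by (auto simp: A_def p_def)
    show "\<forall>f h n. umbrella_in f (jet_space - A) \<and> principal_curvature_surface f h \<and> unit_normals_exc h n \<longrightarrow>
        radial_nonsingular h \<and>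
        (\<exists>x. D x \<noteq> 0 \<and>
          (\<forall>\<theta>. cos \<theta> \<noteq> 0 \<longrightarrow> (radial_geodesic_curvature h n \<theta> = 0 \<longleftrightarrow> poly (fam_rg x) (tan \<theta>) = 0)) \<and>
          (\<forall>\<theta>. cos \<theta> \<noteq> 0 \<longrightarrow> (radial_normal_curvature h n \<theta> = 0 \<longleftrightarrow> poly (fam_rn x) (tan \<theta>) = 0)))"
    proof (intro allI impI, elim conjE)
      fix f h n
      assume f: "umbrella_in f (jet_space - A)" and surface: "principal_curvature_surface f h"
        and n: "unit_normals_exc h n"
      obtain f21 f31 f321 f322 f331 where nf: "in_normal_form f f21 f31 f321 f322 f331"
        and x: "(jet2 f21, jet2 f31, jet1 f321, jet1_2var f322, jet2 f331) \<in> jet_space - A"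
        and smooth: "smooth_germ f"
        using f unfolding umbrella_in_def whitney_umbrella_def by blast
      interpret umbrella_normal_form f f21 f31 f321 f331 f322
        using smooth nf by unfold_locales
      have "p jet \<noteq> 0" using x unfolding jet_eq A_def by blast
      then have D: "D jet \<noteq> 0" "S jet \<noteq> 0" "q0\<^sup>2 + a0\<^sup>2 * p0 \<noteq> 0"
        by (auto simp: p_def disc_def jet_coords)
      have n: "unit_normal_at h (0, \<theta>) (n \<theta>)" if "cos \<theta> \<noteq> 0" for \<theta>
        using n that by (simp add: unit_normals_exc_def exc_set0_def)
      have no_root: "\<forall>t. poly (fam_X jet) t = 0 \<longrightarrow> poly (fam_c jet) t \<noteq> 0"
        using no_root[OF D(2)] by blast
      have zeros: "pd1 h (0, \<theta>) \<noteq> 0"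
        "radial_geodesic_curvature h n \<theta> = 0 \<longleftrightarrow> poly (fam_rg jet) (tan \<theta>) = 0"
        "radial_normal_curvature h n \<theta> = 0 \<longleftrightarrow> poly (fam_rn jet) (tan \<theta>) = 0"
        if "cos \<theta> \<noteq> 0" for \<theta>
        using radial_curvature_zeros[where n = n, OF surface that n[OF that] D(3) no_root] .
      show "radial_nonsingular h \<and>
        (\<exists>x. D x \<noteq> 0 \<and>
          (\<forall>\<theta>. cos \<theta> \<noteq> 0 \<longrightarrow> (radial_geodesic_curvature h n \<theta> = 0 \<longleftrightarrow> poly (fam_rg x) (tan \<theta>) = 0)) \<and>
          (\<forall>\<theta>. cos \<theta> \<noteq> 0 \<longrightarrow> (radial_normal_curvature h n \<theta> = 0 \<longleftrightarrow> poly (fam_rn x) (tan \<theta>) = 0)))"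
      proof (intro conjI exI[of _ jet] allI impI D(1))
        show "radial_nonsingular h"
          using zeros(1) by (auto simp: radial_nonsingular_def exc_set0_def)
      qed (rule zeros(2,3); assumption)+
    qed
  qed
qed

text \<open>Both halves run the same argument with different choices of \<open>D\<close>. The degree
  19 is odd, which forces at least one zero and leaves the ten odd counts up to 19; the degree 14 is
  even, which also admits the count 0.\<close>

theorem theorem5p3:
  shows
   "(\<exists>A_rg. algebraic_in_jet_space A_rg \<and> A_rg \<subset> jet_space \<and>
       (\<forall>f h n. umbrella_in f (jet_space - A_rg) \<and> principal_curvature_surface f h \<and>
                unit_normals_exc h n \<longrightarrow>
          radial_nonsingular h \<and>
          finite (zeros_exc (radial_geodesic_curvature h n)) \<and>
          (\<exists>k\<in>{1..10}. card (zeros_exc (radial_geodesic_curvature h n)) = 2 * k - 1))) \<and>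
    (\<exists>A_rn. algebraic_in_jet_space A_rn \<and> A_rn \<subset> jet_space \<and>
       (\<forall>f h n. umbrella_in f (jet_space - A_rn) \<and> principal_curvature_surface f h \<and>
                unit_normals_exc h n \<longrightarrow>
          radial_nonsingular h \<and>
          finite (zeros_exc (radial_normal_curvature h n)) \<and>
          (\<exists>k\<in>{0..7}. card (zeros_exc (radial_normal_curvature h n)) = 2 * k)))"
proof (rule conjI)
  obtain D where D: "real_polynomial_function D" "D sample_jet \<noteq> 0"
    and roots: "\<And>x. D x \<noteq> 0 \<Longrightarrow> finite {t. poly (fam_rg x) t = 0} \<and> card {t. poly (fam_rg x) t = 0} \<le> 19 \<and>
      (even (card {t. poly (fam_rg x) t = 0}) \<longleftrightarrow> even (19::nat))"
    using generic_simple_roots[OF poly_family_rg _ _ bezout_rg] by (auto simp: sample_rg)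
  obtain A where A: "algebraic_in_jet_space A" "A \<subset> jet_space"
    "\<forall>f h n. umbrella_in f (jet_space - A) \<and> principal_curvature_surface f h \<and> unit_normals_exc h n \<longrightarrow>
      radial_nonsingular h \<and>
      (\<exists>x. D x \<noteq> 0 \<and>
        (\<forall>\<theta>. cos \<theta> \<noteq> 0 \<longrightarrow> (radial_geodesic_curvature h n \<theta> = 0 \<longleftrightarrow> poly (fam_rg x) (tan \<theta>) = 0)) \<and>
        (\<forall>\<theta>. cos \<theta> \<noteq> 0 \<longrightarrow> (radial_normal_curvature h n \<theta> = 0 \<longleftrightarrow> poly (fam_rn x) (tan \<theta>) = 0)))"
    by (rule generic_radial_curvatures[OF D]) blast
  have count: "finite (zeros_exc c) \<and> (\<exists>k\<in>{1..10}. card (zeros_exc c) = 2 * k - 1)"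
    if "D x \<noteq> 0" "\<forall>\<theta>. cos \<theta> \<noteq> 0 \<longrightarrow> (c \<theta> = 0 \<longleftrightarrow> poly (fam_rg x) (tan \<theta>) = 0)" for c x
  proof -
    note z = card_zeros_exc[of c "\<lambda>t. poly (fam_rg x) t = 0"]
    have "odd (card (zeros_exc c))" "card (zeros_exc c) \<le> 19" and fin: "finite (zeros_exc c)"
      using roots[OF that(1)] z that(2) by auto
    then obtain m where "card (zeros_exc c) = 2 * m + 1" "m \<le> 9"
      by (auto elim!: oddE)
    then show ?thesis using fin by (auto intro!: bexI[of _ "Suc m"])
  qed
  show "\<exists>A_rg. algebraic_in_jet_space A_rg \<and> A_rg \<subset> jet_space \<and>
       (\<forall>f h n. umbrella_in f (jet_space - A_rg) \<and> principal_curvature_surface f h \<and>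
                unit_normals_exc h n \<longrightarrow>
          radial_nonsingular h \<and>
          finite (zeros_exc (radial_geodesic_curvature h n)) \<and>
          (\<exists>k\<in>{1..10}. card (zeros_exc (radial_geodesic_curvature h n)) = 2 * k - 1))"
  proof (intro exI[of _ A] conjI A(1,2) allI impI)
    fix f h n
    assume "umbrella_in f (jet_space - A) \<and> principal_curvature_surface f h \<and> unit_normals_exc h n"
    note generic = A(3)[rule_format, OF this]
    then show "radial_nonsingular h" by simp
    obtain x where "D x \<noteq> 0" "\<forall>\<theta>. cos \<theta> \<noteq> 0 \<longrightarrow> (radial_geodesic_curvature h n \<theta> = 0 \<longleftrightarrow> poly (fam_rg x) (tan \<theta>) = 0)"
      using generic by blast
    note card = count[OF this]
    then show "finite (zeros_exc (radial_geodesic_curvature h n))" by simp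
    show "\<exists>k\<in>{1..10}. card (zeros_exc (radial_geodesic_curvature h n)) = 2 * k - 1"
      using card by simp
  qed
next
  obtain D where D: "real_polynomial_function D" "D sample_jet \<noteq> 0"
    and roots: "\<And>x. D x \<noteq> 0 \<Longrightarrow> finite {t. poly (fam_rn x) t = 0} \<and> card {t. poly (fam_rn x) t = 0} \<le> 14 \<and>
      (even (card {t. poly (fam_rn x) t = 0}) \<longleftrightarrow> even (14::nat))"
    using generic_simple_roots[OF poly_family_rn _ _ bezout_rn] by (auto simp: sample_rn)
  obtain A where A: "algebraic_in_jet_space A" "A \<subset> jet_space"
    "\<forall>f h n. umbrella_in f (jet_space - A) \<and> principal_curvature_surface f h \<and> unit_normals_exc h n \<longrightarrow>
      radial_nonsingular h \<and>
      (\<exists>x. D x \<noteq> 0 \<and>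
        (\<forall>\<theta>. cos \<theta> \<noteq> 0 \<longrightarrow> (radial_geodesic_curvature h n \<theta> = 0 \<longleftrightarrow> poly (fam_rg x) (tan \<theta>) = 0)) \<and>
        (\<forall>\<theta>. cos \<theta> \<noteq> 0 \<longrightarrow> (radial_normal_curvature h n \<theta> = 0 \<longleftrightarrow> poly (fam_rn x) (tan \<theta>) = 0)))"
    by (rule generic_radial_curvatures[OF D]) blast
  have count: "finite (zeros_exc c) \<and> (\<exists>k\<in>{0..7}. card (zeros_exc c) = 2 * k)"
    if "D x \<noteq> 0" "\<forall>\<theta>. cos \<theta> \<noteq> 0 \<longrightarrow> (c \<theta> = 0 \<longleftrightarrow> poly (fam_rn x) (tan \<theta>) = 0)" for c x
  proof -
    note z = card_zeros_exc[of c "\<lambda>t. poly (fam_rn x) t = 0"]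
    have "even (card (zeros_exc c))" "card (zeros_exc c) \<le> 14" and fin: "finite (zeros_exc c)"
      using roots[OF that(1)] z that(2) by auto
    then obtain m where "card (zeros_exc c) = 2 * m" "m \<le> 7"
      by (auto elim!: evenE)
    then show ?thesis using fin by (auto intro!: bexI[of _ m])
  qed
  show "\<exists>A_rn. algebraic_in_jet_space A_rn \<and> A_rn \<subset> jet_space \<and>
       (\<forall>f h n. umbrella_in f (jet_space - A_rn) \<and> principal_curvature_surface f h \<and>
                unit_normals_exc h n \<longrightarrow>
          radial_nonsingular h \<and>
          finite (zeros_exc (radial_normal_curvature h n)) \<and>
          (\<exists>k\<in>{0..7}. card (zeros_exc (radial_normal_curvature h n)) = 2 * k))"
  proof (intro exI[of _ A] conjI A(1,2) allI impI)
    fix f h n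
    assume "umbrella_in f (jet_space - A) \<and> principal_curvature_surface f h \<and> unit_normals_exc h n"
    note generic = A(3)[rule_format, OF this]
    then show "radial_nonsingular h" by simp
    obtain x where "D x \<noteq> 0" "\<forall>\<theta>. cos \<theta> \<noteq> 0 \<longrightarrow> (radial_normal_curvature h n \<theta> = 0 \<longleftrightarrow> poly (fam_rn x) (tan \<theta>) = 0)"
      using generic by blast
    note card = count[OF this]
    then show "finite (zeros_exc (radial_normal_curvature h n))" by simp
    show "\<exists>k\<in>{0..7}. card (zeros_exc (radial_normal_curvature h n)) = 2 * k"
      using card by simp
  qed
qed

end
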